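(* Let $\mathcal{C}$ and $\mathcal{M}$ be rigid semisimple tensor categories. Let $\Phi:\mathcal{C}\to\mathcal{M}$ be a tensor functor, with right adjoint $\mathrm{Tr}_{\mathcal C}:\mathcal M\to\mathcal C$. If $A$ is a semisimple algebra object in $\mathcal{M}$, then $\mathrm{Tr}_{\mathcal C}(A)$ is a semisimple algebra object in $\mathcal{C}$.
   Context: Categories and functors are linear over a field $k$, with finite-dimensional morphism spaces. Tensor functors are strong monoidal; coherence isomorphisms are suppressed. A tensor category is rigid if every object $a$ has a dual $a^*$ (with $\mathrm{ev}_a:a^*\otimes a\to1$, $\mathrm{coev}_a:1\to a\otimes a^*$ satisfying the zig-zag equations) and every object is isomorphic to the dual of some object. An algebra object is an associative unital triple $(A,m_A,i_A)$; it is semisimple if its category of (left) modules is semisimple. Let $\varepsilon_x:\Phi(\mathrm{Tr}_{\mathcal C}(x))\to x$ and $\eta_c:c\to\mathrm{Tr}_{\mathcal C}(\Phi(c))$ be the counit and unit of $\Phi\dashv\mathrm{Tr}_{\mathcal C}$. For $x,y\in\mathcal M$, $\mu_{x,y}:\mathrm{Tr}_{\mathcal C}(x)\otimes\mathrm{Tr}_{\mathcal C}(y)\to\mathrm{Tr}_{\mathcal C}(x\otimes y)$ is the unique morphism with $\varepsilon_{x\otimes y}\circ\Phi(\mu_{x,y})=\varepsilon_x\otimes\varepsilon_y$. For an algebra $A$ in $\mathcal M$, the object $\mathrm{Tr}_{\mathcal C}(A)$ is an algebra in $\mathcal C$ with multiplication $\mathrm{Tr}_{\mathcal C}(m_A)\circ\mu_{A,A}$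 and unit $\mathrm{Tr}_{\mathcal C}(i_A)\circ\eta_{1}$. *)

theory Defs
  imports Complex_Main
begin

section \<open>Linear categories\<close>

text \<open>
  The morphisms of a category all live in one ambient \<open>k\<close>-vector space \<open>'m\<close>, and each \<open>Hom a b\<close>
  is a subspace of it, so that the library's vector space notions apply.  Every (small)
  \<open>k\<close>-linear category has this form: take for \<open>'m\<close> the direct sum of all its morphism spaces.
  Different morphism spaces need not be disjoint (they all contain \<open>0\<close>, and in categories of modules
  the same underlying morphism occurs between several pairs of objects); sources and targets are
  therefore always given explicitly.  Composition is written in the usual order, \<open>g \<cdot> f\<close> being
  \<open>g\<close> after \<open>f\<close>.
\<close>

record ('o, 'm, 'k) lincat =
  objects :: "'o set" (\<open>Obj\<index>\<close>)
  homs :: "'o \<Rightarrow> 'o \<Rightarrow> 'm set" (\<open>Hom\<index>\<close>)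
  identity :: "'o \<Rightarrow> 'm" (\<open>Idn\<index>\<close>)
  Comp :: "'m \<Rightarrow> 'm \<Rightarrow> 'm" (infixr \<open>\<cdot>\<index>\<close> 70)
  Scale :: "'k \<Rightarrow> 'm \<Rightarrow> 'm"

locale linear_category =
  fixes C :: "('o, 'm::ab_group_add, 'k::field, 'z) lincat_scheme" (structure)
  assumes vector_space_Scale: "vector_space (Scale C)"
    and Hom_subspace: "\<lbrakk>a \<in> Obj; b \<in> Obj\<rbrakk> \<Longrightarrow> module.subspace (Scale C) (Hom a b)"
    and Hom_finite_dim: "\<lbrakk>a \<in> Obj; b \<in> Obj\<rbrakk>
      \<Longrightarrow> \<exists>B. finite B \<and> B \<subseteq> Hom a b \<and> Hom a b \<subseteq> module.span (Scale C) B"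
    and Idn_closed: "a \<in> Obj \<Longrightarrow> Idn a \<in> Hom a a"
    and Comp_closed: "\<lbrakk>a \<in> Obj; b \<in> Obj; c \<in> Obj; f \<in> Hom a b; g \<in> Hom b c\<rbrakk>
      \<Longrightarrow> g \<cdot> f \<in> Hom a c"
    and Comp_Idn_left: "\<lbrakk>a \<in> Obj; b \<in> Obj; f \<in> Hom a b\<rbrakk> \<Longrightarrow> Idn b \<cdot> f = f"
    and Comp_Idn_right: "\<lbrakk>a \<in> Obj; b \<in> Obj; f \<in> Hom a b\<rbrakk> \<Longrightarrow> f \<cdot> Idn a = f"
    and Comp_assoc: "\<lbrakk>a \<in> Obj; b \<in> Obj; c \<in> Obj; d \<in> Obj;
        f \<in> Hom a b; g \<in> Hom b c; h \<in> Hom c d\<rbrakk>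
      \<Longrightarrow> (h \<cdot> g) \<cdot> f = h \<cdot> (g \<cdot> f)"
    and Comp_add_left: "\<lbrakk>a \<in> Obj; b \<in> Obj; c \<in> Obj; f \<in> Hom a b; g \<in> Hom b c; g' \<in> Hom b c\<rbrakk>
      \<Longrightarrow> (g + g') \<cdot> f = g \<cdot> f + g' \<cdot> f"
    and Comp_add_right: "\<lbrakk>a \<in> Obj; b \<in> Obj; c \<in> Obj; f \<in> Hom a b; f' \<in> Hom a b; g \<in> Hom b c\<rbrakk>
      \<Longrightarrow> g \<cdot> (f + f') = g \<cdot> f + g \<cdot> f'"
    and Comp_scale_left: "\<lbrakk>a \<in> Obj; b \<in> Obj; c \<in> Obj; f \<in> Hom a b; g \<in> Hom b c\<rbrakk>
      \<Longrightarrow> Scale C t g \<cdot> f = Scale C t (g \<cdot> f)"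
    and Comp_scale_right: "\<lbrakk>a \<in> Obj; b \<in> Obj; c \<in> Obj; f \<in> Hom a b; g \<in> Hom b c\<rbrakk>
      \<Longrightarrow> g \<cdot> Scale C t f = Scale C t (g \<cdot> f)"

definition is_inverse :: "('o, 'm, 'k, 'z) lincat_scheme \<Rightarrow> 'o \<Rightarrow> 'o \<Rightarrow> 'm \<Rightarrow> 'm \<Rightarrow> bool"
  where "is_inverse C a b f g \<longleftrightarrow> f \<in> Hom\<^bsub>C\<^esub> a b \<and> g \<in> Hom\<^bsub>C\<^esub> b a
    \<and> g \<cdot>\<^bsub>C\<^esub> f = Idn\<^bsub>C\<^esub> a \<and> f \<cdot>\<^bsub>C\<^esub> g = Idn\<^bsub>C\<^esub> b"

definition is_iso :: "('o, 'm, 'k, 'z) lincat_scheme \<Rightarrow> 'o \<Rightarrow> 'o \<Rightarrow> 'm \<Rightarrow> bool"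
  where "is_iso C a b f \<longleftrightarrow> (\<exists>g. is_inverse C a b f g)"

definition inv_mor :: "('o, 'm, 'k, 'z) lincat_scheme \<Rightarrow> 'o \<Rightarrow> 'o \<Rightarrow> 'm \<Rightarrow> 'm"
  where "inv_mor C a b f = (THE g. is_inverse C a b f g)"

definition isomorphic :: "('o, 'm, 'k, 'z) lincat_scheme \<Rightarrow> 'o \<Rightarrow> 'o \<Rightarrow> bool"
  where "isomorphic C a b \<longleftrightarrow> (\<exists>f. is_iso C a b f)"


section \<open>Abelian and semisimple categories\<close>

definition is_mono :: "('o, 'm, 'k, 'z) lincat_scheme \<Rightarrow> 'o \<Rightarrow> 'o \<Rightarrow> 'm \<Rightarrow> bool"
  where "is_mono C a b f \<longleftrightarrow> f \<in> Hom\<^bsub>C\<^esub> a b \<and>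
    (\<forall>t\<in>Obj\<^bsub>C\<^esub>. \<forall>g\<in>Hom\<^bsub>C\<^esub> t a. \<forall>h\<in>Hom\<^bsub>C\<^esub> t a. f \<cdot>\<^bsub>C\<^esub> g = f \<cdot>\<^bsub>C\<^esub> h \<longrightarrow> g = h)"

definition is_epi :: "('o, 'm, 'k, 'z) lincat_scheme \<Rightarrow> 'o \<Rightarrow> 'o \<Rightarrow> 'm \<Rightarrow> bool"
  where "is_epi C a b f \<longleftrightarrow> f \<in> Hom\<^bsub>C\<^esub> a b \<and>
    (\<forall>t\<in>Obj\<^bsub>C\<^esub>. \<forall>g\<in>Hom\<^bsub>C\<^esub> b t. \<forall>h\<in>Hom\<^bsub>C\<^esub> b t. g \<cdot>\<^bsub>C\<^esub> f = h \<cdot>\<^bsub>C\<^esub> f \<longrightarrow> g = h)"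

text \<open>\<open>is_kernel C a b f x i\<close>: the morphism \<open>i : x \<rightarrow> a\<close> is a kernel of \<open>f : a \<rightarrow> b\<close>.\<close>

definition is_kernel ::
    "('o, 'm::zero, 'k, 'z) lincat_scheme \<Rightarrow> 'o \<Rightarrow> 'o \<Rightarrow> 'm \<Rightarrow> 'o \<Rightarrow> 'm \<Rightarrow> bool"
  where "is_kernel C a b f x i \<longleftrightarrow>
    f \<in> Hom\<^bsub>C\<^esub> a b \<and> i \<in> Hom\<^bsub>C\<^esub> x a \<and> f \<cdot>\<^bsub>C\<^esub> i = 0 \<and>
    (\<forall>t\<in>Obj\<^bsub>C\<^esub>. \<forall>g\<in>Hom\<^bsub>C\<^esub> t a. f \<cdot>\<^bsub>C\<^esub> g = 0 \<longrightarrow> (\<exists>!h. h \<in> Hom\<^bsub>C\<^esub> t x \<and> i \<cdot>\<^bsub>C\<^esub> h = g))"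

text \<open>\<open>is_cokernel C a b f x p\<close>: the morphism \<open>p : b \<rightarrow> x\<close> is a cokernel of \<open>f : a \<rightarrow> b\<close>.\<close>

definition is_cokernel ::
    "('o, 'm::zero, 'k, 'z) lincat_scheme \<Rightarrow> 'o \<Rightarrow> 'o \<Rightarrow> 'm \<Rightarrow> 'o \<Rightarrow> 'm \<Rightarrow> bool"
  where "is_cokernel C a b f x p \<longleftrightarrow>
    f \<in> Hom\<^bsub>C\<^esub> a b \<and> p \<in> Hom\<^bsub>C\<^esub> b x \<and> p \<cdot>\<^bsub>C\<^esub> f = 0 \<and>
    (\<forall>t\<in>Obj\<^bsub>C\<^esub>. \<forall>g\<in>Hom\<^bsub>C\<^esub> b t. g \<cdot>\<^bsub>C\<^esub> f = 0 \<longrightarrow> (\<exists>!h. h \<in> Hom\<^bsub>C\<^esub> x t \<and> h \<cdot>\<^bsub>C\<^esub> p = g))"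

text \<open>The object \<open>s\<close> is a direct sum (biproduct) of \<open>x 0, \<dots>, x (n - 1)\<close>;
  for \<open>n = 0\<close> this says that \<open>s\<close> is a zero object.\<close>

definition is_direct_sum ::
    "('o, 'm::ab_group_add, 'k, 'z) lincat_scheme \<Rightarrow> nat \<Rightarrow> (nat \<Rightarrow> 'o) \<Rightarrow> 'o \<Rightarrow> bool"
  where "is_direct_sum C n x s \<longleftrightarrow>
    (\<exists>i p. (\<forall>j<n. i j \<in> Hom\<^bsub>C\<^esub> (x j) s \<and> p j \<in> Hom\<^bsub>C\<^esub> s (x j)) \<and>
      (\<forall>j<n. \<forall>l<n. p j \<cdot>\<^bsub>C\<^esub> i l = (if j = l then Idn\<^bsub>C\<^esub> (x j) else 0)) \<and>
      Idn\<^bsub>C\<^esub> s = (\<Sum>j<n. i j \<cdot>\<^bsub>C\<^esub> p j))"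

definition is_zero_object :: "('o, 'm::zero, 'k, 'z) lincat_scheme \<Rightarrow> 'o \<Rightarrow> bool"
  where "is_zero_object C z \<longleftrightarrow> z \<in> Obj\<^bsub>C\<^esub> \<and>
    (\<forall>a\<in>Obj\<^bsub>C\<^esub>. Hom\<^bsub>C\<^esub> z a = {0} \<and> Hom\<^bsub>C\<^esub> a z = {0})"

definition is_simple :: "('o, 'm::zero, 'k, 'z) lincat_scheme \<Rightarrow> 'o \<Rightarrow> bool"
  where "is_simple C x \<longleftrightarrow> x \<in> Obj\<^bsub>C\<^esub> \<and> \<not> is_zero_object C x \<and>
    (\<forall>y\<in>Obj\<^bsub>C\<^esub>. \<forall>i. is_mono C y x i \<longrightarrow> is_zero_object C y \<or> is_iso C y x i)"

locale abelian_category = linear_category C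
  for C :: "('o, 'm::ab_group_add, 'k::field, 'z) lincat_scheme" (structure) +
  assumes direct_sum_exists: "(\<And>j. j < n \<Longrightarrow> x j \<in> Obj) \<Longrightarrow> \<exists>s\<in>Obj. is_direct_sum C n x s"
    and kernel_exists: "\<lbrakk>a \<in> Obj; b \<in> Obj; f \<in> Hom a b\<rbrakk> \<Longrightarrow> \<exists>x\<in>Obj. \<exists>i. is_kernel C a b f x i"
    and cokernel_exists: "\<lbrakk>a \<in> Obj; b \<in> Obj; f \<in> Hom a b\<rbrakk> \<Longrightarrow> \<exists>x\<in>Obj. \<exists>p. is_cokernel C a b f x p"
    and mono_normal: "\<lbrakk>a \<in> Obj; b \<in> Obj; is_mono C a b f\<rbrakk>
      \<Longrightarrow> \<exists>c\<in>Obj. \<exists>g. is_kernel C b c g a f"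
    and epi_normal: "\<lbrakk>a \<in> Obj; b \<in> Obj; is_epi C a b f\<rbrakk>
      \<Longrightarrow> \<exists>c\<in>Obj. \<exists>g. is_cokernel C c a g b f"

text \<open>Since morphism spaces are finite-dimensional, a direct sum of simple objects
  has only finitely many summands.\<close>

locale semisimple_category = abelian_category C
  for C :: "('o, 'm::ab_group_add, 'k::field, 'z) lincat_scheme" (structure) +
  assumes semisimple: "a \<in> Obj \<Longrightarrow> \<exists>n x. (\<forall>j<n. is_simple C (x j)) \<and> is_direct_sum C n x a"


section \<open>Rigid tensor categories\<close>

record ('o, 'm, 'k) tensor_cat = "('o, 'm, 'k) lincat" +
  Unit :: "'o" (\<open>\<one>\<index>\<close>)
  Tobj :: "'o \<Rightarrow> 'o \<Rightarrow> 'o" (infixr \<open>\<otimes>\<^sub>o\<index>\<close> 75)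
  Tmor :: "'m \<Rightarrow> 'm \<Rightarrow> 'm" (infixr \<open>\<otimes>\<^sub>m\<index>\<close> 75)
  Assoc :: "'o \<Rightarrow> 'o \<Rightarrow> 'o \<Rightarrow> 'm" (\<open>\<a>\<index>\<close>)
  Lunit :: "'o \<Rightarrow> 'm" (\<open>\<l>\<index>\<close>)
  Runit :: "'o \<Rightarrow> 'm" (\<open>\<r>\<index>\<close>)

locale tensor_category = linear_category C
  for C :: "('o, 'm::ab_group_add, 'k::field, 'z) tensor_cat_scheme" (structure) +
  assumes Unit_closed: "\<one> \<in> Obj"
    and Tobj_closed: "\<lbrakk>a \<in> Obj; b \<in> Obj\<rbrakk> \<Longrightarrow> a \<otimes>\<^sub>o b \<in> Obj"
    and Tmor_closed: "\<lbrakk>a \<in> Obj; a' \<in> Obj; b \<in> Obj; b' \<in> Obj; f \<in> Hom a a'; g \<in> Hom b b'\<rbrakk>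
      \<Longrightarrow> f \<otimes>\<^sub>m g \<in> Hom (a \<otimes>\<^sub>o b) (a' \<otimes>\<^sub>o b')"
    and Tmor_Idn: "\<lbrakk>a \<in> Obj; b \<in> Obj\<rbrakk> \<Longrightarrow> Idn a \<otimes>\<^sub>m Idn b = Idn (a \<otimes>\<^sub>o b)"
    and Tmor_Comp: "\<lbrakk>a \<in> Obj; a' \<in> Obj; a'' \<in> Obj; b \<in> Obj; b' \<in> Obj; b'' \<in> Obj;
        f \<in> Hom a a'; f' \<in> Hom a' a''; g \<in> Hom b b'; g' \<in> Hom b' b''\<rbrakk>
      \<Longrightarrow> (f' \<cdot> f) \<otimes>\<^sub>m (g' \<cdot> g) = (f' \<otimes>\<^sub>m g') \<cdot> (f \<otimes>\<^sub>m g)"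
    and Tmor_add_left: "\<lbrakk>a \<in> Obj; a' \<in> Obj; b \<in> Obj; b' \<in> Obj;
        f \<in> Hom a a'; f' \<in> Hom a a'; g \<in> Hom b b'\<rbrakk>
      \<Longrightarrow> (f + f') \<otimes>\<^sub>m g = f \<otimes>\<^sub>m g + f' \<otimes>\<^sub>m g"
    and Tmor_add_right: "\<lbrakk>a \<in> Obj; a' \<in> Obj; b \<in> Obj; b' \<in> Obj;
        f \<in> Hom a a'; g \<in> Hom b b'; g' \<in> Hom b b'\<rbrakk>
      \<Longrightarrow> f \<otimes>\<^sub>m (g + g') = f \<otimes>\<^sub>m g + f \<otimes>\<^sub>m g'"
    and Tmor_scale_left: "\<lbrakk>a \<in> Obj; a' \<in> Obj; b \<in> Obj; b' \<in> Obj; f \<in> Hom a a'; g \<in> Hom b b'\<rbrakk>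
      \<Longrightarrow> Scale C t f \<otimes>\<^sub>m g = Scale C t (f \<otimes>\<^sub>m g)"
    and Tmor_scale_right: "\<lbrakk>a \<in> Obj; a' \<in> Obj; b \<in> Obj; b' \<in> Obj; f \<in> Hom a a'; g \<in> Hom b b'\<rbrakk>
      \<Longrightarrow> f \<otimes>\<^sub>m Scale C t g = Scale C t (f \<otimes>\<^sub>m g)"
    and Assoc_iso: "\<lbrakk>a \<in> Obj; b \<in> Obj; c \<in> Obj\<rbrakk>
      \<Longrightarrow> is_iso C ((a \<otimes>\<^sub>o b) \<otimes>\<^sub>o c) (a \<otimes>\<^sub>o (b \<otimes>\<^sub>o c)) (\<a> a b c)"
    and Lunit_iso: "a \<in> Obj \<Longrightarrow> is_iso C (\<one> \<otimes>\<^sub>o a) a (\<l> a)"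
    and Runit_iso: "a \<in> Obj \<Longrightarrow> is_iso C (a \<otimes>\<^sub>o \<one>) a (\<r> a)"
    and Assoc_natural: "\<lbrakk>a \<in> Obj; a' \<in> Obj; b \<in> Obj; b' \<in> Obj; c \<in> Obj; c' \<in> Obj;
        f \<in> Hom a a'; g \<in> Hom b b'; h \<in> Hom c c'\<rbrakk>
      \<Longrightarrow> \<a> a' b' c' \<cdot> ((f \<otimes>\<^sub>m g) \<otimes>\<^sub>m h) = (f \<otimes>\<^sub>m (g \<otimes>\<^sub>m h)) \<cdot> \<a> a b c"
    and Lunit_natural: "\<lbrakk>a \<in> Obj; b \<in> Obj; f \<in> Hom a b\<rbrakk> \<Longrightarrow> \<l> b \<cdot> (Idn \<one> \<otimes>\<^sub>m f) = f \<cdot> \<l> a"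
    and Runit_natural: "\<lbrakk>a \<in> Obj; b \<in> Obj; f \<in> Hom a b\<rbrakk> \<Longrightarrow> \<r> b \<cdot> (f \<otimes>\<^sub>m Idn \<one>) = f \<cdot> \<r> a"
    and pentagon: "\<lbrakk>a \<in> Obj; b \<in> Obj; c \<in> Obj; d \<in> Obj\<rbrakk>
      \<Longrightarrow> (Idn a \<otimes>\<^sub>m \<a> b c d) \<cdot> \<a> a (b \<otimes>\<^sub>o c) d \<cdot> (\<a> a b c \<otimes>\<^sub>m Idn d)
        = \<a> a b (c \<otimes>\<^sub>o d) \<cdot> \<a> (a \<otimes>\<^sub>o b) c d"
    and triangle: "\<lbrakk>a \<in> Obj; b \<in> Obj\<rbrakk>
      \<Longrightarrow> (Idn a \<otimes>\<^sub>m \<l> b) \<cdot> \<a> a \<one> b = \<r> a \<otimes>\<^sub>m Idn b"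

text \<open>\<open>is_dual C a d\<close>: \<open>d\<close> is a dual of \<open>a\<close>, with evaluation \<open>d \<otimes> a \<rightarrow> 1\<close> and coevaluation
  \<open>1 \<rightarrow> a \<otimes> d\<close>; the zig-zag composites are maps \<open>1 \<otimes> a \<rightarrow> a\<close> and \<open>d \<otimes> 1 \<rightarrow> d\<close>.\<close>

definition is_dual :: "('o, 'm, 'k, 'z) tensor_cat_scheme \<Rightarrow> 'o \<Rightarrow> 'o \<Rightarrow> bool"
  where "is_dual C a d \<longleftrightarrow> d \<in> Obj\<^bsub>C\<^esub> \<and>
    (\<exists>ev \<in> Hom\<^bsub>C\<^esub> (d \<otimes>\<^sub>o\<^bsub>C\<^esub> a) \<one>\<^bsub>C\<^esub>. \<exists>coev \<in> Hom\<^bsub>C\<^esub> \<one>\<^bsub>C\<^esub> (a \<otimes>\<^sub>o\<^bsub>C\<^esub> d).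
      \<r>\<^bsub>C\<^esub> a \<cdot>\<^bsub>C\<^esub> (Idn\<^bsub>C\<^esub> a \<otimes>\<^sub>m\<^bsub>C\<^esub> ev) \<cdot>\<^bsub>C\<^esub> \<a>\<^bsub>C\<^esub> a d a \<cdot>\<^bsub>C\<^esub> (coev \<otimes>\<^sub>m\<^bsub>C\<^esub> Idn\<^bsub>C\<^esub> a) = \<l>\<^bsub>C\<^esub> a \<and>
      \<l>\<^bsub>C\<^esub> d \<cdot>\<^bsub>C\<^esub> (ev \<otimes>\<^sub>m\<^bsub>C\<^esub> Idn\<^bsub>C\<^esub> d)
        \<cdot>\<^bsub>C\<^esub> inv_mor C ((d \<otimes>\<^sub>o\<^bsub>C\<^esub> a) \<otimes>\<^sub>o\<^bsub>C\<^esub> d) (d \<otimes>\<^sub>o\<^bsub>C\<^esub> (a \<otimes>\<^sub>o\<^bsub>C\<^esub> d)) (\<a>\<^bsub>C\<^esub> d a d)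
        \<cdot>\<^bsub>C\<^esub> (Idn\<^bsub>C\<^esub> d \<otimes>\<^sub>m\<^bsub>C\<^esub> coev) = \<r>\<^bsub>C\<^esub> d)"

locale rigid_tensor_category = tensor_category C
  for C :: "('o, 'm::ab_group_add, 'k::field, 'z) tensor_cat_scheme" (structure) +
  assumes dual_exists: "a \<in> Obj \<Longrightarrow> \<exists>d. is_dual C a d"
    and predual_exists: "b \<in> Obj \<Longrightarrow> \<exists>a\<in>Obj. \<exists>d. is_dual C a d \<and> isomorphic C b d"


section \<open>Tensor functors and adjunctions\<close>

record ('o, 'm, 'p, 'n) funct =
  omap :: "'o \<Rightarrow> 'p"
  mmap :: "'m \<Rightarrow> 'n"

locale linear_functor = source: linear_category C + target: linear_category D
  for C :: "('o, 'm::ab_group_add, 'k::field, 'z) lincat_scheme"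
    and D :: "('p, 'n::ab_group_add, 'k, 'y) lincat_scheme"
    and F :: "('o, 'm, 'p, 'n, 'w) funct_scheme" +
  assumes omap_closed: "a \<in> Obj\<^bsub>C\<^esub> \<Longrightarrow> omap F a \<in> Obj\<^bsub>D\<^esub>"
    and mmap_closed: "\<lbrakk>a \<in> Obj\<^bsub>C\<^esub>; b \<in> Obj\<^bsub>C\<^esub>; f \<in> Hom\<^bsub>C\<^esub> a b\<rbrakk>
      \<Longrightarrow> mmap F f \<in> Hom\<^bsub>D\<^esub> (omap F a) (omap F b)"
    and mmap_Idn: "a \<in> Obj\<^bsub>C\<^esub> \<Longrightarrow> mmap F (Idn\<^bsub>C\<^esub> a) = Idn\<^bsub>D\<^esub> (omap F a)"
    and mmap_Comp: "\<lbrakk>a \<in> Obj\<^bsub>C\<^esub>; b \<in> Obj\<^bsub>C\<^esub>; c \<in> Obj\<^bsub>C\<^esub>; f \<in> Hom\<^bsub>C\<^esub> a b; g \<in> Hom\<^bsub>C\<^esub> b c\<rbrakk>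
      \<Longrightarrow> mmap F (g \<cdot>\<^bsub>C\<^esub> f) = mmap F g \<cdot>\<^bsub>D\<^esub> mmap F f"
    and mmap_add: "\<lbrakk>a \<in> Obj\<^bsub>C\<^esub>; b \<in> Obj\<^bsub>C\<^esub>; f \<in> Hom\<^bsub>C\<^esub> a b; g \<in> Hom\<^bsub>C\<^esub> a b\<rbrakk>
      \<Longrightarrow> mmap F (f + g) = mmap F f + mmap F g"
    and mmap_scale: "\<lbrakk>a \<in> Obj\<^bsub>C\<^esub>; b \<in> Obj\<^bsub>C\<^esub>; f \<in> Hom\<^bsub>C\<^esub> a b\<rbrakk>
      \<Longrightarrow> mmap F (Scale C t f) = Scale D t (mmap F f)"

text \<open>The structure isomorphisms of a tensor functor \<open>\<Phi>\<close> are
  \<open>Fmult \<Phi> a b : \<Phi> a \<otimes> \<Phi> b \<rightarrow> \<Phi> (a \<otimes> b)\<close> and \<open>Funit \<Phi> : 1 \<rightarrow> \<Phi> 1\<close>.\<close>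

record ('o, 'm, 'p, 'n) tensor_funct = "('o, 'm, 'p, 'n) funct" +
  Fmult :: "'o \<Rightarrow> 'o \<Rightarrow> 'n"
  Funit :: "'n"

locale tensor_functor =
  source: tensor_category C + target: tensor_category D + linear_functor C D F
  for C :: "('o, 'm::ab_group_add, 'k::field, 'z) tensor_cat_scheme"
    and D :: "('p, 'n::ab_group_add, 'k, 'y) tensor_cat_scheme"
    and F :: "('o, 'm, 'p, 'n, 'w) tensor_funct_scheme" +
  assumes Fmult_iso: "\<lbrakk>a \<in> Obj\<^bsub>C\<^esub>; b \<in> Obj\<^bsub>C\<^esub>\<rbrakk>
      \<Longrightarrow> is_iso D (omap F a \<otimes>\<^sub>o\<^bsub>D\<^esub> omap F b) (omap F (a \<otimes>\<^sub>o\<^bsub>C\<^esub> b)) (Fmult F a b)"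
    and Funit_iso: "is_iso D \<one>\<^bsub>D\<^esub> (omap F \<one>\<^bsub>C\<^esub>) (Funit F)"
    and Fmult_natural: "\<lbrakk>a \<in> Obj\<^bsub>C\<^esub>; a' \<in> Obj\<^bsub>C\<^esub>; b \<in> Obj\<^bsub>C\<^esub>; b' \<in> Obj\<^bsub>C\<^esub>;
        f \<in> Hom\<^bsub>C\<^esub> a a'; g \<in> Hom\<^bsub>C\<^esub> b b'\<rbrakk>
      \<Longrightarrow> Fmult F a' b' \<cdot>\<^bsub>D\<^esub> (mmap F f \<otimes>\<^sub>m\<^bsub>D\<^esub> mmap F g)
        = mmap F (f \<otimes>\<^sub>m\<^bsub>C\<^esub> g) \<cdot>\<^bsub>D\<^esub> Fmult F a b"
    and Fmult_Assoc: "\<lbrakk>a \<in> Obj\<^bsub>C\<^esub>; b \<in> Obj\<^bsub>C\<^esub>; c \<in> Obj\<^bsub>C\<^esub>\<rbrakk>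
      \<Longrightarrow> mmap F (\<a>\<^bsub>C\<^esub> a b c) \<cdot>\<^bsub>D\<^esub> Fmult F (a \<otimes>\<^sub>o\<^bsub>C\<^esub> b) c \<cdot>\<^bsub>D\<^esub> (Fmult F a b \<otimes>\<^sub>m\<^bsub>D\<^esub> Idn\<^bsub>D\<^esub> (omap F c))
        = Fmult F a (b \<otimes>\<^sub>o\<^bsub>C\<^esub> c) \<cdot>\<^bsub>D\<^esub> (Idn\<^bsub>D\<^esub> (omap F a) \<otimes>\<^sub>m\<^bsub>D\<^esub> Fmult F b c)
          \<cdot>\<^bsub>D\<^esub> \<a>\<^bsub>D\<^esub> (omap F a) (omap F b) (omap F c)"
    and Fmult_Lunit: "a \<in> Obj\<^bsub>C\<^esub>
      \<Longrightarrow> mmap F (\<l>\<^bsub>C\<^esub> a) \<cdot>\<^bsub>D\<^esub> Fmult F \<one>\<^bsub>C\<^esub> a \<cdot>\<^bsub>D\<^esub> (Funit F \<otimes>\<^sub>m\<^bsub>D\<^esub> Idn\<^bsub>D\<^esub> (omap F a)) = \<l>\<^bsub>D\<^esub> (omap F a)"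
    and Fmult_Runit: "a \<in> Obj\<^bsub>C\<^esub>
      \<Longrightarrow> mmap F (\<r>\<^bsub>C\<^esub> a) \<cdot>\<^bsub>D\<^esub> Fmult F a \<one>\<^bsub>C\<^esub> \<cdot>\<^bsub>D\<^esub> (Idn\<^bsub>D\<^esub> (omap F a) \<otimes>\<^sub>m\<^bsub>D\<^esub> Funit F) = \<r>\<^bsub>D\<^esub> (omap F a)"

text \<open>\<open>G : D \<rightarrow> C\<close> is right adjoint to \<open>F : C \<rightarrow> D\<close>, with unit \<open>\<eta> c : c \<rightarrow> G (F c)\<close> and counit
  \<open>\<epsilon> x : F (G x) \<rightarrow> x\<close>.\<close>

locale linear_adjunction = left: linear_functor C D F + right: linear_functor D C G
  for C :: "('o, 'm::ab_group_add, 'k::field, 'z) lincat_scheme"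
    and D :: "('p, 'n::ab_group_add, 'k, 'y) lincat_scheme"
    and F :: "('o, 'm, 'p, 'n, 'w) funct_scheme"
    and G :: "('p, 'n, 'o, 'm, 'v) funct_scheme"
    and \<eta> :: "'o \<Rightarrow> 'm"
    and \<epsilon> :: "'p \<Rightarrow> 'n" +
  assumes unit_closed: "c \<in> Obj\<^bsub>C\<^esub> \<Longrightarrow> \<eta> c \<in> Hom\<^bsub>C\<^esub> c (omap G (omap F c))"
    and counit_closed: "x \<in> Obj\<^bsub>D\<^esub> \<Longrightarrow> \<epsilon> x \<in> Hom\<^bsub>D\<^esub> (omap F (omap G x)) x"
    and unit_natural: "\<lbrakk>c \<in> Obj\<^bsub>C\<^esub>; d \<in> Obj\<^bsub>C\<^esub>; f \<in> Hom\<^bsub>C\<^esub> c d\<rbrakk>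
      \<Longrightarrow> \<eta> d \<cdot>\<^bsub>C\<^esub> f = mmap G (mmap F f) \<cdot>\<^bsub>C\<^esub> \<eta> c"
    and counit_natural: "\<lbrakk>x \<in> Obj\<^bsub>D\<^esub>; y \<in> Obj\<^bsub>D\<^esub>; u \<in> Hom\<^bsub>D\<^esub> x y\<rbrakk>
      \<Longrightarrow> \<epsilon> y \<cdot>\<^bsub>D\<^esub> mmap F (mmap G u) = u \<cdot>\<^bsub>D\<^esub> \<epsilon> x"
    and triangle_left: "c \<in> Obj\<^bsub>C\<^esub> \<Longrightarrow> \<epsilon> (omap F c) \<cdot>\<^bsub>D\<^esub> mmap F (\<eta> c) = Idn\<^bsub>D\<^esub> (omap F c)"
    and triangle_right: "x \<in> Obj\<^bsub>D\<^esub> \<Longrightarrow> mmap G (\<epsilon> x) \<cdot>\<^bsub>C\<^esub> \<eta> (omap G x) = Idn\<^bsub>C\<^esub> (omap G x)"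


section \<open>Algebra objects and their modules\<close>

locale algebra_object = tensor_category C
  for C :: "('o, 'm::ab_group_add, 'k::field, 'z) tensor_cat_scheme" (structure)
    and A :: 'o and m :: 'm and i :: 'm +
  assumes alg_obj: "A \<in> Obj"
    and alg_mult: "m \<in> Hom (A \<otimes>\<^sub>o A) A"
    and alg_unit: "i \<in> Hom \<one> A"
    and alg_assoc: "m \<cdot> (m \<otimes>\<^sub>m Idn A) = m \<cdot> (Idn A \<otimes>\<^sub>m m) \<cdot> \<a> A A A"
    and alg_unit_left: "m \<cdot> (i \<otimes>\<^sub>m Idn A) = \<l> A"
    and alg_unit_right: "m \<cdot> (Idn A \<otimes>\<^sub>m i) = \<r> A"

text \<open>A left module is a pair of an object \<open>X\<close> and an action \<open>r : A \<otimes> X \<rightarrow> X\<close>.\<close>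

definition left_modules ::
    "('o, 'm, 'k, 'z) tensor_cat_scheme \<Rightarrow> 'o \<Rightarrow> 'm \<Rightarrow> 'm \<Rightarrow> ('o \<times> 'm) set"
  where "left_modules C A m i = {(X, r). X \<in> Obj\<^bsub>C\<^esub> \<and> r \<in> Hom\<^bsub>C\<^esub> (A \<otimes>\<^sub>o\<^bsub>C\<^esub> X) X \<and>
    r \<cdot>\<^bsub>C\<^esub> (m \<otimes>\<^sub>m\<^bsub>C\<^esub> Idn\<^bsub>C\<^esub> X) = r \<cdot>\<^bsub>C\<^esub> (Idn\<^bsub>C\<^esub> A \<otimes>\<^sub>m\<^bsub>C\<^esub> r) \<cdot>\<^bsub>C\<^esub> \<a>\<^bsub>C\<^esub> A A X \<and>
    r \<cdot>\<^bsub>C\<^esub> (i \<otimes>\<^sub>m\<^bsub>C\<^esub> Idn\<^bsub>C\<^esub> X) = \<l>\<^bsub>C\<^esub> X}"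

definition module_category ::
    "('o, 'm, 'k, 'z) tensor_cat_scheme \<Rightarrow> 'o \<Rightarrow> 'm \<Rightarrow> 'm \<Rightarrow> ('o \<times> 'm, 'm, 'k) lincat"
  where "module_category C A m i = \<lparr>
    objects = left_modules C A m i,
    homs = (\<lambda>(X, r) (Y, s). {f \<in> Hom\<^bsub>C\<^esub> X Y. f \<cdot>\<^bsub>C\<^esub> r = s \<cdot>\<^bsub>C\<^esub> (Idn\<^bsub>C\<^esub> A \<otimes>\<^sub>m\<^bsub>C\<^esub> f)}),
    identity = (\<lambda>(X, r). Idn\<^bsub>C\<^esub> X),
    Comp = Comp C,
    Scale = Scale C\<rparr>"

definition semisimple_algebra ::
    "('o, 'm::ab_group_add, 'k::field, 'z) tensor_cat_scheme \<Rightarrow> 'o \<Rightarrow> 'm \<Rightarrow> 'm \<Rightarrow> bool"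
  where "semisimple_algebra C A m i \<longleftrightarrow>
    algebra_object C A m i \<and> semisimple_category (module_category C A m i)"


section \<open>The image of an algebra under the right adjoint\<close>

text \<open>The morphism \<open>\<mu> x y : G x \<otimes> G y \<rightarrow> G (x \<otimes> y)\<close>.  Its source is mapped by \<open>F\<close> to
  \<open>F (G x \<otimes> G y)\<close>, which is identified with \<open>F (G x) \<otimes> F (G y)\<close> through \<open>Fmult\<close>.\<close>

definition adj_mu ::
    "('o, 'm, 'k, 'z) tensor_cat_scheme \<Rightarrow> ('p, 'n, 'k, 'y) tensor_cat_scheme
      \<Rightarrow> ('o, 'm, 'p, 'n, 'w) tensor_funct_scheme \<Rightarrow> ('p, 'n, 'o, 'm, 'v) funct_scheme
      \<Rightarrow> ('p \<Rightarrow> 'n) \<Rightarrow> 'p \<Rightarrow> 'p \<Rightarrow> 'm"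
  where "adj_mu C D F G \<epsilon> x y = (THE h.
    h \<in> Hom\<^bsub>C\<^esub> (omap G x \<otimes>\<^sub>o\<^bsub>C\<^esub> omap G y) (omap G (x \<otimes>\<^sub>o\<^bsub>D\<^esub> y)) \<and>
    \<epsilon> (x \<otimes>\<^sub>o\<^bsub>D\<^esub> y) \<cdot>\<^bsub>D\<^esub> mmap F h \<cdot>\<^bsub>D\<^esub> Fmult F (omap G x) (omap G y) = \<epsilon> x \<otimes>\<^sub>m\<^bsub>D\<^esub> \<epsilon> y)"

definition adj_mult ::
    "('o, 'm, 'k, 'z) tensor_cat_scheme \<Rightarrow> ('p, 'n, 'k, 'y) tensor_cat_scheme
      \<Rightarrow> ('o, 'm, 'p, 'n, 'w) tensor_funct_scheme \<Rightarrow> ('p, 'n, 'o, 'm, 'v) funct_scheme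
      \<Rightarrow> ('p \<Rightarrow> 'n) \<Rightarrow> 'p \<Rightarrow> 'n \<Rightarrow> 'm"
  where "adj_mult C D F G \<epsilon> A m = mmap G m \<cdot>\<^bsub>C\<^esub> adj_mu C D F G \<epsilon> A A"

text \<open>The unit is \<open>1 \<rightarrow> G (F 1) \<rightarrow> G 1 \<rightarrow> G A\<close>, the middle map being the image of the inverse of
  \<open>Funit F : 1 \<rightarrow> F 1\<close>.\<close>

definition adj_unit ::
    "('o, 'm, 'k, 'z) tensor_cat_scheme \<Rightarrow> ('p, 'n, 'k, 'y) tensor_cat_scheme
      \<Rightarrow> ('o, 'm, 'p, 'n, 'w) tensor_funct_scheme \<Rightarrow> ('p, 'n, 'o, 'm, 'v) funct_scheme
      \<Rightarrow> ('o \<Rightarrow> 'm) \<Rightarrow> 'n \<Rightarrow> 'm"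
  where "adj_unit C D F G \<eta> i =
    mmap G i \<cdot>\<^bsub>C\<^esub> mmap G (inv_mor D \<one>\<^bsub>D\<^esub> (omap F \<one>\<^bsub>C\<^esub>) (Funit F)) \<cdot>\<^bsub>C\<^esub> \<eta> \<one>\<^bsub>C\<^esub>"

end

theory Submission
  imports Defs
begin

text \<open>
  In a semisimple category every morphism \<open>f\<close> is regular, that is, \<open>f \<cdot> g \<cdot> f = f\<close> for some \<open>g\<close>.
  Conversely, a linear category with regular morphisms, split idempotents and finite direct sums is
  semisimple.  Let \<open>B = Tr A\<close>.  By rigidity \<open>B \<otimes> d\<close> is \<open>Tr (A \<otimes> \<Phi> d)\<close>, so the \<open>B\<close>-linear maps
  \<open>B \<otimes> c \<rightarrow> B \<otimes> d\<close> correspond to the \<open>A\<close>-linear maps \<open>A \<otimes> \<Phi> c \<rightarrow> A \<otimes> \<Phi> d\<close>, compatibly with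
  composition.  Hence maps between free \<open>B\<close>-modules are regular.  Applied to the
  presentation \<open>B \<otimes> B \<otimes> X \<rightarrow> B \<otimes> X\<close> of a \<open>B\<close>-module \<open>X\<close> this shows that \<open>X\<close> is a direct summand of
  \<open>B \<otimes> X\<close>, and so all maps between \<open>B\<close>-modules are regular.
\<close>

section \<open>Von Neumann regular linear categories\<close>

text \<open>Regularity is the property to transport because \<open>f \<cdot> g \<cdot> f = f\<close>
  mentions composition only: a bijection of morphism spaces that respects composition carries it
  over, with no kernels or exactness to follow. Such a bijection is at hand for free modules; a
  passage from arbitrary B-modules to A-modules would require a relative tensor product. It comes
  from the chain Hom(e, B \<otimes> d) = Hom(e \<otimes> d', B) = Hom(\<Phi> e \<otimes> \<Phi> d',
  A) = Hom(\<Phi> e, A \<otimes> \<Phi> d): the outer steps are transpositions along a dual pair, in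
  the source and in the target of \<Phi>, and the middle one is the adjunction. Since the algebra
  sits on the left, d has to be moved away on the right, which calls for an evaluation d \<otimes>
  d' \<rightarrow> 1. So d must be a dual of d', and this is where it matters that every object is
  isomorphic to a dual.\<close>

definition regular_category :: "('o, 'm, 'k, 'z) lincat_scheme \<Rightarrow> bool"
  where "regular_category C \<longleftrightarrow> (\<forall>a\<in>Obj\<^bsub>C\<^esub>. \<forall>b\<in>Obj\<^bsub>C\<^esub>. \<forall>f\<in>Hom\<^bsub>C\<^esub> a b.
    \<exists>g\<in>Hom\<^bsub>C\<^esub> b a. f \<cdot>\<^bsub>C\<^esub> g \<cdot>\<^bsub>C\<^esub> f = f)"

definition is_retract :: "('o, 'm, 'k, 'z) lincat_scheme \<Rightarrow> 'o \<Rightarrow> 'o \<Rightarrow> 'm \<Rightarrow> 'm \<Rightarrow> bool"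
  where "is_retract C a b p i \<longleftrightarrow> p \<in> Hom\<^bsub>C\<^esub> a b \<and> i \<in> Hom\<^bsub>C\<^esub> b a \<and> p \<cdot>\<^bsub>C\<^esub> i = Idn\<^bsub>C\<^esub> b"

definition idempotents_split :: "('o, 'm, 'k, 'z) lincat_scheme \<Rightarrow> bool"
  where "idempotents_split C \<longleftrightarrow> (\<forall>a\<in>Obj\<^bsub>C\<^esub>. \<forall>e\<in>Hom\<^bsub>C\<^esub> a a. e \<cdot>\<^bsub>C\<^esub> e = e \<longrightarrow>
    (\<exists>b\<in>Obj\<^bsub>C\<^esub>. \<exists>p i. is_retract C a b p i \<and> i \<cdot>\<^bsub>C\<^esub> p = e))"

sublocale linear_category \<subseteq> vs: vector_space "Scale C"
  by (rule vector_space_Scale)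

section \<open>Linear calculus of morphisms, kernels and direct sums\<close>

context linear_category
begin

lemma zero_hom: "\<lbrakk>a \<in> Obj; b \<in> Obj\<rbrakk> \<Longrightarrow> 0 \<in> Hom a b"
  using Hom_subspace vs.subspace_0 by blast

lemma add_hom: "\<lbrakk>f \<in> Hom a b; g \<in> Hom a b; a \<in> Obj; b \<in> Obj\<rbrakk> \<Longrightarrow> f + g \<in> Hom a b"
  using Hom_subspace vs.subspace_add by blast

lemma diff_hom: "\<lbrakk>f \<in> Hom a b; g \<in> Hom a b; a \<in> Obj; b \<in> Obj\<rbrakk> \<Longrightarrow> f - g \<in> Hom a b"
  using Hom_subspace vs.subspace_diff by blast

lemma scale_hom: "\<lbrakk>f \<in> Hom a b; a \<in> Obj; b \<in> Obj\<rbrakk> \<Longrightarrow> Scale C t f \<in> Hom a b"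
  using Hom_subspace vs.subspace_scale by blast

lemma sum_hom: "\<lbrakk>\<And>j. j \<in> J \<Longrightarrow> f j \<in> Hom a b; a \<in> Obj; b \<in> Obj\<rbrakk> \<Longrightarrow> sum f J \<in> Hom a b"
  using Hom_subspace vs.subspace_sum by blast

lemma comp_hom: "\<lbrakk>g \<in> Hom b c; f \<in> Hom a b; a \<in> Obj; b \<in> Obj; c \<in> Obj\<rbrakk> \<Longrightarrow> g \<cdot> f \<in> Hom a c"
  by (rule Comp_closed)

lemma comp_assoc: "\<lbrakk>h \<in> Hom c d; g \<in> Hom b c; f \<in> Hom a b; a \<in> Obj; b \<in> Obj; c \<in> Obj; d \<in> Obj\<rbrakk>
    \<Longrightarrow> (h \<cdot> g) \<cdot> f = h \<cdot> g \<cdot> f"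
  by (rule Comp_assoc)

lemma comp_diff_left: "\<lbrakk>g \<in> Hom b c; g' \<in> Hom b c; f \<in> Hom a b; a \<in> Obj; b \<in> Obj; c \<in> Obj\<rbrakk>
    \<Longrightarrow> (g - g') \<cdot> f = g \<cdot> f - g' \<cdot> f"
  using Comp_add_left[of a b c f "g - g'" g'] by (simp add: diff_hom eq_diff_eq)

lemma comp_diff_right: "\<lbrakk>g \<in> Hom b c; f \<in> Hom a b; f' \<in> Hom a b; a \<in> Obj; b \<in> Obj; c \<in> Obj\<rbrakk>
    \<Longrightarrow> g \<cdot> (f - f') = g \<cdot> f - g \<cdot> f'"
  using Comp_add_right[of a b c "f - f'" f' g] by (simp add: diff_hom eq_diff_eq)

lemma comp_zero_left: "\<lbrakk>f \<in> Hom a b; a \<in> Obj; b \<in> Obj; c \<in> Obj\<rbrakk> \<Longrightarrow> 0 \<cdot> f = 0"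
  using comp_diff_left[of 0 b c 0 f a] by (simp add: zero_hom)

lemma comp_zero_right: "\<lbrakk>g \<in> Hom b c; a \<in> Obj; b \<in> Obj; c \<in> Obj\<rbrakk> \<Longrightarrow> g \<cdot> 0 = 0"
  using comp_diff_right[of g b c 0 a 0] by (simp add: zero_hom)

lemma comp_sum_left: "\<lbrakk>\<And>j. j \<in> J \<Longrightarrow> g j \<in> Hom b c; f \<in> Hom a b; a \<in> Obj; b \<in> Obj; c \<in> Obj\<rbrakk>
    \<Longrightarrow> sum g J \<cdot> f = (\<Sum>j\<in>J. g j \<cdot> f)"
proof (induction J rule: infinite_finite_induct)
  case (insert x J)
  then show ?case using Comp_add_left[of a b c f "g x" "sum g J"] by (simp add: sum_hom)
qed (simp_all add: comp_zero_left)

lemma comp_sum_right: "\<lbrakk>g \<in> Hom b c; \<And>j. j \<in> J \<Longrightarrow> f j \<in> Hom a b; a \<in> Obj; b \<in> Obj; c \<in> Obj\<rbrakk>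
    \<Longrightarrow> g \<cdot> sum f J = (\<Sum>j\<in>J. g \<cdot> f j)"
proof (induction J rule: infinite_finite_induct)
  case (insert x J)
  then show ?case using Comp_add_right[of a b c "f x" "sum f J" g] by (simp add: sum_hom)
qed (simp_all add: comp_zero_right)

text \<open>Every arrow into or out of \<open>a\<close> factors through \<open>Idn a\<close>. The
  criterion turns nonzero summands into nonzero endomorphisms, which can then be counted by linear
  algebra.\<close>

lemma zero_object_iff: "is_zero_object C a \<longleftrightarrow> a \<in> Obj \<and> Idn a = 0"
proof
  assume "is_zero_object C a"
  then show "a \<in> Obj \<and> Idn a = 0"
    using Idn_closed by (fastforce simp: is_zero_object_def)
next
  assume *: "a \<in> Obj \<and> Idn a = 0"
  have "f = 0" if "f \<in> Hom a b" "b \<in> Obj" for f b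
    using that * comp_zero_right[of f a b a] Comp_Idn_right[of a b f] by simp
  moreover have "f = 0" if "f \<in> Hom b a" "b \<in> Obj" for f b
    using that * comp_zero_left[of f b a a] Comp_Idn_left[of b a f] by simp
  ultimately show "is_zero_object C a"
    using * zero_hom by (auto simp: is_zero_object_def)
qed

lemma kernel_factor:
  assumes "is_kernel C a b f x i" "t \<in> Obj" "g \<in> Hom t a" "f \<cdot> g = 0"
  obtains h where "h \<in> Hom t x" "i \<cdot> h = g"
proof -
  have "\<exists>!h. h \<in> Hom t x \<and> i \<cdot> h = g" using assms unfolding is_kernel_def by blast
  then show ?thesis using that by blast
qed

lemma kernel_is_mono: "\<lbrakk>is_kernel C a b f x i; a \<in> Obj; b \<in> Obj; x \<in> Obj\<rbrakk> \<Longrightarrow> is_mono C x a i"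
  unfolding is_mono_def
proof (intro conjI ballI impI)
  assume k: "is_kernel C a b f x i" and ob: "a \<in> Obj" "b \<in> Obj" "x \<in> Obj"
  then have hom: "f \<in> Hom a b" "i \<in> Hom x a" and fi: "f \<cdot> i = 0" by (auto simp: is_kernel_def)
  then show "i \<in> Hom x a" by simp
  fix t g h assume t: "t \<in> Obj" "g \<in> Hom t x" "h \<in> Hom t x" "i \<cdot> g = i \<cdot> h"
  have "f \<cdot> (i \<cdot> h) = 0"
    using comp_assoc[OF hom t(3)] fi comp_zero_left[OF t(3)] ob t by simp
  moreover have "i \<cdot> h \<in> Hom t a" using comp_hom[OF hom(2) t(3)] ob t by simp
  ultimately have "\<exists>!u. u \<in> Hom t x \<and> i \<cdot> u = i \<cdot> h"
    using k t by (auto simp: is_kernel_def)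
  then show "g = h" using t by auto
qed

text \<open>Insert the decomposition of \<open>Idn s\<close> in front of \<open>h\<close>. In this
  form the projections of a direct sum are jointly monic: \<open>h\<close> is recovered from all the
  \<open>p j \<cdot> h\<close>.\<close>

lemma direct_sum_components:
  fixes n :: nat
  assumes i: "\<And>j. j < n \<Longrightarrow> i j \<in> Hom (x j) s" and p: "\<And>j. j < n \<Longrightarrow> p j \<in> Hom s (x j)"
    and x: "\<And>j. j < n \<Longrightarrow> x j \<in> Obj" and s: "s \<in> Obj" "t \<in> Obj"
    and id: "Idn s = (\<Sum>j<n. i j \<cdot> p j)" and h: "h \<in> Hom t s"
  shows "h = (\<Sum>j<n. i j \<cdot> p j \<cdot> h)"
proof -
  have "h = (\<Sum>j<n. i j \<cdot> p j) \<cdot> h" using Comp_Idn_left[of t s h] id s h by simp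
  also have "\<dots> = (\<Sum>j<n. (i j \<cdot> p j) \<cdot> h)"
    by (rule comp_sum_left[of _ _ s s _ t]) (use comp_hom[OF i p] x s h in auto)
  also have "\<dots> = (\<Sum>j<n. i j \<cdot> p j \<cdot> h)"
    by (rule sum.cong) (use comp_assoc[OF i p h] x s in auto)
  finally show ?thesis .
qed

text \<open>The image of the family is built up one map at a time: \<open>E = \<Sum>j<n. f j \<cdot> g j\<close> is the
  identity on the maps so far, and only the component of the next map outside of \<open>E\<close> matters.\<close>

lemma regular_family:
  fixes n :: nat
  assumes y: "y \<in> Obj" and x: "\<And>j. j < n \<Longrightarrow> x j \<in> Obj" and f: "\<And>j. j < n \<Longrightarrow> f j \<in> Hom (x j) y"
    and reg: "\<And>j h. \<lbrakk>j < n; h \<in> Hom (x j) y\<rbrakk> \<Longrightarrow> \<exists>k\<in>Hom y (x j). h \<cdot> k \<cdot> h = h"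
  shows "\<exists>g. (\<forall>j<n. g j \<in> Hom y (x j)) \<and> (\<forall>l<n. (\<Sum>j<n. f j \<cdot> g j) \<cdot> f l = f l)"
  using x f reg
proof (induction n)
  case 0
  then show ?case by simp
next
  case (Suc n)
  have "\<exists>g. (\<forall>j<n. g j \<in> Hom y (x j)) \<and> (\<forall>l<n. (\<Sum>j<n. f j \<cdot> g j) \<cdot> f l = f l)"
    by (rule Suc.IH) (rule Suc.prems less_SucI | assumption)+
  then obtain g where g: "\<And>j. j < n \<Longrightarrow> g j \<in> Hom y (x j)"
    and Ef: "\<And>l. l < n \<Longrightarrow> (\<Sum>j<n. f j \<cdot> g j) \<cdot> f l = f l"
    by blast
  define E where "E = (\<Sum>j<n. f j \<cdot> g j)"
  define e where "e = Idn y - E"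
  have xo: "\<And>j. j < Suc n \<Longrightarrow> x j \<in> Obj" and fh: "\<And>j. j < Suc n \<Longrightarrow> f j \<in> Hom (x j) y"
    using Suc by auto
  have E: "E \<in> Hom y y" unfolding E_def
    by (rule sum_hom) (use comp_hom[OF fh g] xo y in auto)
  have e: "e \<in> Hom y y" unfolding e_def by (intro diff_hom Idn_closed E y)
  have ef: "e \<cdot> u = u - E \<cdot> u" if "u \<in> Hom z y" "z \<in> Obj" for u z
    unfolding e_def using comp_diff_left[OF Idn_closed E that(1)] Comp_Idn_left that y by simp
  \<comment> \<open>The part of the next map that \<open>E\<close> does not reproduce. It again
    starts at \<open>x n\<close>, so \<open>reg\<close> applies to it.\<close>
  define h where "h = e \<cdot> f n"
  have fn: "f n \<in> Hom (x n) y" "x n \<in> Obj" using fh xo by auto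
  have h: "h \<in> Hom (x n) y" unfolding h_def using comp_hom[OF e fn(1)] fn y by simp
  with Suc.prems(3) obtain k where k: "k \<in> Hom y (x n)" and hk: "h \<cdot> k \<cdot> h = h"
    by (metis lessI)
  define w where "w = k \<cdot> e"
  have w: "w \<in> Hom y (x n)" unfolding w_def using comp_hom[OF k e] fn y by simp
  \<comment> \<open>The old components are corrected so that the new sum is
    \<open>E + e \<cdot> f n \<cdot> w\<close>: the added term must not disturb what
    \<open>E\<close> already achieves.\<close>
  define g' where "g' = (\<lambda>j. if j = n then w else g j - g j \<cdot> f n \<cdot> w)"
  have fnw: "f n \<cdot> w \<in> Hom y y" using comp_hom[OF fn(1) w] fn y by simp
  have g': "g' j \<in> Hom y (x j)" if "j < Suc n" for j
  proof (cases "j = n")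
    case True then show ?thesis by (simp add: g'_def w)
  next
    case False
    then have "j < n" using that by simp
    then show ?thesis unfolding g'_def
      using diff_hom[OF g comp_hom[OF g fnw]] y xo by simp
  qed
  have "(\<Sum>j<Suc n. f j \<cdot> g' j) = (\<Sum>j<n. f j \<cdot> (g j - g j \<cdot> f n \<cdot> w)) + f n \<cdot> w"
    by (simp add: g'_def)
  also have "(\<Sum>j<n. f j \<cdot> (g j - g j \<cdot> f n \<cdot> w)) = (\<Sum>j<n. f j \<cdot> g j - (f j \<cdot> g j) \<cdot> f n \<cdot> w)"
  proof (rule sum.cong[OF refl])
    fix j assume "j \<in> {..<n}"
    then have j: "j < n" "j < Suc n" by auto
    show "f j \<cdot> (g j - g j \<cdot> f n \<cdot> w) = f j \<cdot> g j - (f j \<cdot> g j) \<cdot> f n \<cdot> w"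
      using comp_diff_right[OF fh[OF j(2)] g[OF j(1)] comp_hom[OF g[OF j(1)] fnw]]
        comp_assoc[OF fh[OF j(2)] g[OF j(1)] fnw] y xo j by simp
  qed
  also have "\<dots> = E - E \<cdot> f n \<cdot> w"
    unfolding E_def sum_subtractf
    by (subst comp_sum_left[of _ _ y y _ y]) (use comp_hom[OF fh g] xo y fnw in auto)
  also have "\<dots> + f n \<cdot> w = E + e \<cdot> f n \<cdot> w" using ef[OF fnw y] by simp
  finally have E': "(\<Sum>j<Suc n. f j \<cdot> g' j) = E + e \<cdot> f n \<cdot> w" .
  have efnw: "e \<cdot> f n \<cdot> w = h \<cdot> w"
    unfolding h_def using comp_assoc[OF e fn(1) w] fn y by simp
  have hw: "h \<cdot> w \<in> Hom y y" using comp_hom[OF h w] fn y by simp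
  have "(\<Sum>j<Suc n. f j \<cdot> g' j) \<cdot> f l = f l" if l: "l < Suc n" for l
  proof -
    have fl: "f l \<in> Hom (x l) y" "x l \<in> Obj" using fh xo l by auto
    have 1: "(\<Sum>j<Suc n. f j \<cdot> g' j) \<cdot> f l = E \<cdot> f l + (h \<cdot> w) \<cdot> f l"
      unfolding E' efnw using Comp_add_left[OF fl(2) y y fl(1) E hw] .
    have "(h \<cdot> w) \<cdot> f l = h \<cdot> (k \<cdot> e) \<cdot> f l"
      using comp_assoc[OF h w fl(1)] fn fl y by (simp add: w_def)
    also have "(k \<cdot> e) \<cdot> f l = k \<cdot> e \<cdot> f l" using comp_assoc[OF k e fl(1)] fn fl y by simp
    finally have 2: "(h \<cdot> w) \<cdot> f l = h \<cdot> k \<cdot> e \<cdot> f l" .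
    show ?thesis
    \<comment> \<open>On \<open>f n\<close> the extra term is
      \<open>h \<cdot> k \<cdot> h = h\<close>, exactly what \<open>E\<close> misses; on an earlier
      map it vanishes because \<open>e \<cdot> f l = 0\<close>.\<close>
    proof (cases "l = n")
      case True
      then have "(h \<cdot> w) \<cdot> f l = h" using 2 hk by (simp add: h_def)
      then show ?thesis using 1 ef[OF fl] True by (simp add: h_def)
    next
      case False
      then have Efl: "E \<cdot> f l = f l" using Ef l by (simp add: E_def)
      then have "h \<cdot> k \<cdot> e \<cdot> f l = 0"
        using ef[OF fl] comp_zero_right[OF k] comp_zero_right[OF h] fn y fl by simp
      then show ?thesis using 1 2 Efl by simp
    qed
  qed
  then show ?case using g' by blast
qed

end

text \<open>The kernel of \<open>f\<close> is a subobject of the simple \<open>x\<close>; it is not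
  all of \<open>x\<close> because \<open>f\<close> is nonzero, so it is zero and \<open>f\<close> is
  a mono. Then \<open>f\<close> exhibits the nonzero object \<open>x\<close> as a subobject of the
  simple \<open>y\<close>.\<close>

lemma (in abelian_category) schur:
  assumes "is_simple C x" "is_simple C y" and f: "f \<in> Hom x y" "f \<noteq> 0"
  shows "is_iso C x y f"
proof -
  have ob: "x \<in> Obj" "y \<in> Obj" and nz: "\<not> is_zero_object C x" using assms by (auto simp: is_simple_def)
  obtain z i where z: "z \<in> Obj" and k: "is_kernel C x y f z i"
    using kernel_exists[OF ob f(1)] by blast
  have i: "i \<in> Hom z x" "f \<cdot> i = 0" using k by (auto simp: is_kernel_def)
  have "\<not> is_iso C z x i"
  proof
    assume "is_iso C z x i"
    then obtain j where j: "j \<in> Hom x z" "i \<cdot> j = Idn x" by (auto simp: is_iso_def is_inverse_def)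
    have "f = f \<cdot> i \<cdot> j" using j f ob Comp_Idn_right by simp
    also have "\<dots> = 0" using comp_assoc[OF f(1) i(1) j(1)] i comp_zero_left[OF j(1)] ob z by simp
    finally show False using f by simp
  qed
  then have zz: "is_zero_object C z"
    using assms(1) kernel_is_mono[OF k ob z] z by (auto simp: is_simple_def)
  have "is_mono C x y f" unfolding is_mono_def
  proof (intro conjI ballI impI f)
    fix t g h assume t: "t \<in> Obj" "g \<in> Hom t x" "h \<in> Hom t x" "f \<cdot> g = f \<cdot> h"
    then have "f \<cdot> (g - h) = 0" using comp_diff_right[OF f(1) t(2,3)] ob by simp
    moreover have "g - h \<in> Hom t x" using diff_hom t ob by simp
    ultimately obtain u where "u \<in> Hom t z" "i \<cdot> u = g - h"
      using kernel_factor[OF k t(1)] by blast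
    moreover have "i = 0" using zz i ob by (auto simp: is_zero_object_def)
    ultimately have "g - h = 0" using comp_zero_left t z ob by metis
    then show "g = h" by simp
  qed
  then show ?thesis using assms(2) ob nz by (auto simp: is_simple_def)
qed

section \<open>Semisimple categories are regular\<close>

context semisimple_category
begin

text \<open>If \<open>h\<close> is nonzero, some component of \<open>h\<close> at a simple summand
  of \<open>y\<close> is nonzero, hence invertible by Schur's lemma. Its inverse after the
  projection is a left inverse of \<open>h\<close>.\<close>

lemma simple_source_regular:
  assumes "is_simple C x" "y \<in> Obj" and h: "h \<in> Hom x y"
  shows "\<exists>k\<in>Hom y x. h \<cdot> k \<cdot> h = h"
proof (cases "h = 0")
  case True
  have "x \<in> Obj" using assms by (auto simp: is_simple_def)
  then show ?thesis using True assms zero_hom comp_zero_left by (metis Comp_closed)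
next
  case False
  have x: "x \<in> Obj" using assms by (auto simp: is_simple_def)
  obtain n z where z: "\<And>j. j < n \<Longrightarrow> is_simple C (z j)" and ds: "is_direct_sum C n z y"
    using semisimple[OF assms(2)] by blast
  obtain i p where i: "\<And>j. j < n \<Longrightarrow> i j \<in> Hom (z j) y" and p: "\<And>j. j < n \<Longrightarrow> p j \<in> Hom y (z j)"
    and id: "Idn y = (\<Sum>j<n. i j \<cdot> p j)"
    using ds by (auto simp: is_direct_sum_def)
  have zo: "\<And>j. j < n \<Longrightarrow> z j \<in> Obj" using z by (auto simp: is_simple_def)
  have "h = (\<Sum>j<n. i j \<cdot> p j \<cdot> h)"
    using direct_sum_components[OF i p zo assms(2) x id h] .
  then obtain l where l: "l < n" "p l \<cdot> h \<noteq> 0"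
  proof -
    have "\<not> (\<forall>j<n. p j \<cdot> h = 0)"
    proof
      assume "\<forall>j<n. p j \<cdot> h = 0"
      then have "(\<Sum>j<n. i j \<cdot> p j \<cdot> h) = 0"
        using comp_zero_right[OF i] assms(2) x zo by (intro sum.neutral) auto
      then show False using \<open>h = _\<close> False by simp
    qed
    then show ?thesis using that by blast
  qed
  have pl: "p l \<in> Hom y (z l)" "z l \<in> Obj" using p zo l by auto
  have "p l \<cdot> h \<in> Hom x (z l)" using comp_hom[OF pl(1) h] pl x assms by simp
  then have "is_iso C x (z l) (p l \<cdot> h)" using schur[OF assms(1) z] l by simp
  then obtain u where u: "u \<in> Hom (z l) x" "u \<cdot> (p l \<cdot> h) = Idn x"
    by (auto simp: is_iso_def is_inverse_def)
  have "h \<cdot> (u \<cdot> p l) \<cdot> h = h"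
    using comp_assoc[OF u(1) pl(1) h] u pl x assms Comp_Idn_right by simp
  moreover have "u \<cdot> p l \<in> Hom y x" using comp_hom[OF u(1) pl(1)] pl x assms by simp
  ultimately show ?thesis by blast
qed

text \<open>Restrict \<open>f\<close> to the simple summands of its source. The family lemma yields
  an endomorphism of the form \<open>f \<cdot> G\<close> that fixes all these restrictions, hence
  fixes \<open>f\<close>.\<close>

lemma regular: "regular_category C"
  unfolding regular_category_def
proof (intro ballI)
  fix a b f assume a: "a \<in> Obj" and b: "b \<in> Obj" and f: "f \<in> Hom a b"
  obtain n x where x: "\<And>j. j < n \<Longrightarrow> is_simple C (x j)" and ds: "is_direct_sum C n x a"
    using semisimple[OF a] by blast
  obtain i p where i: "\<And>j. j < n \<Longrightarrow> i j \<in> Hom (x j) a" and p: "\<And>j. j < n \<Longrightarrow> p j \<in> Hom a (x j)"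
    and id: "Idn a = (\<Sum>j<n. i j \<cdot> p j)"
    using ds by (auto simp: is_direct_sum_def)
  have xo: "\<And>j. j < n \<Longrightarrow> x j \<in> Obj" using x by (auto simp: is_simple_def)
  have fi: "f \<cdot> i j \<in> Hom (x j) b" if "j < n" for j
    using comp_hom[OF f i] that xo a b by simp
  obtain g where g: "\<And>j. j < n \<Longrightarrow> g j \<in> Hom b (x j)"
    and gf: "\<And>l. l < n \<Longrightarrow> (\<Sum>j<n. (f \<cdot> i j) \<cdot> g j) \<cdot> f \<cdot> i l = f \<cdot> i l"
    using regular_family[of b n x "\<lambda>j. f \<cdot> i j"] b xo fi simple_source_regular[OF x b] by blast
  define G where "G = (\<Sum>j<n. i j \<cdot> g j)"
  have G: "G \<in> Hom b a" unfolding G_def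
    by (rule sum_hom) (use comp_hom[OF i g] xo a b in auto)
  have fG: "f \<cdot> G = (\<Sum>j<n. (f \<cdot> i j) \<cdot> g j)"
    unfolding G_def
    by (subst comp_sum_right[OF f, of _ _ b])
      (use comp_hom[OF i g] comp_assoc[OF f i g] xo a b in auto)
  have fGh: "f \<cdot> G \<in> Hom b b" using comp_hom[OF f G] a b by simp
  have fs: "f = (\<Sum>j<n. (f \<cdot> i j) \<cdot> p j)"
  proof -
    have "f = f \<cdot> (\<Sum>j<n. i j \<cdot> p j)" using Comp_Idn_right[OF a b f] id by simp
    also have "\<dots> = (\<Sum>j<n. (f \<cdot> i j) \<cdot> p j)"
      by (subst comp_sum_right[OF f, of _ _ a])
        (use comp_hom[OF i p] comp_assoc[OF f i p] xo a b in auto)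
    finally show ?thesis .
  qed
  have "(f \<cdot> G) \<cdot> f = (\<Sum>j<n. (f \<cdot> G) \<cdot> (f \<cdot> i j) \<cdot> p j)"
    by (subst (2) fs, subst comp_sum_right[of _ b b _ _ a])
      (use fGh comp_hom[OF fi p] xo a b in auto)
  also have "\<dots> = (\<Sum>j<n. (f \<cdot> i j) \<cdot> p j)"
  proof (rule sum.cong[OF refl])
    fix j assume "j \<in> {..<n}"
    then have j: "j < n" by simp
    show "(f \<cdot> G) \<cdot> (f \<cdot> i j) \<cdot> p j = (f \<cdot> i j) \<cdot> p j"
      using comp_assoc[OF fGh fi[OF j] p[OF j]] gf[OF j] xo[OF j] a b by (simp add: fG)
  qed
  finally have "(f \<cdot> G) \<cdot> f = f" using fs by simp
  then show "\<exists>g\<in>Hom b a. f \<cdot> g \<cdot> f = f" using G comp_assoc[OF f G f] a b by auto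
qed

end

text \<open>The image of an idempotent \<open>e\<close> is the kernel of \<open>Idn a - e\<close>;
  the retraction is the factorization of \<open>e\<close> through this kernel.\<close>

lemma (in abelian_category) idempotents_split: "idempotents_split C"
  unfolding idempotents_split_def
proof (intro ballI impI)
  fix a e assume a: "a \<in> Obj" and e: "e \<in> Hom a a" and ee: "e \<cdot> e = e"
  define f where "f = Idn a - e"
  have f: "f \<in> Hom a a" unfolding f_def by (intro diff_hom Idn_closed a e)
  have fu: "f \<cdot> u = u - e \<cdot> u" if "u \<in> Hom b a" "b \<in> Obj" for u b
    unfolding f_def using comp_diff_left[OF Idn_closed e that(1)] Comp_Idn_left that a by simp
  obtain b i where b: "b \<in> Obj" and k: "is_kernel C a a f b i"
    using kernel_exists[OF a a f] by blast
  have i: "i \<in> Hom b a" "f \<cdot> i = 0" using k by (auto simp: is_kernel_def)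
  have "f \<cdot> e = 0" using fu[OF e a] ee by simp
  then obtain p where p: "p \<in> Hom a b" "i \<cdot> p = e"
    using kernel_factor[OF k a e] by blast
  have "i \<cdot> p \<cdot> i = i \<cdot> Idn b"
    using comp_assoc[OF i(1) p(1) i(1)] p fu[OF i(1) b] i Comp_Idn_right a b by simp
  moreover have "p \<cdot> i \<in> Hom b b" using comp_hom[OF p(1) i(1)] a b by simp
  ultimately have "p \<cdot> i = Idn b"
    using kernel_is_mono[OF k a a b] b Idn_closed[OF b] by (auto simp: is_mono_def)
  then show "\<exists>b\<in>Obj. \<exists>p i. is_retract C a b p i \<and> i \<cdot> p = e"
    using b p i by (auto simp: is_retract_def)
qed

section \<open>From regularity and split idempotents to semisimplicity\<close>

context linear_category
begin

text \<open>Split the complementary idempotent \<open>Idn a - i \<cdot> p\<close>. The mixed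
  composites vanish because the two idempotents annihilate each other.\<close>

lemma retract_complement:
  assumes split: "idempotents_split C" and r: "is_retract C a b p i" and ob: "a \<in> Obj" "b \<in> Obj"
  obtains c q j where "c \<in> Obj" "is_retract C a c q j" "p \<cdot> j = 0" "q \<cdot> i = 0" "Idn a = i \<cdot> p + j \<cdot> q"
proof -
  have p: "p \<in> Hom a b" and i: "i \<in> Hom b a" and pi: "p \<cdot> i = Idn b"
    using r by (auto simp: is_retract_def)
  have ip: "i \<cdot> p \<in> Hom a a" using comp_hom[OF i p] ob by simp
  define e where "e = Idn a - i \<cdot> p"
  have e: "e \<in> Hom a a" unfolding e_def by (intro diff_hom Idn_closed ip ob)
  have eu: "e \<cdot> u = u - i \<cdot> p \<cdot> u" if "u \<in> Hom d a" "d \<in> Obj" for u d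
    unfolding e_def using comp_diff_left[OF Idn_closed ip that(1)] comp_assoc[OF i p that(1)]
      Comp_Idn_left that ob by simp
  have ei: "e \<cdot> i = 0" using eu[OF i] pi Comp_Idn_right[OF _ _ i] ob by simp
  have "e \<cdot> i \<cdot> p = 0" using comp_assoc[OF e i p] ei comp_zero_left[OF p] ob by simp
  then have "e \<cdot> e = e"
    using comp_diff_right[OF e Idn_closed ip] Comp_Idn_right[OF _ _ e] ob by (simp add: e_def)
  then obtain c q j where c: "c \<in> Obj" and r': "is_retract C a c q j" and jq: "j \<cdot> q = e"
    using split e ob unfolding idempotents_split_def by blast
  have q: "q \<in> Hom a c" and j: "j \<in> Hom c a" and qj: "q \<cdot> j = Idn c"
    using r' by (auto simp: is_retract_def)
  have "q \<cdot> i = (q \<cdot> j) \<cdot> q \<cdot> i"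
    using qj Comp_Idn_left comp_hom[OF q i] ob c by simp
  also have "\<dots> = q \<cdot> (j \<cdot> q) \<cdot> i"
    using comp_assoc[OF q j comp_hom[OF q i]] comp_assoc[OF j q i] ob c by simp
  also have "\<dots> = 0" using jq ei comp_zero_right[OF q] ob c by simp
  finally have qi: "q \<cdot> i = 0" .
  have "e \<cdot> j = j" using jq comp_assoc[OF j q j] qj Comp_Idn_right[OF _ _ j] ob c by auto
  then have ipj: "i \<cdot> p \<cdot> j = 0" using eu[OF j c] by simp
  have "p \<cdot> j = (p \<cdot> i) \<cdot> p \<cdot> j" using pi Comp_Idn_left comp_hom[OF p j] ob c by simp
  also have "\<dots> = p \<cdot> i \<cdot> p \<cdot> j" using comp_assoc[OF p i comp_hom[OF p j]] ob c by simp
  also have "\<dots> = 0" using ipj comp_zero_right[OF p] ob c by simp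
  finally have pj: "p \<cdot> j = 0" .
  show thesis using that[OF c r' pj qi] jq by (simp add: e_def)
qed

text \<open>Regularity gives \<open>f \<cdot> g \<cdot> f = f \<cdot> Idn a\<close>, in which a mono
  can be cancelled on the left.\<close>

lemma regular_mono_splits:
  assumes "regular_category C" "is_mono C a b f" and ob: "a \<in> Obj" "b \<in> Obj"
  obtains g where "is_retract C b a g f"
proof -
  have f: "f \<in> Hom a b" using assms by (simp add: is_mono_def)
  then obtain g where g: "g \<in> Hom b a" "f \<cdot> g \<cdot> f = f"
    using assms unfolding regular_category_def by blast
  have "f \<cdot> g \<cdot> f = f \<cdot> Idn a" using g Comp_Idn_right[OF _ _ f] ob by simp
  then have "g \<cdot> f = Idn a"
    using assms(2) comp_hom[OF g(1) f] Idn_closed ob unfolding is_mono_def by blast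
  then show thesis using that f g by (auto simp: is_retract_def)
qed

lemma regular_epi_splits:
  assumes "regular_category C" "is_epi C a b f" and ob: "a \<in> Obj" "b \<in> Obj"
  obtains g where "is_retract C a b f g"
proof -
  have f: "f \<in> Hom a b" using assms by (simp add: is_epi_def)
  then obtain g where g: "g \<in> Hom b a" "f \<cdot> g \<cdot> f = f"
    using assms unfolding regular_category_def by blast
  have "(f \<cdot> g) \<cdot> f = Idn b \<cdot> f" using g comp_assoc[OF f g(1) f] Comp_Idn_left[OF _ _ f] ob by simp
  then have "f \<cdot> g = Idn b"
    using assms(2) comp_hom[OF f g(1)] Idn_closed ob unfolding is_epi_def by blast
  then show thesis using that f g by (auto simp: is_retract_def)
qed

text \<open>The summand \<open>u \<cdot> f\<close> of the identity kills every \<open>g\<close> with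
  \<open>f \<cdot> g = 0\<close>, so \<open>g\<close> is \<open>i \<cdot> p \<cdot> g\<close>.
  Uniqueness of the factorization is \<open>p \<cdot> i = Idn b\<close>.\<close>

lemma retract_is_kernel:
  assumes r: "is_retract C a b p i" and f: "f \<in> Hom a c" "f \<cdot> i = 0"
    and u: "u \<in> Hom c a" "Idn a = i \<cdot> p + u \<cdot> f" and ob: "a \<in> Obj" "b \<in> Obj" "c \<in> Obj"
  shows "is_kernel C a c f b i"
  unfolding is_kernel_def
proof (intro conjI ballI impI)
  have p: "p \<in> Hom a b" and i: "i \<in> Hom b a" and pi: "p \<cdot> i = Idn b"
    using r by (auto simp: is_retract_def)
  show "f \<in> Hom a c" "i \<in> Hom b a" "f \<cdot> i = 0" using f i by auto
  fix t g assume t: "t \<in> Obj" and g: "g \<in> Hom t a" and fg: "f \<cdot> g = 0"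
  have "g = (i \<cdot> p + u \<cdot> f) \<cdot> g" using u Comp_Idn_left[OF _ _ g] t ob by simp
  also have "\<dots> = i \<cdot> p \<cdot> g + u \<cdot> f \<cdot> g"
    using Comp_add_left[OF _ _ _ g comp_hom[OF i p] comp_hom[OF u(1) f(1)]]
      comp_assoc[OF i p g] comp_assoc[OF u(1) f(1) g] t ob by simp
  also have "\<dots> = i \<cdot> p \<cdot> g" using fg comp_zero_right[OF u(1) t] ob by simp
  finally have "i \<cdot> p \<cdot> g = g" by simp
  moreover have "h = p \<cdot> g" if "h \<in> Hom t b" "i \<cdot> h = g" for h
    using comp_assoc[OF p i that(1)] pi that Comp_Idn_left[OF _ _ that(1)] t ob by simp
  ultimately show "\<exists>!h. h \<in> Hom t b \<and> i \<cdot> h = g"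
    using comp_hom[OF p g] t ob by blast
qed

lemma retract_is_cokernel:
  assumes r: "is_retract C a b p i" and f: "f \<in> Hom c a" "p \<cdot> f = 0"
    and u: "u \<in> Hom a c" "Idn a = i \<cdot> p + f \<cdot> u" and ob: "a \<in> Obj" "b \<in> Obj" "c \<in> Obj"
  shows "is_cokernel C c a f b p"
  unfolding is_cokernel_def
proof (intro conjI ballI impI)
  have p: "p \<in> Hom a b" and i: "i \<in> Hom b a" and pi: "p \<cdot> i = Idn b"
    using r by (auto simp: is_retract_def)
  show "f \<in> Hom c a" "p \<in> Hom a b" "p \<cdot> f = 0" using f p by auto
  fix t g assume t: "t \<in> Obj" and g: "g \<in> Hom a t" and gf: "g \<cdot> f = 0"
  have "g = g \<cdot> (i \<cdot> p + f \<cdot> u)" using u Comp_Idn_right[OF _ _ g] t ob by simp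
  also have "\<dots> = (g \<cdot> i) \<cdot> p + (g \<cdot> f) \<cdot> u"
    using Comp_add_right[OF _ _ _ comp_hom[OF i p] comp_hom[OF f(1) u(1)] g]
      comp_assoc[OF g i p] comp_assoc[OF g f(1) u(1)] t ob by simp
  also have "\<dots> = (g \<cdot> i) \<cdot> p" using gf comp_zero_left[OF u(1) _ _ t] ob by simp
  finally have "(g \<cdot> i) \<cdot> p = g" by simp
  moreover have "h = g \<cdot> i" if "h \<in> Hom b t" "h \<cdot> p = g" for h
    using comp_assoc[OF that(1) p i] pi that Comp_Idn_right[OF _ _ that(1)] t ob by simp
  ultimately show "\<exists>!h. h \<in> Hom b t \<and> h \<cdot> p = g"
    using comp_hom[OF g i] t ob by blast
qed

text \<open>If \<open>f \<cdot> g \<cdot> f = f\<close>, then \<open>g \<cdot> f\<close> and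
  \<open>f \<cdot> g\<close> are idempotent. The kernel of \<open>f\<close> is the image of the
  complement of \<open>g \<cdot> f\<close>, the cokernel that of the complement of
  \<open>f \<cdot> g\<close>. Monos and epis split, so each is the kernel or cokernel of a map to or
  from its complement.\<close>

lemma regular_abelian:
  assumes reg: "regular_category C" and split: "idempotents_split C"
    and sums: "\<And>n x. (\<And>j. j < n \<Longrightarrow> x j \<in> Obj) \<Longrightarrow> \<exists>s\<in>Obj. is_direct_sum C n x s"
  shows "abelian_category C"
proof
  fix a b f assume ob: "a \<in> Obj" "b \<in> Obj" and f: "f \<in> Hom a b"
  obtain g where g: "g \<in> Hom b a" and fgf: "f \<cdot> g \<cdot> f = f"
    using reg ob f unfolding regular_category_def by blast
  have gf: "g \<cdot> f \<in> Hom a a" and fg: "f \<cdot> g \<in> Hom b b"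
    using comp_hom[OF g f] comp_hom[OF f g] ob by auto
  have "(g \<cdot> f) \<cdot> g \<cdot> f = g \<cdot> f"
    using comp_assoc[OF g f comp_hom[OF g f]] fgf ob by simp
  then obtain c p i where c: "c \<in> Obj" and r: "is_retract C a c p i" and ip: "i \<cdot> p = g \<cdot> f"
    using split gf ob unfolding idempotents_split_def by blast
  obtain d q j where d: "d \<in> Obj" and r': "is_retract C a d q j" and pj: "p \<cdot> j = 0"
    and id: "Idn a = i \<cdot> p + j \<cdot> q"
    by (rule retract_complement[OF split r]) (use ob c in auto)
  have hom: "p \<in> Hom a c" "i \<in> Hom c a" "q \<in> Hom a d" "j \<in> Hom d a"
    using r r' by (auto simp: is_retract_def)
  have "f \<cdot> j = f \<cdot> (g \<cdot> f) \<cdot> j"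
    using comp_assoc[OF f gf hom(4)] fgf ob d by simp
  also have "\<dots> = 0" unfolding ip[symmetric]
    using comp_assoc[OF hom(2,1,4)] pj comp_zero_right[OF hom(2), of d] comp_zero_right[OF f, of d] ob c d
    by simp
  finally have "is_kernel C a b f d j"
    using retract_is_kernel[OF r' f _ g] id ob d ip by (simp add: add.commute)
  then show "\<exists>x\<in>Obj. \<exists>i. is_kernel C a b f x i" using d by blast
next
  fix a b f assume ob: "a \<in> Obj" "b \<in> Obj" and f: "f \<in> Hom a b"
  obtain g where g: "g \<in> Hom b a" and fgf: "f \<cdot> g \<cdot> f = f"
    using reg ob f unfolding regular_category_def by blast
  have fg: "f \<cdot> g \<in> Hom b b" using comp_hom[OF f g] ob by auto
  have fgf': "(f \<cdot> g) \<cdot> f = f" using comp_assoc[OF f g f] fgf ob by simp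
  have "(f \<cdot> g) \<cdot> f \<cdot> g = f \<cdot> g"
    using comp_assoc[OF fg f g] fgf' ob by simp
  then obtain c p i where c: "c \<in> Obj" and r: "is_retract C b c p i" and ip: "i \<cdot> p = f \<cdot> g"
    using split fg ob unfolding idempotents_split_def by blast
  obtain d q j where d: "d \<in> Obj" and r': "is_retract C b d q j" and qi: "q \<cdot> i = 0"
    and id: "Idn b = i \<cdot> p + j \<cdot> q"
    by (rule retract_complement[OF split r]) (use ob c in auto)
  have hom: "p \<in> Hom b c" "i \<in> Hom c b" "q \<in> Hom b d" "j \<in> Hom d b"
    using r r' by (auto simp: is_retract_def)
  have "q \<cdot> f = (q \<cdot> f \<cdot> g) \<cdot> f"
    using comp_assoc[OF hom(3) fg f] fgf' ob d by simp
  also have "\<dots> = 0" unfolding ip[symmetric]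
    using comp_assoc[OF hom(3,2,1)] qi comp_zero_left[OF hom(1)] comp_zero_left[OF f] ob c d
    by simp
  finally have "is_cokernel C a b f d q"
    using retract_is_cokernel[OF r' f _ g] id ob d ip by (simp add: add.commute)
  then show "\<exists>x\<in>Obj. \<exists>p. is_cokernel C a b f x p" using d by blast
next
  fix a b f assume ob: "a \<in> Obj" "b \<in> Obj" and f: "is_mono C a b f"
  obtain g where r: "is_retract C b a g f" by (rule regular_mono_splits[OF reg f ob])
  obtain d q j where d: "d \<in> Obj" and r': "is_retract C b d q j" and "q \<cdot> f = 0"
    and "Idn b = f \<cdot> g + j \<cdot> q"
    by (rule retract_complement[OF split r]) (use ob in auto)
  then have "is_kernel C b d q a f"
    using retract_is_kernel[OF r] ob r' by (auto simp: is_retract_def)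
  then show "\<exists>c\<in>Obj. \<exists>g. is_kernel C b c g a f" using d by blast
next
  fix a b f assume ob: "a \<in> Obj" "b \<in> Obj" and f: "is_epi C a b f"
  obtain g where r: "is_retract C a b f g" by (rule regular_epi_splits[OF reg f ob])
  obtain d q j where d: "d \<in> Obj" and r': "is_retract C a d q j" and "f \<cdot> j = 0"
    and "Idn a = g \<cdot> f + j \<cdot> q"
    by (rule retract_complement[OF split r]) (use ob in auto)
  then have "is_cokernel C d a j b f"
    using retract_is_cokernel[OF r] ob r' by (auto simp: is_retract_def)
  then show "\<exists>c\<in>Obj. \<exists>g. is_cokernel C c a g b f" using d by blast
qed (rule sums)

text \<open>The idempotents \<open>i j \<cdot> p j\<close> are linearly independent in
  \<open>Hom a a\<close>: putting a linear relation between \<open>p l\<close> and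
  \<open>i l\<close> leaves only the coefficient with index \<open>l\<close>, times the nonzero
  \<open>Idn (x l)\<close>.\<close>

lemma direct_sum_length_bound:
  assumes ds: "is_direct_sum C n x a" and a: "a \<in> Obj"
    and x: "\<And>j. j < n \<Longrightarrow> x j \<in> Obj \<and> \<not> is_zero_object C (x j)"
    and B: "finite B" "Hom a a \<subseteq> vs.span B"
  shows "n \<le> card B"
proof -
  obtain i p where i: "\<And>j. j < n \<Longrightarrow> i j \<in> Hom (x j) a" and p: "\<And>j. j < n \<Longrightarrow> p j \<in> Hom a (x j)"
    and pi: "\<And>j l. \<lbrakk>j < n; l < n\<rbrakk> \<Longrightarrow> p j \<cdot> i l = (if j = l then Idn (x j) else 0)"
    using ds unfolding is_direct_sum_def by blast
  have xo: "x j \<in> Obj" and nz: "Idn (x j) \<noteq> 0" if "j < n" for j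
    using x[OF that] by (auto simp: zero_object_iff)
  define e where "e = (\<lambda>j. i j \<cdot> p j)"
  have e: "e j \<in> Hom a a" if "j < n" for j
    unfolding e_def using comp_hom[OF i p] that xo a by simp
  have pe: "p l \<cdot> e j \<cdot> i l = (if j = l then Idn (x l) else 0)" if "j < n" "l < n" for j l
  proof -
    have "e j \<cdot> i l = i j \<cdot> p j \<cdot> i l"
      unfolding e_def using comp_assoc[OF i p i] that xo a by simp
    then show ?thesis
      using pi that Comp_Idn_right[OF _ _ i] comp_zero_right[OF i] comp_zero_right[OF p] xo a by auto
  qed
  \<comment> \<open>Independence speaks of the set of these idempotents. Only with distinct values
    does the size of that set count the summands.\<close>
  have inj: "inj_on e {..<n}"
    using pe nz by (intro inj_onI) (metis lessThan_iff)
  have "\<not> vs.dependent (e ` {..<n})"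
  proof
    assume "vs.dependent (e ` {..<n})"
    then obtain u l where l: "l < n" "u (e l) \<noteq> 0" and s: "(\<Sum>v\<in>e ` {..<n}. Scale C (u v) v) = 0"
      by (auto simp: vs.dependent_finite)
    define S where "S = (\<Sum>j<n. Scale C (u (e j)) (e j))"
    have "S = 0" using s by (simp add: S_def sum.reindex[OF inj])
    have se: "Scale C (u (e j)) (e j) \<in> Hom a a" if "j < n" for j
      using scale_hom[OF e] that a by simp
    have sei: "e j \<cdot> i l \<in> Hom (x l) a" if "j < n" for j
      using comp_hom[OF e i] that l xo a by simp
    have sei': "Scale C (u (e j)) (e j \<cdot> i l) \<in> Hom (x l) a" if "j < n" for j
      using scale_hom[OF sei] that l xo a by simp
    have "p l \<cdot> S \<cdot> i l = p l \<cdot> (\<Sum>j<n. Scale C (u (e j)) (e j \<cdot> i l))"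
      unfolding S_def
      by (subst comp_sum_left[OF _ i[OF l(1)], of _ _ a])
        (use se Comp_scale_left[OF _ _ _ i e] l xo a in auto)
    also have "\<dots> = (\<Sum>j<n. Scale C (u (e j)) (p l \<cdot> e j \<cdot> i l))"
      by (subst comp_sum_right[OF p[OF l(1)], of _ _ "x l"])
        (use sei' Comp_scale_right[OF _ _ _ sei p] l xo a in auto)
    also have "\<dots> = (\<Sum>j<n. if j = l then Scale C (u (e l)) (Idn (x l)) else 0)"
      using pe l by (intro sum.cong) auto
    also have "\<dots> = Scale C (u (e l)) (Idn (x l))" using l by simp
    finally have "Scale C (u (e l)) (Idn (x l)) = 0"
      using \<open>S = 0\<close> comp_zero_left[OF i, of l a] comp_zero_right[OF p, of l "x l"] l xo a by simp
    then show False using l nz by (simp add: vs.scale_eq_0_iff)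
  qed
  moreover have "e ` {..<n} \<subseteq> vs.span B" using e B by auto
  ultimately have "card (e ` {..<n}) \<le> card B"
    using vs.independent_span_bound[OF B(1)] by blast
  then show ?thesis using card_image[OF inj] by simp
qed

text \<open>The summand at position \<open>l\<close> is split in two: one half keeps the position,
  the other is appended at the fresh index \<open>n\<close>. Inclusions and projections are composed
  with those of the finer splitting.\<close>

lemma direct_sum_refine:
  assumes ds: "is_direct_sum C n x a" and a: "a \<in> Obj" and x: "\<And>j. j < n \<Longrightarrow> x j \<in> Obj" and l: "l < n"
    and yz: "y \<in> Obj" "z \<in> Obj"
    and r: "is_retract C (x l) y q v" "is_retract C (x l) z q' v'" "q \<cdot> v' = 0" "q' \<cdot> v = 0"
      "Idn (x l) = v \<cdot> q + v' \<cdot> q'"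
  shows "is_direct_sum C (Suc n) (x(l := y, n := z)) a"
proof -
  obtain i p where i: "\<And>j. j < n \<Longrightarrow> i j \<in> Hom (x j) a" and p: "\<And>j. j < n \<Longrightarrow> p j \<in> Hom a (x j)"
    and pi: "\<And>j l. \<lbrakk>j < n; l < n\<rbrakk> \<Longrightarrow> p j \<cdot> i l = (if j = l then Idn (x j) else 0)"
    and id: "Idn a = (\<Sum>j<n. i j \<cdot> p j)"
    using ds unfolding is_direct_sum_def by blast
  have hom: "q \<in> Hom (x l) y" "v \<in> Hom y (x l)" "q' \<in> Hom (x l) z" "v' \<in> Hom z (x l)"
    and qv: "q \<cdot> v = Idn y" "q' \<cdot> v' = Idn z"
    using r by (auto simp: is_retract_def)
  note xl = x[OF l] and il = i[OF l] and pl = p[OF l]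
  define i' where "i' = i(l := i l \<cdot> v, n := i l \<cdot> v')"
  define p' where "p' = p(l := q \<cdot> p l, n := q' \<cdot> p l)"
  have hh: "i l \<cdot> v \<in> Hom y a" "i l \<cdot> v' \<in> Hom z a" "q \<cdot> p l \<in> Hom a y" "q' \<cdot> p l \<in> Hom a z"
    using comp_hom[OF il] comp_hom[OF _ pl] hom xl a yz by auto
  have A: "(s \<cdot> p l) \<cdot> i l \<cdot> t = s \<cdot> t"
    if "s \<in> Hom (x l) b" "t \<in> Hom c (x l)" "b \<in> Obj" "c \<in> Obj" for s t b c
    using comp_assoc[OF that(1) pl comp_hom[OF il that(2)]] comp_assoc[OF pl il that(2)]
      pi[OF l l] Comp_Idn_left[OF _ _ that(2)] that xl a by simp
  have B: "(s \<cdot> p l) \<cdot> i j = 0" if "s \<in> Hom (x l) b" "b \<in> Obj" "j < n" "j \<noteq> l" for s b j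
    using comp_assoc[OF that(1) pl i[OF that(3)]] pi[OF l that(3)] comp_zero_right[OF that(1)]
      that xl x[OF that(3)] a by simp
  have D: "p j \<cdot> i l \<cdot> t = 0" if "t \<in> Hom c (x l)" "c \<in> Obj" "j < n" "j \<noteq> l" for t c j
    using comp_assoc[OF p[OF that(3)] il that(1)] pi[OF that(3) l] comp_zero_left[OF that(1)]
      that xl x[OF that(3)] a by simp
  have orth: "p' j \<cdot> i' k = (if j = k then Idn ((x(l := y, n := z)) j) else 0)"
    if "j < Suc n" "k < Suc n" for j k
    using that l A[OF hom(1,2) yz(1,1)] A[OF hom(1,4) yz(1,2)] A[OF hom(3,2) yz(2,1)]
      A[OF hom(3,4) yz(2,2)] B[OF hom(1) yz(1), of k] B[OF hom(3) yz(2), of k]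
      D[OF hom(2) yz(1), of j] D[OF hom(4) yz(2), of j] r(3,4) qv pi[of j k]
    by (auto simp: i'_def p'_def less_Suc_eq)
  have E: "(i l \<cdot> t) \<cdot> s \<cdot> p l = i l \<cdot> (t \<cdot> s) \<cdot> p l"
    if "s \<in> Hom (x l) b" "t \<in> Hom b (x l)" "b \<in> Obj" for s t b
    using comp_assoc[OF il that(2) comp_hom[OF that(1) pl]] comp_assoc[OF that(2,1) pl] that xl a by simp
  have vq: "v \<cdot> q \<in> Hom (x l) (x l)" "v' \<cdot> q' \<in> Hom (x l) (x l)"
    using comp_hom hom xl yz by auto
  have "i' l \<cdot> p' l + i' n \<cdot> p' n = i l \<cdot> (v \<cdot> q) \<cdot> p l + i l \<cdot> (v' \<cdot> q') \<cdot> p l"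
    using l E[OF hom(1,2) yz(1)] E[OF hom(3,4) yz(2)] by (simp add: i'_def p'_def)
  also have "\<dots> = i l \<cdot> (v \<cdot> q + v' \<cdot> q') \<cdot> p l"
    using Comp_add_left[OF _ _ _ pl vq] Comp_add_right[OF _ _ _ comp_hom[OF vq(1) pl] comp_hom[OF vq(2) pl] il]
      xl a by simp
  also have "\<dots> = i l \<cdot> p l" using r(5) Comp_Idn_left[OF _ _ pl] xl a by simp
  finally have il': "i' l \<cdot> p' l + i' n \<cdot> p' n = i l \<cdot> p l" .
  have "(\<Sum>j<Suc n. i' j \<cdot> p' j) = (\<Sum>j\<in>{..<n} - {l}. i' j \<cdot> p' j) + (i' l \<cdot> p' l + i' n \<cdot> p' n)"
    using l by (simp add: sum.remove[of "{..<n}" l] algebra_simps)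
  also have "(\<Sum>j\<in>{..<n} - {l}. i' j \<cdot> p' j) = (\<Sum>j\<in>{..<n} - {l}. i j \<cdot> p j)"
    by (rule sum.cong) (auto simp: i'_def p'_def)
  also have "\<dots> + (i' l \<cdot> p' l + i' n \<cdot> p' n) = Idn a"
    using l by (simp add: il' id sum.remove[of "{..<n}" l] algebra_simps)
  finally have "Idn a = (\<Sum>j<Suc n. i' j \<cdot> p' j)" by simp
  moreover have "i' j \<in> Hom ((x(l := y, n := z)) j) a \<and> p' j \<in> Hom a ((x(l := y, n := z)) j)"
    if "j < Suc n" for j
    using that i p hh l by (auto simp: i'_def p'_def less_Suc_eq)
  ultimately show ?thesis unfolding is_direct_sum_def using orth by blast
qed

text \<open>A decomposition of an object into the largest possible number of nonzero summands, which
  exists because the endomorphism space is finite-dimensional, has simple summands.\<close>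

lemma regular_semisimple:
  assumes reg: "regular_category C" and split: "idempotents_split C" and a: "a \<in> Obj"
  shows "\<exists>n x. (\<forall>j<n. is_simple C (x j)) \<and> is_direct_sum C n x a"
proof -
  define P where "P = (\<lambda>n. \<exists>x. (\<forall>j<n. x j \<in> Obj \<and> \<not> is_zero_object C (x j)) \<and> is_direct_sum C n x a)"
  obtain B where B: "finite B" "Hom a a \<subseteq> vs.span B" using Hom_finite_dim[OF a a] by blast
  have bound: "\<forall>n. P n \<longrightarrow> n \<le> card B"
    unfolding P_def using direct_sum_length_bound[OF _ a _ B] by blast
  have "\<exists>n. P n"
  \<comment> \<open>A greatest length needs at least one decomposition to exist: the empty one for a
    zero object, otherwise \<open>a\<close> as its own single summand.\<close>
  proof (cases "Idn a = 0")
    case True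
    then have "P 0" by (auto simp: P_def is_direct_sum_def)
    then show ?thesis ..
  next
    case False
    then have "P 1" unfolding P_def is_direct_sum_def
      using a Idn_closed[OF a] Comp_Idn_left[OF a a Idn_closed[OF a]]
      by (intro exI[of _ "\<lambda>_. a"] conjI exI[of _ "\<lambda>_. Idn a"]) (auto simp: zero_object_iff)
    then show ?thesis ..
  qed
  then obtain n where n: "P n" and max: "\<And>k. P k \<Longrightarrow> k \<le> n"
    using bound by (metis GreatestI_ex_nat Greatest_le_nat)
  then obtain x where x: "\<And>j. j < n \<Longrightarrow> x j \<in> Obj \<and> \<not> is_zero_object C (x j)"
    and ds: "is_direct_sum C n x a"
    unfolding P_def by blast
  have "is_simple C (x l)" if l: "l < n" for l
  proof (rule ccontr)
    assume "\<not> is_simple C (x l)"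
    then obtain y v where y: "y \<in> Obj" and m: "is_mono C y (x l) v"
      and nz: "\<not> is_zero_object C y" and ni: "\<not> is_iso C y (x l) v"
      using x[OF l] by (auto simp: is_simple_def)
    have xl: "x l \<in> Obj" using x[OF l] by simp
    \<comment> \<open>A mono that witnesses non-simplicity splits off. Its complement is nonzero, as
      otherwise \<open>v\<close> would be invertible, so there would be a decomposition with one
      more nonzero summand.\<close>
    obtain q where r: "is_retract C (x l) y q v" by (rule regular_mono_splits[OF reg m y xl])
    obtain z q' v' where z: "z \<in> Obj" and r': "is_retract C (x l) z q' v'" "q \<cdot> v' = 0" "q' \<cdot> v = 0"
      "Idn (x l) = v \<cdot> q + v' \<cdot> q'"
      by (rule retract_complement[OF split r xl y])
    have "\<not> is_zero_object C z"
    proof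
      assume "is_zero_object C z"
      then have "q' = 0" using r' xl by (auto simp: is_retract_def is_zero_object_def)
      then have "Idn (x l) = v \<cdot> q"
        using r' comp_zero_right[of v' z "x l" "x l"] xl z by (simp add: is_retract_def)
      then show False using ni r by (auto simp: is_retract_def is_iso_def is_inverse_def)
    qed
    moreover have "is_direct_sum C (Suc n) (x(l := y, n := z)) a"
      using direct_sum_refine[OF ds a _ l y z r r'] x by blast
    ultimately have "P (Suc n)" unfolding P_def using x y z nz
      by (intro exI[of _ "x(l := y, n := z)"]) (auto simp: less_Suc_eq)
    then show False using max by fastforce
  qed
  then show ?thesis using ds by blast
qed

end

lemma semisimple_categoryI:
  fixes C (structure)
  assumes "linear_category C" "regular_category C" "idempotents_split C"
    and "\<And>n x. (\<And>j. j < n \<Longrightarrow> x j \<in> Obj) \<Longrightarrow> \<exists>s\<in>Obj. is_direct_sum C n x s"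
  shows "semisimple_category C"
  using linear_category.regular_abelian[OF assms] linear_category.regular_semisimple[OF assms(1-3)]
  by (intro semisimple_category.intro semisimple_category_axioms.intro) blast+

section \<open>Arrows of a tensor category\<close>

text \<open>A morphism together with its source and target.  On such arrows all typing conditions of the
  laws of a tensor category are equations that the simplifier can decide.\<close>

datatype ('o, 'm) arrow = Arrow (src: 'o) (mor: 'm) (tgt: 'o)

definition arr :: "('o, 'm, 'k, 'z) lincat_scheme \<Rightarrow> ('o, 'm) arrow \<Rightarrow> bool"
  where "arr C f \<longleftrightarrow> src f \<in> Obj\<^bsub>C\<^esub> \<and> tgt f \<in> Obj\<^bsub>C\<^esub> \<and> mor f \<in> Hom\<^bsub>C\<^esub> (src f) (tgt f)"

text \<open>Total by design: the endpoints are read off without checking that they match, so the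
  \<open>src\<close> and \<open>tgt\<close> equations are unconditional rewrite rules. Matching is
  demanded only where \<open>arr\<close> has to be shown.\<close>

definition cmp :: "('o, 'm, 'k, 'z) lincat_scheme \<Rightarrow> ('o, 'm) arrow \<Rightarrow> ('o, 'm) arrow \<Rightarrow> ('o, 'm) arrow"
    (infixr \<open>\<odot>\<index>\<close> 70)
  where "g \<odot>\<^bsub>C\<^esub> f = Arrow (src f) (mor g \<cdot>\<^bsub>C\<^esub> mor f) (tgt g)"

definition ide :: "('o, 'm, 'k, 'z) lincat_scheme \<Rightarrow> 'o \<Rightarrow> ('o, 'm) arrow" (\<open>\<iota>\<index>\<close>)
  where "\<iota>\<^bsub>C\<^esub> a = Arrow a (Idn\<^bsub>C\<^esub> a) a"

definition tns ::
    "('o, 'm, 'k, 'z) tensor_cat_scheme \<Rightarrow> ('o, 'm) arrow \<Rightarrow> ('o, 'm) arrow \<Rightarrow> ('o, 'm) arrow"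
    (infixr \<open>\<otimes>\<index>\<close> 75)
  where "f \<otimes>\<^bsub>C\<^esub> g = Arrow (src f \<otimes>\<^sub>o\<^bsub>C\<^esub> src g) (mor f \<otimes>\<^sub>m\<^bsub>C\<^esub> mor g) (tgt f \<otimes>\<^sub>o\<^bsub>C\<^esub> tgt g)"

definition inv_arrow :: "('o, 'm, 'k, 'z) lincat_scheme \<Rightarrow> ('o, 'm) arrow \<Rightarrow> ('o, 'm) arrow"
  where "inv_arrow C f = Arrow (tgt f) (inv_mor C (src f) (tgt f) (mor f)) (src f)"

definition as :: "('o, 'm, 'k, 'z) tensor_cat_scheme \<Rightarrow> 'o \<Rightarrow> 'o \<Rightarrow> 'o \<Rightarrow> ('o, 'm) arrow" (\<open>\<alpha>\<index>\<close>)
  where "\<alpha>\<^bsub>C\<^esub> a b c = Arrow ((a \<otimes>\<^sub>o\<^bsub>C\<^esub> b) \<otimes>\<^sub>o\<^bsub>C\<^esub> c) (\<a>\<^bsub>C\<^esub> a b c) (a \<otimes>\<^sub>o\<^bsub>C\<^esub> b \<otimes>\<^sub>o\<^bsub>C\<^esub> c)"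

definition asi :: "('o, 'm, 'k, 'z) tensor_cat_scheme \<Rightarrow> 'o \<Rightarrow> 'o \<Rightarrow> 'o \<Rightarrow> ('o, 'm) arrow" (\<open>\<alpha>''\<index>\<close>)
  where "\<alpha>'\<^bsub>C\<^esub> a b c = inv_arrow C (\<alpha>\<^bsub>C\<^esub> a b c)"

definition lu :: "('o, 'm, 'k, 'z) tensor_cat_scheme \<Rightarrow> 'o \<Rightarrow> ('o, 'm) arrow" (\<open>\<ell>\<index>\<close>)
  where "\<ell>\<^bsub>C\<^esub> a = Arrow (\<one>\<^bsub>C\<^esub> \<otimes>\<^sub>o\<^bsub>C\<^esub> a) (\<l>\<^bsub>C\<^esub> a) a"

definition lui :: "('o, 'm, 'k, 'z) tensor_cat_scheme \<Rightarrow> 'o \<Rightarrow> ('o, 'm) arrow" (\<open>\<ell>''\<index>\<close>)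
  where "\<ell>'\<^bsub>C\<^esub> a = inv_arrow C (\<ell>\<^bsub>C\<^esub> a)"

definition ru :: "('o, 'm, 'k, 'z) tensor_cat_scheme \<Rightarrow> 'o \<Rightarrow> ('o, 'm) arrow" (\<open>\<rho>\<index>\<close>)
  where "\<rho>\<^bsub>C\<^esub> a = Arrow (a \<otimes>\<^sub>o\<^bsub>C\<^esub> \<one>\<^bsub>C\<^esub>) (\<r>\<^bsub>C\<^esub> a) a"

definition rui :: "('o, 'm, 'k, 'z) tensor_cat_scheme \<Rightarrow> 'o \<Rightarrow> ('o, 'm) arrow" (\<open>\<rho>''\<index>\<close>)
  where "\<rho>'\<^bsub>C\<^esub> a = inv_arrow C (\<rho>\<^bsub>C\<^esub> a)"

lemma src_tgt [simp]:
  "src (g \<odot>\<^bsub>C\<^esub> f) = src f" "tgt (g \<odot>\<^bsub>C\<^esub> f) = tgt g"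
  "src (\<iota>\<^bsub>C\<^esub> a) = a" "tgt (\<iota>\<^bsub>C\<^esub> a) = a"
  "src (inv_arrow C f) = tgt f" "tgt (inv_arrow C f) = src f"
  by (simp_all add: cmp_def ide_def inv_arrow_def)

lemma src_tgt_tensor [simp]:
  "src (f \<otimes>\<^bsub>C\<^esub> g) = src f \<otimes>\<^sub>o\<^bsub>C\<^esub> src g" "tgt (f \<otimes>\<^bsub>C\<^esub> g) = tgt f \<otimes>\<^sub>o\<^bsub>C\<^esub> tgt g"
  "src (\<alpha>\<^bsub>C\<^esub> a b c) = (a \<otimes>\<^sub>o\<^bsub>C\<^esub> b) \<otimes>\<^sub>o\<^bsub>C\<^esub> c" "tgt (\<alpha>\<^bsub>C\<^esub> a b c) = a \<otimes>\<^sub>o\<^bsub>C\<^esub> b \<otimes>\<^sub>o\<^bsub>C\<^esub> c"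
  "tgt (\<alpha>'\<^bsub>C\<^esub> a b c) = (a \<otimes>\<^sub>o\<^bsub>C\<^esub> b) \<otimes>\<^sub>o\<^bsub>C\<^esub> c" "src (\<alpha>'\<^bsub>C\<^esub> a b c) = a \<otimes>\<^sub>o\<^bsub>C\<^esub> b \<otimes>\<^sub>o\<^bsub>C\<^esub> c"
  "src (\<ell>\<^bsub>C\<^esub> a) = \<one>\<^bsub>C\<^esub> \<otimes>\<^sub>o\<^bsub>C\<^esub> a" "tgt (\<ell>\<^bsub>C\<^esub> a) = a"
  "tgt (\<ell>'\<^bsub>C\<^esub> a) = \<one>\<^bsub>C\<^esub> \<otimes>\<^sub>o\<^bsub>C\<^esub> a" "src (\<ell>'\<^bsub>C\<^esub> a) = a"
  "src (\<rho>\<^bsub>C\<^esub> a) = a \<otimes>\<^sub>o\<^bsub>C\<^esub> \<one>\<^bsub>C\<^esub>" "tgt (\<rho>\<^bsub>C\<^esub> a) = a"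
  "tgt (\<rho>'\<^bsub>C\<^esub> a) = a \<otimes>\<^sub>o\<^bsub>C\<^esub> \<one>\<^bsub>C\<^esub>" "src (\<rho>'\<^bsub>C\<^esub> a) = a"
  by (simp_all add: tns_def as_def asi_def lu_def lui_def ru_def rui_def)

section \<open>Composition and inverses of arrows\<close>

context linear_category
begin

lemma arr_src_tgt [simp]: "arr C f \<Longrightarrow> src f \<in> Obj" "arr C f \<Longrightarrow> tgt f \<in> Obj"
  by (simp_all add: arr_def)

lemma arr_cmp [simp]: "\<lbrakk>arr C g; arr C f; src g = tgt f\<rbrakk> \<Longrightarrow> arr C (g \<odot> f)"
  by (simp del: arr_src_tgt add: arr_def cmp_def comp_hom[of _ "tgt f" "tgt g" _ "src f"])

lemma arr_ide [simp]: "a \<in> Obj \<Longrightarrow> arr C (\<iota> a)"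
  by (simp del: arr_src_tgt add: arr_def ide_def Idn_closed)

lemma cmp_assoc [simp]:
  "\<lbrakk>arr C h; arr C g; arr C f; src h = tgt g; src g = tgt f\<rbrakk> \<Longrightarrow> (h \<odot> g) \<odot> f = h \<odot> g \<odot> f"
  by (simp del: arr_src_tgt add: arr_def cmp_def comp_assoc[of _ "tgt g" "tgt h" _ "tgt f" _ "src f"])

lemma cmp_ide_left [simp]: "\<lbrakk>arr C f; tgt f = a\<rbrakk> \<Longrightarrow> \<iota> a \<odot> f = f"
  by (cases f) (auto simp del: arr_src_tgt simp: arr_def cmp_def ide_def Comp_Idn_left)

lemma cmp_ide_right [simp]: "\<lbrakk>arr C f; src f = a\<rbrakk> \<Longrightarrow> f \<odot> \<iota> a = f"
  by (cases f) (auto simp del: arr_src_tgt simp: arr_def cmp_def ide_def Comp_Idn_right)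

text \<open>Composites are kept associated to the right, where \<open>x \<odot> y\<close> is not a
  subterm of \<open>x \<odot> y \<odot> t\<close>. This turns an equation for
  \<open>x \<odot> y\<close> into a rewrite rule that also applies there.\<close>

lemma whisker:
  "\<lbrakk>x \<odot> y = z; arr C x; arr C y; arr C t; src x = tgt y; src y = tgt t\<rbrakk> \<Longrightarrow> x \<odot> y \<odot> t = z \<odot> t"
  using cmp_assoc[of x y t] by simp

text \<open>Two-sided inverses are unique, so the definite description in \<open>inv_mor\<close>
  really denotes the inverse.\<close>

lemma iso_inverse: "\<lbrakk>is_iso C a b f; a \<in> Obj; b \<in> Obj\<rbrakk> \<Longrightarrow> is_inverse C a b f (inv_mor C a b f)"
  unfolding inv_mor_def
proof (rule theI')
  assume "is_iso C a b f" and ob: "a \<in> Obj" "b \<in> Obj"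
  then obtain g where g: "is_inverse C a b f g" by (auto simp: is_iso_def)
  moreover have "h = g" if "is_inverse C a b f h" for h
  proof -
    have "h = h \<cdot> f \<cdot> g" using that g ob Comp_Idn_right by (simp add: is_inverse_def)
    also have "\<dots> = g" using that g ob comp_assoc[of h b a f a g b] Comp_Idn_left
      by (simp add: is_inverse_def)
    finally show ?thesis .
  qed
  ultimately show "\<exists>!g. is_inverse C a b f g" by blast
qed

lemma inv_arrow:
  assumes "is_iso C (src f) (tgt f) (mor f)" "src f \<in> Obj" "tgt f \<in> Obj"
  shows "arr C f" "arr C (inv_arrow C f)" "f \<odot> inv_arrow C f = \<iota> (tgt f)"
    "inv_arrow C f \<odot> f = \<iota> (src f)"
  using iso_inverse[OF assms] assms
  by (auto simp del: arr_src_tgt simp: is_inverse_def arr_def cmp_def ide_def inv_arrow_def)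

lemma cancel_right:
  assumes "x \<odot> p = y \<odot> p" "p \<odot> p' = \<iota> a" "arr C x" "arr C y" "arr C p" "arr C p'"
    "src x = tgt p" "src y = tgt p" "src p = tgt p'" "tgt p = a"
  shows "x = y"
  using whisker[OF assms(1), of p'] assms by simp

lemma cancel_left:
  assumes "p \<odot> x = p \<odot> y" "p' \<odot> p = \<iota> a" "arr C x" "arr C y" "arr C p" "arr C p'"
    "tgt x = src p" "tgt y = src p" "src p' = tgt p" "src p = a"
  shows "x = y"
  using cmp_assoc[of p' p x] cmp_assoc[of p' p y] assms by simp

end

section \<open>Naturality and coherence in a tensor category\<close>

context tensor_category
begin

lemma Unit_obj [simp]: "\<one> \<in> Obj" by (rule Unit_closed)

lemma Tobj_obj [simp]: "\<lbrakk>a \<in> Obj; b \<in> Obj\<rbrakk> \<Longrightarrow> a \<otimes>\<^sub>o b \<in> Obj" by (rule Tobj_closed)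

lemma arr_tns [simp]: "\<lbrakk>arr C f; arr C g\<rbrakk> \<Longrightarrow> arr C (f \<otimes> g)"
  by (auto simp del: arr_src_tgt simp: arr_def tns_def intro: Tmor_closed)

lemma tns_ide [simp]: "\<lbrakk>a \<in> Obj; b \<in> Obj\<rbrakk> \<Longrightarrow> \<iota> a \<otimes> \<iota> b = \<iota> (a \<otimes>\<^sub>o b)"
  by (simp add: ide_def tns_def Tmor_Idn)

lemma interchange [simp]:
  "\<lbrakk>arr C f'; arr C f; arr C g'; arr C g; src f' = tgt f; src g' = tgt g\<rbrakk>
    \<Longrightarrow> (f' \<otimes> g') \<odot> (f \<otimes> g) = (f' \<odot> f) \<otimes> (g' \<odot> g)"
  by (auto simp del: arr_src_tgt simp: arr_def tns_def cmp_def
      intro!: Tmor_Comp[of "src f" "tgt f" "tgt f'" "src g" "tgt g" "tgt g'", symmetric])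

text \<open>The interchange law in the interior of a composite associated to the right. With it the
  simplifier fuses neighbouring tensor products, which settles all steps that need no structure
  isomorphism.\<close>

lemma interchange' [simp]:
  "\<lbrakk>arr C f'; arr C f; arr C g'; arr C g; arr C t; src f' = tgt f; src g' = tgt g;
    tgt t = src f \<otimes>\<^sub>o src g\<rbrakk>
    \<Longrightarrow> (f' \<otimes> g') \<odot> (f \<otimes> g) \<odot> t = ((f' \<odot> f) \<otimes> (g' \<odot> g)) \<odot> t"
  by (subst cmp_assoc[symmetric]) simp_all

lemma as_inverse:
  assumes "a \<in> Obj" "b \<in> Obj" "c \<in> Obj"
  shows arr_as [simp]: "arr C (\<alpha> a b c)" and arr_asi [simp]: "arr C (\<alpha>' a b c)"
    and as_asi [simp]: "\<alpha> a b c \<odot> \<alpha>' a b c = \<iota> (a \<otimes>\<^sub>o b \<otimes>\<^sub>o c)"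
    and asi_as [simp]: "\<alpha>' a b c \<odot> \<alpha> a b c = \<iota> ((a \<otimes>\<^sub>o b) \<otimes>\<^sub>o c)"
  using inv_arrow[of "\<alpha> a b c"] Assoc_iso[OF assms] assms by (simp_all add: as_def asi_def)

lemma lu_inverse:
  assumes "a \<in> Obj"
  shows arr_lu [simp]: "arr C (\<ell> a)" and arr_lui [simp]: "arr C (\<ell>' a)"
    and lu_lui [simp]: "\<ell> a \<odot> \<ell>' a = \<iota> a" and lui_lu [simp]: "\<ell>' a \<odot> \<ell> a = \<iota> (\<one> \<otimes>\<^sub>o a)"
  using inv_arrow[of "\<ell> a"] Lunit_iso[OF assms] assms by (simp_all add: lu_def lui_def)

lemma ru_inverse:
  assumes "a \<in> Obj"
  shows arr_ru [simp]: "arr C (\<rho> a)" and arr_rui [simp]: "arr C (\<rho>' a)"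
    and ru_rui [simp]: "\<rho> a \<odot> \<rho>' a = \<iota> a" and rui_ru [simp]: "\<rho>' a \<odot> \<rho> a = \<iota> (a \<otimes>\<^sub>o \<one>)"
  using inv_arrow[of "\<rho> a"] Runit_iso[OF assms] assms by (simp_all add: ru_def rui_def)

lemma cancel_inverse [simp]:
  "\<lbrakk>a \<in> Obj; b \<in> Obj; c \<in> Obj; arr C t; tgt t = a \<otimes>\<^sub>o b \<otimes>\<^sub>o c\<rbrakk> \<Longrightarrow> \<alpha> a b c \<odot> \<alpha>' a b c \<odot> t = t"
  "\<lbrakk>a \<in> Obj; b \<in> Obj; c \<in> Obj; arr C t; tgt t = (a \<otimes>\<^sub>o b) \<otimes>\<^sub>o c\<rbrakk> \<Longrightarrow> \<alpha>' a b c \<odot> \<alpha> a b c \<odot> t = t"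
  "\<lbrakk>a \<in> Obj; arr C t; tgt t = a\<rbrakk> \<Longrightarrow> \<ell> a \<odot> \<ell>' a \<odot> t = t"
  "\<lbrakk>a \<in> Obj; arr C t; tgt t = \<one> \<otimes>\<^sub>o a\<rbrakk> \<Longrightarrow> \<ell>' a \<odot> \<ell> a \<odot> t = t"
  "\<lbrakk>a \<in> Obj; arr C t; tgt t = a\<rbrakk> \<Longrightarrow> \<rho> a \<odot> \<rho>' a \<odot> t = t"
  "\<lbrakk>a \<in> Obj; arr C t; tgt t = a \<otimes>\<^sub>o \<one>\<rbrakk> \<Longrightarrow> \<rho>' a \<odot> \<rho> a \<odot> t = t"
  by (simp_all add: whisker[OF as_asi] whisker[OF asi_as] whisker[OF lu_lui] whisker[OF lui_lu]
      whisker[OF ru_rui] whisker[OF rui_ru])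

lemma as_nat:
  "\<lbrakk>arr C f; arr C g; arr C h\<rbrakk>
    \<Longrightarrow> \<alpha> (tgt f) (tgt g) (tgt h) \<odot> ((f \<otimes> g) \<otimes> h) = (f \<otimes> g \<otimes> h) \<odot> \<alpha> (src f) (src g) (src h)"
  by (auto simp del: arr_src_tgt simp: arr_def tns_def cmp_def as_def intro!: Assoc_natural)

lemma asi_nat:
  assumes "arr C f" "arr C g" "arr C h"
  shows "\<alpha>' (tgt f) (tgt g) (tgt h) \<odot> (f \<otimes> g \<otimes> h) = ((f \<otimes> g) \<otimes> h) \<odot> \<alpha>' (src f) (src g) (src h)"
proof (rule cancel_left[where p = "\<alpha> (tgt f) (tgt g) (tgt h)" and p' = "\<alpha>' (tgt f) (tgt g) (tgt h)"])
  show "\<alpha> (tgt f) (tgt g) (tgt h) \<odot> \<alpha>' (tgt f) (tgt g) (tgt h) \<odot> (f \<otimes> g \<otimes> h)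
    = \<alpha> (tgt f) (tgt g) (tgt h) \<odot> ((f \<otimes> g) \<otimes> h) \<odot> \<alpha>' (src f) (src g) (src h)"
    using assms by (simp add: whisker[OF as_nat])
qed (use assms in auto)

lemma as_nat_whisker:
  "\<lbrakk>arr C f; arr C g; arr C h; arr C t; tgt t = (src f \<otimes>\<^sub>o src g) \<otimes>\<^sub>o src h;
    tgt f = a; tgt g = b; tgt h = c\<rbrakk>
    \<Longrightarrow> \<alpha> a b c \<odot> ((f \<otimes> g) \<otimes> h) \<odot> t = (f \<otimes> g \<otimes> h) \<odot> \<alpha> (src f) (src g) (src h) \<odot> t"
  using whisker[OF as_nat, of f g h t] by auto

lemma asi_nat_whisker:
  "\<lbrakk>arr C f; arr C g; arr C h; arr C t; tgt t = src f \<otimes>\<^sub>o src g \<otimes>\<^sub>o src h;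
    tgt f = a; tgt g = b; tgt h = c\<rbrakk>
    \<Longrightarrow> \<alpha>' a b c \<odot> (f \<otimes> g \<otimes> h) \<odot> t = ((f \<otimes> g) \<otimes> h) \<odot> \<alpha>' (src f) (src g) (src h) \<odot> t"
  using whisker[OF asi_nat, of f g h t] by auto

text \<open>Deleted from the simpset where a structure isomorphism is moved past a tensor product.\<close>

lemmas no_fuse = interchange interchange' tns_ide

lemma lu_nat: "arr C f \<Longrightarrow> \<ell> (tgt f) \<odot> (\<iota> \<one> \<otimes> f) = f \<odot> \<ell> (src f)"
  by (auto simp del: arr_src_tgt simp: arr_def tns_def cmp_def lu_def ide_def intro!: Lunit_natural)

lemma ru_nat: "arr C f \<Longrightarrow> \<rho> (tgt f) \<odot> (f \<otimes> \<iota> \<one>) = f \<odot> \<rho> (src f)"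
  by (auto simp del: arr_src_tgt simp: arr_def tns_def cmp_def ru_def ide_def intro!: Runit_natural)

lemma lui_nat: "arr C f \<Longrightarrow> \<ell>' (tgt f) \<odot> f = (\<iota> \<one> \<otimes> f) \<odot> \<ell>' (src f)"
  by (rule cancel_left[where p = "\<ell> (tgt f)" and p' = "\<ell>' (tgt f)"]) (simp_all add: whisker[OF lu_nat])

lemma rui_nat: "arr C f \<Longrightarrow> \<rho>' (tgt f) \<odot> f = (f \<otimes> \<iota> \<one>) \<odot> \<rho>' (src f)"
  by (rule cancel_left[where p = "\<rho> (tgt f)" and p' = "\<rho>' (tgt f)"]) (simp_all add: whisker[OF ru_nat])

lemma as_pentagon: "\<lbrakk>a \<in> Obj; b \<in> Obj; c \<in> Obj; d \<in> Obj\<rbrakk>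
  \<Longrightarrow> (\<iota> a \<otimes> \<alpha> b c d) \<odot> \<alpha> a (b \<otimes>\<^sub>o c) d \<odot> (\<alpha> a b c \<otimes> \<iota> d) = \<alpha> a b (c \<otimes>\<^sub>o d) \<odot> \<alpha> (a \<otimes>\<^sub>o b) c d"
  using pentagon[of a b c d] by (simp add: tns_def cmp_def ide_def as_def)

lemma as_triangle: "\<lbrakk>a \<in> Obj; b \<in> Obj\<rbrakk> \<Longrightarrow> (\<iota> a \<otimes> \<ell> b) \<odot> \<alpha> a \<one> b = \<rho> a \<otimes> \<iota> b"
  using triangle[of a b] by (simp add: tns_def cmp_def ide_def as_def lu_def ru_def)

lemma whisker3:
  "\<lbrakk>x \<odot> y \<odot> w = z; arr C x; arr C y; arr C w; arr C t; src x = tgt y; src y = tgt w; src w = tgt t\<rbrakk>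
    \<Longrightarrow> x \<odot> y \<odot> w \<odot> t = z \<odot> t"
  using cmp_assoc[of x "y \<odot> w" t] by simp

text \<open>The pentagon with one outer associator on each side inverted, the form that arises when
  an object on the left is carried past a zig-zag.\<close>

lemma pentagon_mixed:
  assumes "a \<in> Obj" "b \<in> Obj" "c \<in> Obj" "d \<in> Obj"
  shows "\<alpha> a (b \<otimes>\<^sub>o c) d \<odot> (\<alpha> a b c \<otimes> \<iota> d) \<odot> \<alpha>' (a \<otimes>\<^sub>o b) c d = (\<iota> a \<otimes> \<alpha>' b c d) \<odot> \<alpha> a b (c \<otimes>\<^sub>o d)"
proof (rule cancel_left[where p = "\<iota> a \<otimes> \<alpha> b c d" and p' = "\<iota> a \<otimes> \<alpha>' b c d"])
  show "(\<iota> a \<otimes> \<alpha> b c d) \<odot> \<alpha> a (b \<otimes>\<^sub>o c) d \<odot> (\<alpha> a b c \<otimes> \<iota> d) \<odot> \<alpha>' (a \<otimes>\<^sub>o b) c d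
    = (\<iota> a \<otimes> \<alpha> b c d) \<odot> (\<iota> a \<otimes> \<alpha>' b c d) \<odot> \<alpha> a b (c \<otimes>\<^sub>o d)"
    using assms by (simp add: whisker3[OF as_pentagon])
qed (use assms in auto)

lemma pentagon_inverse:
  assumes "a \<in> Obj" "b \<in> Obj" "c \<in> Obj" "d \<in> Obj"
  shows "\<alpha>' a (b \<otimes>\<^sub>o c) d \<odot> (\<iota> a \<otimes> \<alpha>' b c d) \<odot> \<alpha> a b (c \<otimes>\<^sub>o d) = (\<alpha> a b c \<otimes> \<iota> d) \<odot> \<alpha>' (a \<otimes>\<^sub>o b) c d"
  using assms by (simp flip: pentagon_mixed)

text \<open>By naturality of the left unitor, tensoring with the unit object is conjugation by an
  isomorphism.\<close>

lemma unit_tns_faithful: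
  assumes "\<iota> \<one> \<otimes> f = \<iota> \<one> \<otimes> g" "arr C f" "arr C g" "src f = src g" "tgt f = tgt g"
  shows "f = g"
  by (rule cancel_right[where p = "\<ell> (src f)" and p' = "\<ell>' (src f)"])
    (use assms lu_nat[of f] lu_nat[of g] in auto)

lemma tns_unit_faithful:
  assumes "f \<otimes> \<iota> \<one> = g \<otimes> \<iota> \<one>" "arr C f" "arr C g" "src f = src g" "tgt f = tgt g"
  shows "f = g"
  by (rule cancel_right[where p = "\<rho> (src f)" and p' = "\<rho>' (src f)"])
    (use assms ru_nat[of f] ru_nat[of g] in auto)

text \<open>Kelly's argument: the triangle axiom only concerns a unit in the middle. After tensoring
  with one more unit on the left, the pentagon brings the unit into the middle, and tensoring with
  the unit is faithful.\<close>

lemma lu_tensor: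
  assumes "a \<in> Obj" "b \<in> Obj"
  shows "\<ell> (a \<otimes>\<^sub>o b) \<odot> \<alpha> \<one> a b = \<ell> a \<otimes> \<iota> b"
proof (rule unit_tns_faithful)
  \<comment> \<open>The two associators of the pentagon that lead into the object
    \<open>\<one> \<otimes> ((\<one> \<otimes> a) \<otimes> b)\<close>. Both sides are compared
    after this isomorphism.\<close>
  define P where "P = \<alpha> \<one> (\<one> \<otimes>\<^sub>o a) b \<odot> (\<alpha> \<one> \<one> a \<otimes> \<iota> b)"
  define P' where "P' = (\<alpha>' \<one> \<one> a \<otimes> \<iota> b) \<odot> \<alpha>' \<one> (\<one> \<otimes>\<^sub>o a) b"
  have P: "arr C P" "arr C P'" "src P = ((\<one> \<otimes>\<^sub>o \<one>) \<otimes>\<^sub>o a) \<otimes>\<^sub>o b" "tgt P = \<one> \<otimes>\<^sub>o (\<one> \<otimes>\<^sub>o a) \<otimes>\<^sub>o b"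
    "tgt P' = ((\<one> \<otimes>\<^sub>o \<one>) \<otimes>\<^sub>o a) \<otimes>\<^sub>o b" "P \<odot> P' = \<iota> (\<one> \<otimes>\<^sub>o (\<one> \<otimes>\<^sub>o a) \<otimes>\<^sub>o b)"
    using assms by (simp_all add: P_def P'_def)
  have "(\<iota> \<one> \<otimes> (\<ell> (a \<otimes>\<^sub>o b) \<odot> \<alpha> \<one> a b)) \<odot> P
    = (\<iota> \<one> \<otimes> \<ell> (a \<otimes>\<^sub>o b)) \<odot> (\<iota> \<one> \<otimes> \<alpha> \<one> a b) \<odot> P"
    using assms P by simp
  also have "\<dots> = (\<iota> \<one> \<otimes> \<ell> (a \<otimes>\<^sub>o b)) \<odot> \<alpha> \<one> \<one> (a \<otimes>\<^sub>o b) \<odot> \<alpha> (\<one> \<otimes>\<^sub>o \<one>) a b"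
    using assms unfolding P_def by (simp only: as_pentagon Unit_obj)
  also have "\<dots> = (\<rho> \<one> \<otimes> \<iota> a \<otimes> \<iota> b) \<odot> \<alpha> (\<one> \<otimes>\<^sub>o \<one>) a b"
    using assms by (simp add: whisker[OF as_triangle])
  also have "\<dots> = \<alpha> \<one> a b \<odot> ((\<rho> \<one> \<otimes> \<iota> a) \<otimes> \<iota> b)"
    using as_nat[of "\<rho> \<one>" "\<iota> a" "\<iota> b"] assms by simp
  also have "\<dots> = \<alpha> \<one> a b \<odot> ((\<iota> \<one> \<otimes> \<ell> a) \<otimes> \<iota> b) \<odot> (\<alpha> \<one> \<one> a \<otimes> \<iota> b)"
    using assms by (simp add: as_triangle)
  also have "\<dots> = (\<iota> \<one> \<otimes> \<ell> a \<otimes> \<iota> b) \<odot> P"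
    unfolding P_def using assms by (simp del: no_fuse add: as_nat_whisker)
  finally show "\<iota> \<one> \<otimes> (\<ell> (a \<otimes>\<^sub>o b) \<odot> \<alpha> \<one> a b) = \<iota> \<one> \<otimes> \<ell> a \<otimes> \<iota> b"
    by (rule cancel_right[where p = P and p' = P']) (use P assms in simp_all)
qed (use assms in auto)

text \<open>The mirror image of the argument for the left unitor, with the additional unit on the
  right.\<close>

lemma ru_tensor:
  assumes "a \<in> Obj" "b \<in> Obj"
  shows "(\<iota> a \<otimes> \<rho> b) \<odot> \<alpha> a b \<one> = \<rho> (a \<otimes>\<^sub>o b)"
proof (rule tns_unit_faithful)
  have "\<alpha> a b \<one> \<odot> (((\<iota> a \<otimes> \<rho> b) \<odot> \<alpha> a b \<one>) \<otimes> \<iota> \<one>)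
    = \<alpha> a b \<one> \<odot> ((\<iota> a \<otimes> \<rho> b) \<otimes> \<iota> \<one>) \<odot> (\<alpha> a b \<one> \<otimes> \<iota> \<one>)"
    using assms by simp
  also have "\<dots> = (\<iota> a \<otimes> \<rho> b \<otimes> \<iota> \<one>) \<odot> \<alpha> a (b \<otimes>\<^sub>o \<one>) \<one> \<odot> (\<alpha> a b \<one> \<otimes> \<iota> \<one>)"
    using assms by (simp del: no_fuse add: as_nat_whisker)
  also have "\<dots> = (\<iota> a \<otimes> \<iota> b \<otimes> \<ell> \<one>) \<odot> (\<iota> a \<otimes> \<alpha> b \<one> \<one>) \<odot> \<alpha> a (b \<otimes>\<^sub>o \<one>) \<one> \<odot> (\<alpha> a b \<one> \<otimes> \<iota> \<one>)"
    using assms by (simp add: as_triangle)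
  also have "\<dots> = (\<iota> a \<otimes> \<iota> b \<otimes> \<ell> \<one>) \<odot> \<alpha> a b (\<one> \<otimes>\<^sub>o \<one>) \<odot> \<alpha> (a \<otimes>\<^sub>o b) \<one> \<one>"
    using assms by (simp only: as_pentagon Unit_obj)
  also have "\<dots> = \<alpha> a b \<one> \<odot> (\<iota> (a \<otimes>\<^sub>o b) \<otimes> \<ell> \<one>) \<odot> \<alpha> (a \<otimes>\<^sub>o b) \<one> \<one>"
    using assms by (simp del: interchange interchange' tns_ide add: as_nat_whisker tns_ide[symmetric])
  also have "\<dots> = \<alpha> a b \<one> \<odot> (\<rho> (a \<otimes>\<^sub>o b) \<otimes> \<iota> \<one>)"
    using assms by (simp add: as_triangle)
  finally show "((\<iota> a \<otimes> \<rho> b) \<odot> \<alpha> a b \<one>) \<otimes> \<iota> \<one> = \<rho> (a \<otimes>\<^sub>o b) \<otimes> \<iota> \<one>"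
    by (rule cancel_left[where p = "\<alpha> a b \<one>" and p' = "\<alpha>' a b \<one>"]) (use assms in simp_all)
qed (use assms in auto)

end

section \<open>Transposition and free modules\<close>

context tensor_category
begin

text \<open>This is the zig-zag equation \<open>zig\<close> tensored with \<open>y\<close> on the
  left. The triangle, naturality and the mixed pentagon rebracket everything so that
  \<open>y\<close> becomes an inert left factor.\<close>

lemma zigzag_tensor:
  assumes ob: "y \<in> Obj" "d \<in> Obj" "d' \<in> Obj"
    and ev: "arr C ev" "src ev = d \<otimes>\<^sub>o d'" "tgt ev = \<one>"
    and coev: "arr C coev" "src coev = \<one>" "tgt coev = d' \<otimes>\<^sub>o d"
    and zig: "\<ell> d \<odot> (ev \<otimes> \<iota> d) \<odot> \<alpha>' d d' d \<odot> (\<iota> d \<otimes> coev) = \<rho> d"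
  shows "(\<rho> y \<otimes> \<iota> d) \<odot> ((\<iota> y \<otimes> ev) \<otimes> \<iota> d) \<odot> (\<alpha> y d d' \<otimes> \<iota> d) \<odot> \<alpha>' (y \<otimes>\<^sub>o d) d' d
    \<odot> (\<iota> (y \<otimes>\<^sub>o d) \<otimes> coev) = \<rho> (y \<otimes>\<^sub>o d)" (is "?L = _")
proof -
  have "?L = (\<iota> y \<otimes> \<ell> d) \<odot> \<alpha> y \<one> d \<odot> ((\<iota> y \<otimes> ev) \<otimes> \<iota> d) \<odot> (\<alpha> y d d' \<otimes> \<iota> d)
      \<odot> \<alpha>' (y \<otimes>\<^sub>o d) d' d \<odot> (\<iota> (y \<otimes>\<^sub>o d) \<otimes> coev)"
    using ob ev coev by (simp del: no_fuse add: whisker[OF as_triangle])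
  also have "\<dots> = (\<iota> y \<otimes> \<ell> d) \<odot> (\<iota> y \<otimes> ev \<otimes> \<iota> d) \<odot> \<alpha> y (d \<otimes>\<^sub>o d') d \<odot> (\<alpha> y d d' \<otimes> \<iota> d)
      \<odot> \<alpha>' (y \<otimes>\<^sub>o d) d' d \<odot> (\<iota> (y \<otimes>\<^sub>o d) \<otimes> coev)"
    using ob ev coev by (simp del: no_fuse add: as_nat_whisker)
  also have "\<dots> = (\<iota> y \<otimes> \<ell> d) \<odot> (\<iota> y \<otimes> ev \<otimes> \<iota> d) \<odot> (\<iota> y \<otimes> \<alpha>' d d' d) \<odot> \<alpha> y d (d' \<otimes>\<^sub>o d)
      \<odot> ((\<iota> y \<otimes> \<iota> d) \<otimes> coev)"
    using ob ev coev by (simp del: interchange interchange' add: whisker3[OF pentagon_mixed])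
  also have "\<dots> = (\<iota> y \<otimes> \<ell> d) \<odot> (\<iota> y \<otimes> ev \<otimes> \<iota> d) \<odot> (\<iota> y \<otimes> \<alpha>' d d' d) \<odot> (\<iota> y \<otimes> \<iota> d \<otimes> coev)
      \<odot> \<alpha> y d \<one>"
    using ob ev coev as_nat[of "\<iota> y" "\<iota> d" coev] by (simp del: no_fuse)
  also have "\<dots> = (\<iota> y \<otimes> \<rho> d) \<odot> \<alpha> y d \<one>"
    using ob ev coev by (simp del: tns_ide add: zig)
  finally show ?thesis using ob by (simp add: ru_tensor)
qed

text \<open>The inner expression transposes \<open>u\<close> to an arrow
  \<open>e \<otimes> d' \<rightarrow> y\<close> by means of \<open>ev\<close>; the outer one
  transposes back with \<open>coev\<close>. In the source category this gives injectivity of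
  transposition, in the target of the functor it checks a constructed preimage. The proof slides
  \<open>u\<close> to the right until the zig-zag stands alone.\<close>

lemma transpose_transpose:
  assumes ob: "y \<in> Obj" "d \<in> Obj" "d' \<in> Obj"
    and ev: "arr C ev" "src ev = d \<otimes>\<^sub>o d'" "tgt ev = \<one>"
    and coev: "arr C coev" "src coev = \<one>" "tgt coev = d' \<otimes>\<^sub>o d"
    and zig: "\<ell> d \<odot> (ev \<otimes> \<iota> d) \<odot> \<alpha>' d d' d \<odot> (\<iota> d \<otimes> coev) = \<rho> d"
    and u: "arr C u" "src u = e" "tgt u = y \<otimes>\<^sub>o d"
  shows "((\<rho> y \<odot> (\<iota> y \<otimes> ev) \<odot> \<alpha> y d d' \<odot> (u \<otimes> \<iota> d')) \<otimes> \<iota> d)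
    \<odot> \<alpha>' e d' d \<odot> (\<iota> e \<otimes> coev) \<odot> \<rho>' e = u" (is "?L = _")
proof -
  have e: "e \<in> Obj" using u by auto
  have "?L = (\<rho> y \<otimes> \<iota> d) \<odot> ((\<iota> y \<otimes> ev) \<otimes> \<iota> d) \<odot> (\<alpha> y d d' \<otimes> \<iota> d) \<odot> ((u \<otimes> \<iota> d') \<otimes> \<iota> d)
    \<odot> \<alpha>' e d' d \<odot> (\<iota> e \<otimes> coev) \<odot> \<rho>' e"
    using ob ev coev u e by simp
  also have "\<dots> = (\<rho> y \<otimes> \<iota> d) \<odot> ((\<iota> y \<otimes> ev) \<otimes> \<iota> d) \<odot> (\<alpha> y d d' \<otimes> \<iota> d) \<odot> \<alpha>' (y \<otimes>\<^sub>o d) d' d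
    \<odot> (u \<otimes> \<iota> d' \<otimes> \<iota> d) \<odot> (\<iota> e \<otimes> coev) \<odot> \<rho>' e"
    using ob ev coev u e by (simp del: no_fuse add: asi_nat_whisker)
  also have "(u \<otimes> \<iota> d' \<otimes> \<iota> d) \<odot> (\<iota> e \<otimes> coev) \<odot> \<rho>' e = (\<iota> (y \<otimes>\<^sub>o d) \<otimes> coev) \<odot> (u \<otimes> \<iota> \<one>) \<odot> \<rho>' e"
    using ob ev coev u e by simp
  also have "(u \<otimes> \<iota> \<one>) \<odot> \<rho>' e = \<rho>' (y \<otimes>\<^sub>o d) \<odot> u" using rui_nat[of u] u by simp
  also have "(\<rho> y \<otimes> \<iota> d) \<odot> ((\<iota> y \<otimes> ev) \<otimes> \<iota> d) \<odot> (\<alpha> y d d' \<otimes> \<iota> d) \<odot> \<alpha>' (y \<otimes>\<^sub>o d) d' d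
      \<odot> (\<iota> (y \<otimes>\<^sub>o d) \<otimes> coev) \<odot> \<rho>' (y \<otimes>\<^sub>o d) \<odot> u
    = ((\<rho> y \<otimes> \<iota> d) \<odot> ((\<iota> y \<otimes> ev) \<otimes> \<iota> d) \<odot> (\<alpha> y d d' \<otimes> \<iota> d) \<odot> \<alpha>' (y \<otimes>\<^sub>o d) d' d
      \<odot> (\<iota> (y \<otimes>\<^sub>o d) \<otimes> coev)) \<odot> \<rho>' (y \<otimes>\<^sub>o d) \<odot> u"
    using ob ev coev u e by (simp del: no_fuse)
  also have "\<dots> = \<rho> (y \<otimes>\<^sub>o d) \<odot> \<rho>' (y \<otimes>\<^sub>o d) \<odot> u"
    by (simp only: zigzag_tensor[OF ob ev coev zig])
  also have "\<dots> = u" using u ob by simp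
  finally show ?thesis .
qed

end

section \<open>Algebras and free modules on arrows\<close>

locale arrow_algebra = tensor_category C
  for C :: "('o, 'm::ab_group_add, 'k::field, 'z) tensor_cat_scheme" (structure)
    and A :: 'o and \<mu> \<upsilon> :: "('o, 'm) arrow" +
  assumes A_obj [simp]: "A \<in> Obj"
    and mult_arr [simp]: "arr C \<mu>" "src \<mu> = A \<otimes>\<^sub>o A" "tgt \<mu> = A"
    and unit_arr [simp]: "arr C \<upsilon>" "src \<upsilon> = \<one>" "tgt \<upsilon> = A"
    and mult_assoc: "\<mu> \<odot> (\<mu> \<otimes> \<iota> A) = \<mu> \<odot> (\<iota> A \<otimes> \<mu>) \<odot> \<alpha> A A A"
    and mult_unit_left: "\<mu> \<odot> (\<upsilon> \<otimes> \<iota> A) = \<ell> A"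
    and mult_unit_right: "\<mu> \<odot> (\<iota> A \<otimes> \<upsilon>) = \<rho> A"
begin

text \<open>The action of the free module \<open>A \<otimes> c\<close>.\<close>

definition act :: "'o \<Rightarrow> ('o, 'm) arrow"
  where "act c = (\<mu> \<otimes> \<iota> c) \<odot> \<alpha>' A A c"

text \<open>The unit of the free-forgetful adjunction: a linear map out of
  \<open>A \<otimes> x\<close> is determined by its composite with \<open>unt x\<close>. For a
  module on \<open>x\<close> it is also a section of the action, linear only in exceptional
  cases.\<close>

definition unt :: "'o \<Rightarrow> ('o, 'm) arrow"
  where "unt x = (\<upsilon> \<otimes> \<iota> x) \<odot> \<ell>' x"

lemma act_arr [simp]: "c \<in> Obj \<Longrightarrow> arr C (act c)" "src (act c) = A \<otimes>\<^sub>o A \<otimes>\<^sub>o c" "tgt (act c) = A \<otimes>\<^sub>o c"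
  by (simp_all add: act_def)

lemma unt_arr [simp]: "x \<in> Obj \<Longrightarrow> arr C (unt x)" "src (unt x) = x" "tgt (unt x) = A \<otimes>\<^sub>o x"
  by (simp_all add: unt_def)

text \<open>Associativity of the multiplication, tensored with \<open>c\<close>; the pentagon
  accounts for the brackets.\<close>

lemma act_assoc:
  assumes c: "c \<in> Obj"
  shows "act c \<odot> (\<mu> \<otimes> \<iota> (A \<otimes>\<^sub>o c)) = act c \<odot> (\<iota> A \<otimes> act c) \<odot> \<alpha> A A (A \<otimes>\<^sub>o c)"
proof -
  have "act c \<odot> (\<mu> \<otimes> \<iota> (A \<otimes>\<^sub>o c)) = (\<mu> \<otimes> \<iota> c) \<odot> \<alpha>' A A c \<odot> (\<mu> \<otimes> \<iota> A \<otimes> \<iota> c)"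
    using c by (simp add: act_def)
  also have "\<dots> = (\<mu> \<otimes> \<iota> c) \<odot> ((\<mu> \<otimes> \<iota> A) \<otimes> \<iota> c) \<odot> \<alpha>' (A \<otimes>\<^sub>o A) A c"
    using c asi_nat[of \<mu> "\<iota> A" "\<iota> c"] by simp
  also have "\<dots> = (\<mu> \<otimes> \<iota> c) \<odot> ((\<iota> A \<otimes> \<mu>) \<otimes> \<iota> c) \<odot> (\<alpha> A A A \<otimes> \<iota> c) \<odot> \<alpha>' (A \<otimes>\<^sub>o A) A c"
    using c by (simp add: mult_assoc)
  also have "\<dots> = (\<mu> \<otimes> \<iota> c) \<odot> ((\<iota> A \<otimes> \<mu>) \<otimes> \<iota> c) \<odot> \<alpha>' A (A \<otimes>\<^sub>o A) c \<odot> (\<iota> A \<otimes> \<alpha>' A A c)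
      \<odot> \<alpha> A A (A \<otimes>\<^sub>o c)"
    using c by (simp only: pentagon_inverse A_obj)
  also have "\<dots> = (\<mu> \<otimes> \<iota> c) \<odot> \<alpha>' A A c \<odot> (\<iota> A \<otimes> \<mu> \<otimes> \<iota> c) \<odot> (\<iota> A \<otimes> \<alpha>' A A c) \<odot> \<alpha> A A (A \<otimes>\<^sub>o c)"
    using c by (simp del: no_fuse add: asi_nat_whisker)
  also have "\<dots> = act c \<odot> (\<iota> A \<otimes> act c) \<odot> \<alpha> A A (A \<otimes>\<^sub>o c)"
    using c by (simp add: act_def)
  finally show ?thesis .
qed

text \<open>The left unit law of the algebra tensored with \<open>c\<close>;
  \<open>lu_tensor\<close> identifies the remaining unitors.\<close>

lemma act_unit:
  assumes c: "c \<in> Obj"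
  shows "act c \<odot> (\<upsilon> \<otimes> \<iota> (A \<otimes>\<^sub>o c)) = \<ell> (A \<otimes>\<^sub>o c)"
proof -
  have "act c \<odot> (\<upsilon> \<otimes> \<iota> (A \<otimes>\<^sub>o c)) = (\<mu> \<otimes> \<iota> c) \<odot> \<alpha>' A A c \<odot> (\<upsilon> \<otimes> \<iota> A \<otimes> \<iota> c)"
    using c by (simp add: act_def)
  also have "\<dots> = (\<mu> \<otimes> \<iota> c) \<odot> ((\<upsilon> \<otimes> \<iota> A) \<otimes> \<iota> c) \<odot> \<alpha>' \<one> A c"
    using c asi_nat[of \<upsilon> "\<iota> A" "\<iota> c"] by simp
  also have "\<dots> = (\<ell> A \<otimes> \<iota> c) \<odot> \<alpha>' \<one> A c" using c by (simp add: mult_unit_left)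
  also have "\<dots> = \<ell> (A \<otimes>\<^sub>o c)" using c by (simp flip: lu_tensor)
  finally show ?thesis .
qed

text \<open>A triangle identity of the free-forgetful adjunction, resting on the right unit law of
  the algebra. It recovers a linear map on a free module from its restriction to generators.\<close>

lemma act_free_unit:
  assumes c: "c \<in> Obj"
  shows "act c \<odot> (\<iota> A \<otimes> unt c) = \<iota> (A \<otimes>\<^sub>o c)"
proof -
  have "act c \<odot> (\<iota> A \<otimes> unt c) = (\<mu> \<otimes> \<iota> c) \<odot> \<alpha>' A A c \<odot> (\<iota> A \<otimes> \<upsilon> \<otimes> \<iota> c) \<odot> (\<iota> A \<otimes> \<ell>' c)"
    using c by (simp add: act_def unt_def)
  also have "\<dots> = (\<mu> \<otimes> \<iota> c) \<odot> ((\<iota> A \<otimes> \<upsilon>) \<otimes> \<iota> c) \<odot> \<alpha>' A \<one> c \<odot> (\<iota> A \<otimes> \<ell>' c)"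
    using c by (simp del: no_fuse add: asi_nat_whisker)
  also have "\<dots> = (\<rho> A \<otimes> \<iota> c) \<odot> \<alpha>' A \<one> c \<odot> (\<iota> A \<otimes> \<ell>' c)"
    using c by (simp add: mult_unit_right)
  also have "\<dots> = (\<iota> A \<otimes> \<ell> c) \<odot> \<alpha> A \<one> c \<odot> \<alpha>' A \<one> c \<odot> (\<iota> A \<otimes> \<ell>' c)"
    using c by (simp add: whisker[OF as_triangle] del: cancel_inverse)
  also have "\<dots> = \<iota> (A \<otimes>\<^sub>o c)" using c by simp
  finally show ?thesis .
qed

lemma unt_nat: "arr C f \<Longrightarrow> unt (tgt f) \<odot> f = (\<iota> A \<otimes> f) \<odot> unt (src f)"
  by (simp add: unt_def lui_nat)

end

text \<open>Subtraction is the only additive operation needed on arrows: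
  \<open>g \<ominus> g\<close> serves as the zero arrow with the endpoints of \<open>g\<close>, so a
  separate zero arrow can be avoided.\<close>

definition subt :: "('o, 'm::ab_group_add) arrow \<Rightarrow> ('o, 'm) arrow \<Rightarrow> ('o, 'm) arrow" (infixl \<open>\<ominus>\<close> 65)
  where "f \<ominus> g = Arrow (src f) (mor f - mor g) (tgt f)"

lemma src_tgt_subt [simp]: "src (f \<ominus> g) = src f" "tgt (f \<ominus> g) = tgt f"
  by (simp_all add: subt_def)

lemma subt_cancel: "\<lbrakk>f \<ominus> g = h \<ominus> h; src f = src g; tgt f = tgt g\<rbrakk> \<Longrightarrow> f = g"
  by (cases f; cases g) (simp add: subt_def)

lemma subt_zero [simp]: "f \<ominus> (g \<ominus> g) = f"
  by (cases f) (simp add: subt_def)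

context linear_category
begin

lemma arr_subt [simp]: "\<lbrakk>arr C f; arr C g; src f = src g; tgt f = tgt g\<rbrakk> \<Longrightarrow> arr C (f \<ominus> g)"
  by (auto simp del: arr_src_tgt simp: arr_def subt_def diff_hom)

lemma cmp_subt_left: "\<lbrakk>arr C f; arr C f'; arr C g; src f = src f'; tgt f = tgt f'; src f = tgt g\<rbrakk>
    \<Longrightarrow> (f \<ominus> f') \<odot> g = f \<odot> g \<ominus> f' \<odot> g"
  by (auto simp del: arr_src_tgt simp: arr_def subt_def cmp_def
      comp_diff_left[of _ "tgt g" "tgt f'" _ _ "src g"])

lemma cmp_subt_right: "\<lbrakk>arr C f; arr C f'; arr C g; src f = src f'; tgt f = tgt f'; src g = tgt f\<rbrakk>
    \<Longrightarrow> g \<odot> (f \<ominus> f') = g \<odot> f \<ominus> g \<odot> f'"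
  by (auto simp del: arr_src_tgt simp: arr_def subt_def cmp_def
      comp_diff_right[of _ "tgt f'" "tgt g" _ "src f'"])

end

lemma (in tensor_category) tmor_diff_right:
  "\<lbrakk>f \<in> Hom a a'; g \<in> Hom b b'; g' \<in> Hom b b'; a \<in> Obj; a' \<in> Obj; b \<in> Obj; b' \<in> Obj\<rbrakk>
    \<Longrightarrow> f \<otimes>\<^sub>m (g - g') = f \<otimes>\<^sub>m g - f \<otimes>\<^sub>m g'"
  using Tmor_add_right[of a a' b b' f "g - g'" g'] by (simp add: diff_hom eq_diff_eq)

lemma (in tensor_category) tns_subt_right: "\<lbrakk>arr C f; arr C f'; arr C g; src f = src f'; tgt f = tgt f'\<rbrakk>
    \<Longrightarrow> g \<otimes> (f \<ominus> f') = g \<otimes> f \<ominus> g \<otimes> f'"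
  by (auto simp del: arr_src_tgt simp: arr_def subt_def tns_def
      tmor_diff_right[of _ "src g" "tgt g" _ "src f'" "tgt f'"])

section \<open>Modules, linear maps and the reduction to free modules\<close>

context arrow_algebra
begin

text \<open>The action arrow alone represents the module, since its target is the underlying
  object.\<close>

definition is_module :: "('o, 'm) arrow \<Rightarrow> bool"
  where "is_module R \<longleftrightarrow> arr C R \<and> src R = A \<otimes>\<^sub>o tgt R
    \<and> R \<odot> (\<mu> \<otimes> \<iota> (tgt R)) = R \<odot> (\<iota> A \<otimes> R) \<odot> \<alpha> A A (tgt R)
    \<and> R \<odot> (\<upsilon> \<otimes> \<iota> (tgt R)) = \<ell> (tgt R)"

text \<open>The module laws for \<open>R\<close> and \<open>S\<close> are deliberately left out:
  linearity of maps is also used to prove that an action satisfies these laws.\<close>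

definition is_linear :: "('o, 'm) arrow \<Rightarrow> ('o, 'm) arrow \<Rightarrow> ('o, 'm) arrow \<Rightarrow> bool"
  where "is_linear R S f \<longleftrightarrow> arr C R \<and> src R = A \<otimes>\<^sub>o tgt R \<and> arr C S \<and> src S = A \<otimes>\<^sub>o tgt S
    \<and> arr C f \<and> src f = tgt R \<and> tgt f = tgt S \<and> f \<odot> R = S \<odot> (\<iota> A \<otimes> f)"

lemma is_linear_arr:
  "is_linear R S f \<Longrightarrow> arr C R" "is_linear R S f \<Longrightarrow> arr C S" "is_linear R S f \<Longrightarrow> arr C f"
  "is_linear R S f \<Longrightarrow> src R = A \<otimes>\<^sub>o tgt R" "is_linear R S f \<Longrightarrow> src S = A \<otimes>\<^sub>o tgt S"
  "is_linear R S f \<Longrightarrow> src f = tgt R" "is_linear R S f \<Longrightarrow> tgt f = tgt S"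
  by (simp_all add: is_linear_def)

lemma is_linear_eq: "is_linear R S f \<Longrightarrow> f \<odot> R = S \<odot> (\<iota> A \<otimes> f)"
  by (simp add: is_linear_def)

lemma is_module_arr:
  "is_module R \<Longrightarrow> arr C R" "is_module R \<Longrightarrow> src R = A \<otimes>\<^sub>o tgt R"
  by (simp_all add: is_module_def)

lemma is_module_eq:
  "is_module R \<Longrightarrow> R \<odot> (\<mu> \<otimes> \<iota> (tgt R)) = R \<odot> (\<iota> A \<otimes> R) \<odot> \<alpha> A A (tgt R)"
  "is_module R \<Longrightarrow> R \<odot> (\<upsilon> \<otimes> \<iota> (tgt R)) = \<ell> (tgt R)"
  by (simp_all add: is_module_def)

lemma is_linear_ide:
  assumes "is_module R"
  shows "is_linear R R (\<iota> (tgt R))"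
proof -
  have "arr C R" "tgt R \<in> Obj" using is_module_arr[OF assms] by simp_all
  then show ?thesis using is_module_arr[OF assms] by (simp add: is_linear_def)
qed

lemma is_linear_comp:
  assumes f: "is_linear R S f" and g: "is_linear S T g"
  shows "is_linear R T (g \<odot> f)"
proof -
  note F = is_linear_arr[OF f] and G = is_linear_arr[OF g]
  have "(g \<odot> f) \<odot> R = g \<odot> S \<odot> (\<iota> A \<otimes> f)" using F G by (simp add: is_linear_eq[OF f])
  also have "\<dots> = T \<odot> (\<iota> A \<otimes> g) \<odot> (\<iota> A \<otimes> f)"
    using F G by (simp del: no_fuse add: whisker[OF is_linear_eq[OF g]])
  also have "\<dots> = T \<odot> (\<iota> A \<otimes> (g \<odot> f))" using F G by simp
  finally show ?thesis using F G by (simp add: is_linear_def)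
qed

lemma is_linear_subt:
  assumes f: "is_linear R S f" and g: "is_linear R S g"
  shows "is_linear R S (f \<ominus> g)"
proof -
  note F = is_linear_arr[OF f] and G = is_linear_arr[OF g]
  have "(f \<ominus> g) \<odot> R = S \<odot> (\<iota> A \<otimes> (f \<ominus> g))"
    using F G by (simp add: cmp_subt_left cmp_subt_right tns_subt_right is_linear_eq[OF f] is_linear_eq[OF g])
  then show ?thesis using F G by (simp add: is_linear_def)
qed

text \<open>Both module laws are equations between arrows into the underlying object, so they can be
  tested after the maps \<open>p j\<close>; linearity carries them to the laws of the
  \<open>R j\<close>. It serves for a retract, with its inclusion as the single map, and for a
  direct sum, with the projections.\<close>

lemma is_module_of_jointly_monic:
  assumes r: "arr C r" "src r = A \<otimes>\<^sub>o tgt r" and mod: "\<And>j. j \<in> J \<Longrightarrow> is_module (R j)"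
    and lin: "\<And>j. j \<in> J \<Longrightarrow> is_linear r (R j) (p j)"
    and monic: "\<And>f g. \<lbrakk>arr C f; arr C g; src f = src g; tgt f = tgt r; tgt g = tgt r;
      \<And>j. j \<in> J \<Longrightarrow> p j \<odot> f = p j \<odot> g\<rbrakk> \<Longrightarrow> f = g"
  shows "is_module r"
proof -
  define x where "x = tgt r"
  have x: "x \<in> Obj" "tgt r = x" "src r = A \<otimes>\<^sub>o x" using r by (auto simp: x_def)
  have ass: "p j \<odot> r \<odot> (\<mu> \<otimes> \<iota> x) = p j \<odot> r \<odot> (\<iota> A \<otimes> r) \<odot> \<alpha> A A x"
    and unit: "p j \<odot> r \<odot> (\<upsilon> \<otimes> \<iota> x) = p j \<odot> \<ell> x" if j: "j \<in> J" for j
  proof -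
    define y where "y = tgt (R j)"
    note M = is_module_eq[OF mod[OF j]] and L = is_linear_arr[OF lin[OF j]]
    have y: "y \<in> Obj" "tgt (R j) = y" using L(2) by (auto simp: y_def)
    have pr: "p j \<odot> r \<odot> t = R j \<odot> (\<iota> A \<otimes> p j) \<odot> t" if "arr C t" "tgt t = A \<otimes>\<^sub>o x" for t
      using whisker[OF is_linear_eq[OF lin[OF j]]] L that x by simp
    have "p j \<odot> r \<odot> (\<mu> \<otimes> \<iota> x) = (R j \<odot> (\<mu> \<otimes> \<iota> y)) \<odot> (\<iota> (A \<otimes>\<^sub>o A) \<otimes> p j)"
      using L x y by (simp add: pr)
    also have "\<dots> = R j \<odot> (\<iota> A \<otimes> R j) \<odot> \<alpha> A A y \<odot> ((\<iota> A \<otimes> \<iota> A) \<otimes> p j)"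
      unfolding M[unfolded y] using L x y by simp
    also have "\<dots> = R j \<odot> (\<iota> A \<otimes> R j) \<odot> (\<iota> A \<otimes> \<iota> A \<otimes> p j) \<odot> \<alpha> A A x"
      using as_nat[of "\<iota> A" "\<iota> A" "p j"] L x y by simp
    also have "\<dots> = R j \<odot> (\<iota> A \<otimes> (p j \<odot> r)) \<odot> \<alpha> A A x"
      using L x y by (simp add: is_linear_eq[OF lin[OF j]])
    also have "\<dots> = p j \<odot> r \<odot> (\<iota> A \<otimes> r) \<odot> \<alpha> A A x"
      using L x y by (simp add: pr)
    finally show "p j \<odot> r \<odot> (\<mu> \<otimes> \<iota> x) = p j \<odot> r \<odot> (\<iota> A \<otimes> r) \<odot> \<alpha> A A x" .
    have "p j \<odot> r \<odot> (\<upsilon> \<otimes> \<iota> x) = (R j \<odot> (\<upsilon> \<otimes> \<iota> y)) \<odot> (\<iota> \<one> \<otimes> p j)"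
      using L x y by (simp add: pr)
    also have "\<dots> = p j \<odot> \<ell> x"
      unfolding M[unfolded y] using L x y lu_nat[of "p j"] by simp
    finally show "p j \<odot> r \<odot> (\<upsilon> \<otimes> \<iota> x) = p j \<odot> \<ell> x" .
  qed
  have "r \<odot> (\<mu> \<otimes> \<iota> x) = r \<odot> (\<iota> A \<otimes> r) \<odot> \<alpha> A A x"
    by (rule monic) (use r x ass in auto)
  moreover have "r \<odot> (\<upsilon> \<otimes> \<iota> x) = \<ell> x"
    by (rule monic) (use r x unit in auto)
  ultimately show ?thesis using r x by (simp add: is_module_def)
qed

lemma act_module: "c \<in> Obj \<Longrightarrow> is_module (act c)"
  by (simp add: is_module_def act_assoc act_unit)

lemma tensor_linear:
  assumes "arr C f"
  shows "is_linear (act (src f)) (act (tgt f)) (\<iota> A \<otimes> f)"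
proof -
  have "(\<iota> A \<otimes> f) \<odot> act (src f) = (\<mu> \<otimes> \<iota> (tgt f)) \<odot> ((\<iota> A \<otimes> \<iota> A) \<otimes> f) \<odot> \<alpha>' A A (src f)"
    using assms by (simp add: act_def)
  also have "\<dots> = act (tgt f) \<odot> (\<iota> A \<otimes> \<iota> A \<otimes> f)"
    using asi_nat[of "\<iota> A" "\<iota> A" f] assms by (simp add: act_def)
  finally show ?thesis using assms by (simp add: is_linear_def)
qed

text \<open>Read from left to right, the associativity law of a module is linearity of its action as
  a map from a free module. This map is the free cover of the module.\<close>

lemma action_linear:
  assumes R: "is_module R"
  shows "is_linear (act (tgt R)) R R"
proof -
  have x: "tgt R \<in> Obj" "arr C R" "src R = A \<otimes>\<^sub>o tgt R" using is_module_arr[OF R] by simp_all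
  have "R \<odot> act (tgt R) = (R \<odot> (\<mu> \<otimes> \<iota> (tgt R))) \<odot> \<alpha>' A A (tgt R)"
    using x by (simp add: act_def)
  also have "\<dots> = R \<odot> (\<iota> A \<otimes> R)"
    unfolding is_module_eq(1)[OF R] using x by simp
  finally show ?thesis using x by (simp add: is_linear_def)
qed

lemma action_unt: "is_module R \<Longrightarrow> R \<odot> unt (tgt R) = \<iota> (tgt R)"
  using whisker[OF is_module_eq(2), of R "\<ell>' (tgt R)"] is_module_arr[of R] by (simp add: unt_def)

text \<open>A module \<open>X\<close> is the cokernel of the difference of the two maps \<open>A \<otimes> (A \<otimes> X) \<rightarrow> A \<otimes> X\<close>.
  Since this difference is regular, \<open>X\<close> is a direct summand of the free module \<open>A \<otimes> X\<close>.\<close>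

lemma action_section:
  assumes reg: "\<And>c d f. \<lbrakk>c \<in> Obj; d \<in> Obj; is_linear (act c) (act d) f\<rbrakk>
      \<Longrightarrow> \<exists>g. is_linear (act d) (act c) g \<and> f \<odot> g \<odot> f = f"
    and R: "is_module R"
  obtains s where "is_linear R (act (tgt R)) s" "R \<odot> s = \<iota> (tgt R)"
proof -
  define x where "x = tgt R"
  have x: "x \<in> Obj" "tgt R = x" "src R = A \<otimes>\<^sub>o x" "arr C R"
    using is_module_arr[OF R] by (auto simp: x_def)
  note Rl = action_linear[OF R, unfolded x]
  define f where "f = act x \<ominus> \<iota> A \<otimes> R"
  have fl: "is_linear (act (A \<otimes>\<^sub>o x)) (act x) f" unfolding f_def
    using is_linear_subt[OF action_linear[OF act_module[OF x(1)]]] tensor_linear[OF x(4)] x by simp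
  then obtain g where gl: "is_linear (act x) (act (A \<otimes>\<^sub>o x)) g" and fgf: "f \<odot> g \<odot> f = f"
    using reg[OF _ x(1) fl] x by auto
  \<comment> \<open>Since \<open>f \<odot> g \<odot> f = f\<close>, the linear endomorphism
    \<open>e\<close> kills \<open>f\<close>. Hence it takes the same value on the two maps whose
    difference is \<open>f\<close>.\<close>
  define e where "e = \<iota> (A \<otimes>\<^sub>o x) \<ominus> f \<odot> g"
  have el: "is_linear (act x) (act x) e" unfolding e_def
    using is_linear_subt[OF is_linear_ide[OF act_module[OF x(1)]] is_linear_comp[OF gl fl]] x by simp
  have f: "arr C f" "src f = A \<otimes>\<^sub>o A \<otimes>\<^sub>o x" "tgt f = A \<otimes>\<^sub>o x"
    and g: "arr C g" "src g = A \<otimes>\<^sub>o x" "tgt g = A \<otimes>\<^sub>o A \<otimes>\<^sub>o x"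
    and e: "arr C e" "src e = A \<otimes>\<^sub>o x" "tgt e = A \<otimes>\<^sub>o x"
    using is_linear_arr[OF fl] is_linear_arr[OF gl] is_linear_arr[OF el] x by simp_all
  have "e \<odot> act x \<ominus> e \<odot> (\<iota> A \<otimes> R) = e \<odot> f"
    unfolding f_def using e x by (simp add: cmp_subt_right)
  also have "\<dots> = f \<ominus> f"
    unfolding e_def using f g x fgf by (simp add: cmp_subt_left)
  finally have eact: "e \<odot> act x = e \<odot> (\<iota> A \<otimes> R)"
    by (rule subt_cancel) (use e x in simp_all)
  \<comment> \<open>The unit \<open>unt x\<close> is already a section of \<open>R\<close>, but in
    general not a linear one; \<open>e\<close> corrects it.\<close>
  define s where "s = e \<odot> unt x"
  have s: "arr C s" "src s = x" "tgt s = A \<otimes>\<^sub>o x" using e x by (simp_all add: s_def)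
  have "act x \<odot> unt (A \<otimes>\<^sub>o x) = \<iota> (A \<otimes>\<^sub>o x)"
    using action_unt[OF act_module[OF x(1)]] x by simp
  then have "e = (e \<odot> act x) \<odot> unt (A \<otimes>\<^sub>o x)" using e x by simp
  also have "\<dots> = s \<odot> R"
    unfolding eact s_def using unt_nat[of R] e x by simp
  finally have sR: "e = s \<odot> R" .
  \<comment> \<open>The action coequalizes the two maps, so \<open>R \<odot> f\<close> is zero and
    \<open>R\<close> does not notice the correction by \<open>e\<close>.\<close>
  have "R \<odot> f = R \<odot> (\<iota> A \<otimes> R) \<ominus> R \<odot> (\<iota> A \<otimes> R)"
    unfolding f_def using x is_linear_eq[OF Rl] by (simp add: cmp_subt_right)
  then have "(R \<odot> f) \<odot> g = (R \<odot> (\<iota> A \<otimes> R)) \<odot> g \<ominus> (R \<odot> (\<iota> A \<otimes> R)) \<odot> g"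
    using x g by (simp add: cmp_subt_left)
  then have "R \<odot> e = R"
    unfolding e_def using x f g by (simp add: cmp_subt_right)
  then have "(R \<odot> s) \<odot> R \<odot> unt x = R \<odot> unt x"
    using x s sR whisker[of R e R "unt x"] e by simp
  then have Rs: "R \<odot> s = \<iota> x" using action_unt[OF R] x s by simp
  \<comment> \<open>Linearity of \<open>s\<close> is tested after
    \<open>\<iota> A \<otimes> R\<close>, which has the right inverse
    \<open>\<iota> A \<otimes> unt x\<close>. There it becomes linearity of
    \<open>e = s \<odot> R\<close>.\<close>
  have "s \<odot> R = act x \<odot> (\<iota> A \<otimes> s)"
  proof (rule cancel_right[where p = "\<iota> A \<otimes> R" and p' = "\<iota> A \<otimes> unt x"])
    show "(s \<odot> R) \<odot> (\<iota> A \<otimes> R) = (act x \<odot> (\<iota> A \<otimes> s)) \<odot> (\<iota> A \<otimes> R)"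
      using eact is_linear_eq[OF el] s x by (simp flip: sR)
  qed (use x s action_unt[OF R] in simp_all)
  then have "is_linear R (act x) s" using x s by (simp add: is_linear_def)
  then show thesis using that Rs x by simp
qed

text \<open>Cover the source by the free module on it and embed the target linearly into a free
  module by \<open>s\<close>. A pseudo-inverse \<open>g\<close> of the resulting map of free modules
  gives the pseudo-inverse \<open>R \<odot> g \<odot> s\<close> of \<open>f\<close>.\<close>

lemma regular_of_free_regular:
  assumes reg: "\<And>c d f. \<lbrakk>c \<in> Obj; d \<in> Obj; is_linear (act c) (act d) f\<rbrakk>
      \<Longrightarrow> \<exists>g. is_linear (act d) (act c) g \<and> f \<odot> g \<odot> f = f"
    and R: "is_module R" and S: "is_module S" and f: "is_linear R S f"
  shows "\<exists>g. is_linear S R g \<and> f \<odot> g \<odot> f = f"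
proof -
  obtain s where sl: "is_linear S (act (tgt S)) s" and Ss: "S \<odot> s = \<iota> (tgt S)"
    using action_section[OF reg S] by blast
  define x y where "x = tgt R" and "y = tgt S"
  have xy: "x \<in> Obj" "y \<in> Obj"
    using is_module_arr[OF R] is_module_arr[OF S] by (auto simp: x_def y_def)
  note Rl = action_linear[OF R] and Sl = action_linear[OF S]
  have "is_linear (act x) (act y) (s \<odot> f \<odot> R)"
    unfolding x_def y_def by (intro is_linear_comp[OF _ sl] is_linear_comp[OF Rl f])
  then obtain g where gl: "is_linear (act y) (act x) g"
    and g: "(s \<odot> f \<odot> R) \<odot> g \<odot> (s \<odot> f \<odot> R) = s \<odot> f \<odot> R"
    using reg[OF xy] by blast
  have kl: "is_linear S R (R \<odot> g \<odot> s)"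
    using is_linear_comp[OF is_linear_comp[OF sl gl[unfolded x_def y_def]] Rl] .
  note arrs = is_linear_arr[OF f] is_linear_arr[OF gl] is_linear_arr[OF sl] is_linear_arr[OF Rl]
    x_def[symmetric] y_def[symmetric] xy
  have cancel: "S \<odot> s \<odot> t = t" if "arr C t" "tgt t = y" for t
    using whisker[OF Ss] that arrs by simp
  \<comment> \<open>The cover is undone on the right by \<open>unt x\<close> and the embedding on
    the left by \<open>S\<close>. Linearity of \<open>unt x\<close> is irrelevant here, as only an
    equation of arrows is at stake.\<close>
  have "f \<odot> (R \<odot> g \<odot> s) \<odot> f = S \<odot> ((s \<odot> f \<odot> R) \<odot> g \<odot> (s \<odot> f \<odot> R)) \<odot> unt x"
    using action_unt[OF R] arrs by (simp add: cancel)
  also have "\<dots> = f"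
    unfolding g using action_unt[OF R] arrs by (simp add: cancel)
  finally show ?thesis using kl by blast
qed

text \<open>The image \<open>k\<close> inherits the action
  \<open>p \<odot> R \<odot> (\<iota> A \<otimes> i)\<close>. Linearity of \<open>e\<close> makes
  both \<open>p\<close> and \<open>i\<close> linear, and the module laws follow because
  \<open>i\<close> is monic.\<close>

lemma split_idempotent:
  assumes R: "is_module R" and e: "is_linear R R e"
    and p: "arr C p" "src p = tgt R" "tgt p = k" and i: "arr C i" "src i = k" "tgt i = tgt R"
    and pi: "p \<odot> i = \<iota> k" and ip: "i \<odot> p = e"
  shows "\<exists>r. is_module r \<and> is_linear R r p \<and> is_linear r R i"
proof -
  define x where "x = tgt R"
  have x: "x \<in> Obj" "tgt R = x" "src R = A \<otimes>\<^sub>o x" "arr C R"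
    using is_module_arr[OF R] by (auto simp: x_def)
  have k: "k \<in> Obj" using p by auto
  have "e \<odot> i = i \<odot> p \<odot> i" using p i x by (simp flip: ip)
  then have ei: "e \<odot> i = i" using pi i by simp
  have "p \<odot> e = (p \<odot> i) \<odot> p" using p i by (simp flip: ip)
  then have pe: "p \<odot> e = p" using pi p by simp
  note E = is_linear_arr[OF e, unfolded x]
  note p = p[unfolded x] and i = i[unfolded x]
  define r where "r = p \<odot> R \<odot> (\<iota> A \<otimes> i)"
  have r: "arr C r" "src r = A \<otimes>\<^sub>o k" "tgt r = k" using p i x by (simp_all add: r_def)
  have "i \<odot> r = (e \<odot> R) \<odot> (\<iota> A \<otimes> i)"
    using p i x by (simp add: r_def flip: ip)
  also have "\<dots> = R \<odot> (\<iota> A \<otimes> i)"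
    unfolding is_linear_eq[OF e] using E i x by (simp add: ei)
  finally have il: "is_linear r R i" using r i x by (simp add: is_linear_def)
  have "p \<odot> R = (p \<odot> e) \<odot> R" by (simp add: pe)
  also have "\<dots> = p \<odot> R \<odot> (\<iota> A \<otimes> e)" using p E x by (simp add: is_linear_eq[OF e])
  also have "\<dots> = r \<odot> (\<iota> A \<otimes> p)" using p i x by (simp add: r_def flip: ip)
  finally have pl: "is_linear R r p" using r p x by (simp add: is_linear_def)
  have "is_module r"
  proof (rule is_module_of_jointly_monic[of r "{()}" "\<lambda>_. R" "\<lambda>_. i"])
    fix f g assume "arr C f" "arr C g" "tgt f = tgt r" "tgt g = tgt r"
      and "\<And>j. j \<in> {()} \<Longrightarrow> i \<odot> f = i \<odot> g"
    then show "f = g"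
      using cancel_left[of i f g p k] i p pi r by simp
  qed (use r R il in auto)
  then show ?thesis using il pl by blast
qed

end

section \<open>Categories of modules\<close>

sublocale algebra_object \<subseteq> arrow_algebra C A "Arrow (A \<otimes>\<^sub>o A) m A" "Arrow \<one> i A"
  using alg_obj alg_mult alg_unit alg_assoc alg_unit_left alg_unit_right
  by unfold_locales (simp_all del: arr_src_tgt add: arr_def cmp_def tns_def ide_def as_def lu_def ru_def)

lemma (in arrow_algebra) algebra_object: "algebra_object C A (mor \<mu>) (mor \<upsilon>)"
proof
  show "mor \<mu> \<in> Hom (A \<otimes>\<^sub>o A) A" "mor \<upsilon> \<in> Hom \<one> A"
    using mult_arr unit_arr by (auto simp del: arr_src_tgt simp: arr_def)
qed (use arg_cong[OF mult_assoc, of mor] arg_cong[OF mult_unit_left, of mor]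
    arg_cong[OF mult_unit_right, of mor] in \<open>simp_all add: cmp_def tns_def ide_def as_def lu_def ru_def\<close>)

section \<open>The linear category of modules over an algebra\<close>

context algebra_object
begin

definition mact :: "'o \<times> 'm \<Rightarrow> ('o, 'm) arrow"
  where "mact x = Arrow (A \<otimes>\<^sub>o fst x) (snd x) (fst x)"

lemma src_tgt_mact [simp]: "src (mact x) = A \<otimes>\<^sub>o fst x" "tgt (mact x) = fst x" "mor (mact x) = snd x"
  by (simp_all add: mact_def)

lemma left_modules_iff: "x \<in> left_modules C A m i \<longleftrightarrow> is_module (mact x)"
  using alg_obj Tobj_closed
  by (cases x) (auto simp del: arr_src_tgt simp: left_modules_def is_module_def mact_def arr_def cmp_def tns_def
      ide_def as_def lu_def)

lemma module_eq_mact: "is_module R \<Longrightarrow> R = mact (tgt R, mor R)"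
  using is_module_arr(2)[of R] by (cases R) (simp add: mact_def)

lemma is_module_mact: "x \<in> left_modules C A m i \<Longrightarrow> is_module (mact x)"
  by (simp add: left_modules_iff)

lemma module_obj: "x \<in> left_modules C A m i \<Longrightarrow> fst x \<in> Obj"
  by (auto simp: left_modules_def)

lemma module_hom_iff:
  assumes "x \<in> left_modules C A m i" "y \<in> left_modules C A m i"
  shows "f \<in> homs (module_category C A m i) x y \<longleftrightarrow> is_linear (mact x) (mact y) (Arrow (fst x) f (fst y))"
proof -
  have "arr C (mact x)" "arr C (mact y)" "fst x \<in> Obj" "fst y \<in> Obj"
    using assms is_module_arr(1)[OF is_module_mact] module_obj by auto
  then show ?thesis
    by (cases x; cases y) (auto simp del: arr_src_tgt simp: module_category_def is_linear_def mact_def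
        arr_def cmp_def tns_def ide_def)
qed

lemma linear_category_modules: "linear_category (module_category C A m i)"
proof -
  let ?N = "module_category C A m i"
  have [simp]: "objects ?N = left_modules C A m i" "Comp ?N = Comp C" "Scale ?N = Scale C"
    "\<And>x. identity ?N x = Idn (fst x)"
    by (auto simp: module_category_def)
  have hom: "homs ?N x y = {f \<in> Hom (fst x) (fst y). f \<cdot> snd x = snd y \<cdot> (Idn A \<otimes>\<^sub>m f)}" for x y
    by (auto simp: module_category_def split: prod.splits)
  have action: "snd x \<in> Hom (A \<otimes>\<^sub>o fst x) (fst x)" if "x \<in> left_modules C A m i" for x
    using that by (auto simp: left_modules_def)
  have sub: "vs.subspace (homs ?N x y)"
    if x: "x \<in> left_modules C A m i" and y: "y \<in> left_modules C A m i" for x y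
  proof -
    note ob = alg_obj module_obj[OF x] module_obj[OF y]
    note ob' = Tobj_closed[OF ob(1,2)] Tobj_closed[OF ob(1,3)]
    note tm = Tmor_closed[OF ob(1,1) ob(2,3) Idn_closed[OF ob(1)]]
    note [simp] = zero_hom add_hom scale_hom ob ob'
    have "Idn A \<otimes>\<^sub>m 0 = 0"
      using tmor_diff_right[OF Idn_closed[OF ob(1)], of 0 "fst x" "fst y" 0] by simp
    then have "0 \<in> homs ?N x y"
      using comp_zero_left[OF action[OF x], of "fst y"] comp_zero_right[OF action[OF y], of "A \<otimes>\<^sub>o fst x"]
      by (simp add: hom)
    moreover have "f + g \<in> homs ?N x y" if "f \<in> homs ?N x y" "g \<in> homs ?N x y" for f g
      using that Comp_add_left[OF _ _ _ action[OF x], of "fst y" f g]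
        Tmor_add_right[OF ob(1,1) ob(2,3) Idn_closed[OF ob(1)], of f g]
        Comp_add_right[OF _ _ _ tm tm action[OF y], of f g]
      by (simp add: hom)
    moreover have "Scale C t f \<in> homs ?N x y" if "f \<in> homs ?N x y" for t f
      using that Comp_scale_left[OF _ _ _ action[OF x], of "fst y" f t]
        Tmor_scale_right[OF ob(1,1) ob(2,3) Idn_closed[OF ob(1)], of f t]
        Comp_scale_right[OF _ _ _ tm action[OF y], of f t]
      by (simp add: hom)
    ultimately show ?thesis by (simp add: vs.subspace_def)
  qed
  show ?thesis
  proof (rule linear_category.intro)
    show "vector_space (Scale ?N)" by (simp add: vector_space_Scale)
  next
    fix x y assume "x \<in> objects ?N" "y \<in> objects ?N"
    then have xy: "x \<in> left_modules C A m i" "y \<in> left_modules C A m i" by auto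
    show "module.subspace (Scale ?N) (homs ?N x y)" using sub[OF xy] by simp
    obtain S where S: "finite S" "Hom (fst x) (fst y) \<subseteq> vs.span S"
      using Hom_finite_dim[OF module_obj[OF xy(1)] module_obj[OF xy(2)]] by blast
    \<comment> \<open>The spanning set has to lie inside the subspace of linear maps. A maximal
      independent subset does, and it is finite because it lies in the span of the finite set
      \<open>S\<close>.\<close>
    obtain B where B: "B \<subseteq> homs ?N x y" "vs.independent B" "homs ?N x y \<subseteq> vs.span B"
      using vs.maximal_independent_subset by blast
    have "B \<subseteq> Hom (fst x) (fst y)" using B(1) by (auto simp: hom)
    then have "B \<subseteq> vs.span S" using S(2) by (rule order_trans)
    then have "finite B" using vs.independent_span_bound[OF S(1) B(2)] by blast
    then show "\<exists>B. finite B \<and> B \<subseteq> homs ?N x y \<and> homs ?N x y \<subseteq> module.span (Scale ?N) B"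
      using B(1,3) by (intro exI[of _ B]) simp
  next
    fix x assume "x \<in> objects ?N"
    then have x: "x \<in> left_modules C A m i" by simp
    show "identity ?N x \<in> homs ?N x x"
      using is_linear_ide[OF is_module_mact[OF x]] by (simp add: module_hom_iff[OF x x] ide_def)
  next
    fix x y z f g assume "x \<in> objects ?N" "y \<in> objects ?N" "z \<in> objects ?N"
      and f: "f \<in> homs ?N x y" and g: "g \<in> homs ?N y z"
    then have xyz: "x \<in> left_modules C A m i" "y \<in> left_modules C A m i" "z \<in> left_modules C A m i"
      by auto
    show "Comp ?N g f \<in> homs ?N x z"
      using is_linear_comp[OF f[unfolded module_hom_iff[OF xyz(1,2)]] g[unfolded module_hom_iff[OF xyz(2,3)]]]
      by (simp add: module_hom_iff[OF xyz(1,3)] cmp_def)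
  next
    fix x y f assume "x \<in> objects ?N" "y \<in> objects ?N" "f \<in> homs ?N x y"
    then show "Comp ?N (identity ?N y) f = f" "Comp ?N f (identity ?N x) = f"
      using Comp_Idn_left[of "fst x" "fst y" f] Comp_Idn_right[of "fst x" "fst y" f]
      by (simp_all add: hom module_obj)
  next
    fix x y z w f g h
    assume "x \<in> objects ?N" "y \<in> objects ?N" "z \<in> objects ?N" "w \<in> objects ?N"
      "f \<in> homs ?N x y" "g \<in> homs ?N y z" "h \<in> homs ?N z w"
    then show "Comp ?N (Comp ?N h g) f = Comp ?N h (Comp ?N g f)"
      using Comp_assoc[of "fst x" "fst y" "fst z" "fst w" f g h] by (simp add: hom module_obj)
  next
    fix x y z f g g' assume "x \<in> objects ?N" "y \<in> objects ?N" "z \<in> objects ?N"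
      "f \<in> homs ?N x y" "g \<in> homs ?N y z" "g' \<in> homs ?N y z"
    then show "Comp ?N (g + g') f = Comp ?N g f + Comp ?N g' f"
      using Comp_add_left[of "fst x" "fst y" "fst z" f g g'] by (simp add: hom module_obj)
  next
    fix x y z f f' g assume "x \<in> objects ?N" "y \<in> objects ?N" "z \<in> objects ?N"
      "f \<in> homs ?N x y" "f' \<in> homs ?N x y" "g \<in> homs ?N y z"
    then show "Comp ?N g (f + f') = Comp ?N g f + Comp ?N g f'"
      using Comp_add_right[of "fst x" "fst y" "fst z" f f' g] by (simp add: hom module_obj)
  next
    fix x y z f g t assume "x \<in> objects ?N" "y \<in> objects ?N" "z \<in> objects ?N"
      "f \<in> homs ?N x y" "g \<in> homs ?N y z"
    then show "Comp ?N (Scale ?N t g) f = Scale ?N t (Comp ?N g f)"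
      "Comp ?N g (Scale ?N t f) = Scale ?N t (Comp ?N g f)"
      using Comp_scale_left[of "fst x" "fst y" "fst z" f g t]
        Comp_scale_right[of "fst x" "fst y" "fst z" f g t] by (simp_all add: hom module_obj)
  qed
qed

lemma regular_modulesI:
  assumes "\<And>R S f. \<lbrakk>is_module R; is_module S; is_linear R S f\<rbrakk> \<Longrightarrow> \<exists>g. is_linear S R g \<and> f \<odot> g \<odot> f = f"
  shows "regular_category (module_category C A m i)"
  unfolding regular_category_def
proof (intro ballI)
  let ?N = "module_category C A m i"
  have [simp]: "Comp ?N = Comp C" by (simp add: module_category_def)
  fix x y f assume "x \<in> objects ?N" "y \<in> objects ?N" and f: "f \<in> homs ?N x y"
  then have x: "x \<in> left_modules C A m i" and y: "y \<in> left_modules C A m i"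
    by (auto simp: module_category_def)
  obtain g where g: "is_linear (mact y) (mact x) g"
    and fgf: "Arrow (fst x) f (fst y) \<odot> g \<odot> Arrow (fst x) f (fst y) = Arrow (fst x) f (fst y)"
    using assms[OF is_module_mact[OF x] is_module_mact[OF y] f[unfolded module_hom_iff[OF x y]]] by blast
  have "g = Arrow (fst y) (mor g) (fst x)"
    using is_linear_arr(6,7)[OF g] by (cases g) simp
  then have "mor g \<in> homs ?N y x" using g module_hom_iff[OF y x] by simp
  moreover have "f \<cdot> mor g \<cdot> f = f" using fgf by (simp add: cmp_def)
  ultimately show "\<exists>g\<in>homs ?N y x. Comp ?N f (Comp ?N g f) = f" by auto
qed

lemma regular_modulesD:
  assumes reg: "regular_category (module_category C A m i)"
    and R: "is_module R" and S: "is_module S" and f: "is_linear R S f"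
  shows "\<exists>g. is_linear S R g \<and> f \<odot> g \<odot> f = f"
proof -
  let ?N = "module_category C A m i"
  define x y where "x = (tgt R, mor R)" and "y = (tgt S, mor S)"
  have RS: "R = mact x" "S = mact y"
    using module_eq_mact[OF R, symmetric] module_eq_mact[OF S, symmetric] by (simp_all add: x_def y_def)
  then have xy: "x \<in> left_modules C A m i" "y \<in> left_modules C A m i"
    using R S by (simp_all add: left_modules_iff)
  have fe: "f = Arrow (fst x) (mor f) (fst y)"
    using is_linear_arr(6,7)[OF f] by (cases f) (simp add: RS)
  have "mor f \<in> homs ?N x y" using f fe module_hom_iff[OF xy] by (simp add: RS)
  moreover have "x \<in> objects ?N" "y \<in> objects ?N" "Comp ?N = Comp C"
    using xy by (simp_all add: module_category_def)
  ultimately obtain g where g: "g \<in> homs ?N y x" "mor f \<cdot> g \<cdot> mor f = mor f"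
    using reg unfolding regular_category_def by metis
  have "is_linear S R (Arrow (fst y) g (fst x))" using g module_hom_iff[OF xy(2,1)] by (simp add: RS)
  moreover have "f \<odot> Arrow (fst y) g (fst x) \<odot> f = f"
    using g(2) fe by (metis arrow.sel cmp_def)
  ultimately show ?thesis by blast
qed

lemma idempotents_split_modules:
  assumes split: "idempotents_split C"
  shows "idempotents_split (module_category C A m i)"
  unfolding idempotents_split_def
proof (intro ballI impI)
  let ?N = "module_category C A m i"
  have [simp]: "Comp ?N = Comp C" "\<And>x. identity ?N x = Idn (fst x)"
    by (auto simp: module_category_def)
  fix x e assume "x \<in> objects ?N" and e: "e \<in> homs ?N x x" and ee: "Comp ?N e e = e"
  then have x: "x \<in> left_modules C A m i" by (auto simp: module_category_def)
  note el = e[unfolded module_hom_iff[OF x x]]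
  have "e \<in> Hom (fst x) (fst x)"
    using is_linear_arr(3)[OF el] by (simp del: arr_src_tgt add: arr_def)
  then obtain k p j where k: "k \<in> Obj" and r: "is_retract C (fst x) k p j" and jp: "j \<cdot> p = e"
    using split ee[simplified] module_obj[OF x] unfolding idempotents_split_def by blast
  define P J where "P = Arrow (fst x) p k" and "J = Arrow k j (fst x)"
  have PJ: "arr C P" "arr C J" "P \<odot> J = \<iota> k" "J \<odot> P = Arrow (fst x) e (fst x)"
    using r jp k module_obj[OF x]
    by (auto simp del: arr_src_tgt simp: is_retract_def P_def J_def arr_def cmp_def ide_def)
  obtain s where s: "is_module s" "is_linear (mact x) s P" "is_linear s (mact x) J"
    using split_idempotent[OF is_module_mact[OF x] el PJ(1) _ _ PJ(2) _ _ PJ(3,4)]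
    by (auto simp: P_def J_def)
  have ts: "tgt s = k" using is_linear_arr(7)[OF s(2)] by (simp add: P_def)
  define y where "y = (k, mor s)"
  have sy: "mact y = s" and fy: "fst y = k"
    using module_eq_mact[OF s(1), symmetric] ts by (simp_all add: y_def)
  have y: "y \<in> left_modules C A m i" using s sy by (simp add: left_modules_iff)
  have "p \<in> homs ?N x y" "j \<in> homs ?N y x"
    using s by (simp_all add: module_hom_iff[OF x y] module_hom_iff[OF y x] sy fy flip: P_def J_def)
  then have "is_retract ?N x y p j" using r by (simp add: is_retract_def fy)
  moreover have "y \<in> objects ?N" using y by (simp add: module_category_def)
  ultimately show "\<exists>y\<in>objects ?N. \<exists>p j. is_retract ?N x y p j \<and> Comp ?N j p = e" using jp by auto
qed

text \<open>The direct sum of the underlying objects carries the diagonal action. Joint monicity of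
  the projections yields first the module laws and then linearity of the inclusions.\<close>

lemma direct_sum_modules:
  assumes sums: "\<And>n x. (\<And>j. j < n \<Longrightarrow> x j \<in> Obj) \<Longrightarrow> \<exists>s\<in>Obj. is_direct_sum C n x s"
    and x: "\<And>j. j < n \<Longrightarrow> x j \<in> left_modules C A m i"
  shows "\<exists>s\<in>left_modules C A m i. is_direct_sum (module_category C A m i) n x s"
proof -
  let ?N = "module_category C A m i"
  have [simp]: "Comp ?N = Comp C" "\<And>x. identity ?N x = Idn (fst x)"
    by (auto simp: module_category_def)
  have xo: "fst (x j) \<in> Obj" if "j < n" for j using module_obj x that by simp
  obtain s where s: "s \<in> Obj" and ds: "is_direct_sum C n (\<lambda>j. fst (x j)) s"
    using sums[of n "\<lambda>j. fst (x j)"] xo by blast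
  obtain q p where q: "\<And>j. j < n \<Longrightarrow> q j \<in> Hom (fst (x j)) s" and p: "\<And>j. j < n \<Longrightarrow> p j \<in> Hom s (fst (x j))"
    and pq: "\<And>j l. \<lbrakk>j < n; l < n\<rbrakk> \<Longrightarrow> p j \<cdot> q l = (if j = l then Idn (fst (x j)) else 0)"
    and id: "Idn s = (\<Sum>j<n. q j \<cdot> p j)"
    using ds unfolding is_direct_sum_def by blast
  have act: "snd (x j) \<in> Hom (A \<otimes>\<^sub>o fst (x j)) (fst (x j))" if "j < n" for j
    using x[OF that] by (auto simp: left_modules_def)
  have tp: "Idn A \<otimes>\<^sub>m p j \<in> Hom (A \<otimes>\<^sub>o s) (A \<otimes>\<^sub>o fst (x j))" if "j < n" for j
    using Tmor_closed[OF _ _ _ _ Idn_closed p] alg_obj s xo that by simp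
  have atp: "snd (x j) \<cdot> (Idn A \<otimes>\<^sub>m p j) \<in> Hom (A \<otimes>\<^sub>o s) (fst (x j))" if "j < n" for j
    using comp_hom[OF act tp] alg_obj s xo that by simp
  \<comment> \<open>The only possible action for which all projections are linear.\<close>
  define r where "r = (\<Sum>j<n. q j \<cdot> snd (x j) \<cdot> (Idn A \<otimes>\<^sub>m p j))"
  have r: "r \<in> Hom (A \<otimes>\<^sub>o s) s" unfolding r_def
    by (rule sum_hom) (use comp_hom[OF q atp] alg_obj s xo in auto)
  have pr: "p l \<cdot> r = snd (x l) \<cdot> (Idn A \<otimes>\<^sub>m p l)" if l: "l < n" for l
  proof -
    have "p l \<cdot> r = (\<Sum>j<n. p l \<cdot> q j \<cdot> snd (x j) \<cdot> (Idn A \<otimes>\<^sub>m p j))"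
      unfolding r_def
      by (rule comp_sum_right[OF p[OF l], of _ _ "A \<otimes>\<^sub>o s"]) (use comp_hom[OF q atp] alg_obj s xo l in auto)
    also have "\<dots> = (\<Sum>j<n. if j = l then snd (x l) \<cdot> (Idn A \<otimes>\<^sub>m p l) else 0)"
    proof (rule sum.cong[OF refl])
      fix j assume "j \<in> {..<n}"
      then have j: "j < n" by simp
      show "p l \<cdot> q j \<cdot> snd (x j) \<cdot> (Idn A \<otimes>\<^sub>m p j) = (if j = l then snd (x l) \<cdot> (Idn A \<otimes>\<^sub>m p l) else 0)"
        using comp_assoc[OF p[OF l] q[OF j] atp[OF j]] pq[OF l j] atp[OF j] xo[OF j] xo[OF l] s alg_obj
          Comp_Idn_left[OF _ _ atp[OF j]] comp_zero_left[OF atp[OF j], of "fst (x l)"] by auto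
    qed
    finally show ?thesis using l by simp
  qed
  define S Q P where "S = mact (s, r)" and "Q = (\<lambda>j. Arrow (fst (x j)) (q j) s)"
    and "P = (\<lambda>j. Arrow s (p j) (fst (x j)))"
  have S: "arr C S" "src S = A \<otimes>\<^sub>o s" "tgt S = s"
    using r s alg_obj by (simp_all del: arr_src_tgt add: S_def mact_def arr_def)
  have P: "arr C (P j)" "src (P j) = s" "tgt (P j) = fst (x j)"
    and Q: "arr C (Q j)" "src (Q j) = fst (x j)" "tgt (Q j) = s" if "j < n" for j
    using p q s xo that by (simp_all del: arr_src_tgt add: P_def Q_def arr_def)
  have M: "is_module (mact (x j))" if "j < n" for j using is_module_mact x that by simp
  note Ma = is_module_arr(1)[OF M]
  have Plin: "is_linear S (mact (x j)) (P j)" if j: "j < n" for j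
  proof -
    have "P j \<odot> S = mact (x j) \<odot> (\<iota> A \<otimes> P j)"
      using pr[OF j] by (simp add: P_def S_def mact_def cmp_def tns_def ide_def)
    then show ?thesis using S P[OF j] Ma[OF j] by (simp add: is_linear_def)
  qed
  have monic: "f = g" if f: "arr C f" "tgt f = s" and g: "arr C g" "tgt g = s" and src: "src f = src g"
    and eq: "\<And>j. j < n \<Longrightarrow> P j \<odot> f = P j \<odot> g" for f g
  proof -
    have o: "src g \<in> Obj" using g(1) by simp
    have fg: "mor f \<in> Hom (src g) s" "mor g \<in> Hom (src g) s"
      using f g src by (auto simp del: arr_src_tgt simp: arr_def)
    have "mor f = (\<Sum>j<n. q j \<cdot> p j \<cdot> mor f)"
      using direct_sum_components[OF q p xo s o id fg(1)] .
    also have "\<dots> = (\<Sum>j<n. q j \<cdot> p j \<cdot> mor g)"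
    proof (rule sum.cong[OF refl])
      fix j assume "j \<in> {..<n}"
      then have "p j \<cdot> mor f = p j \<cdot> mor g" using eq[of j] by (simp add: cmp_def P_def)
      then show "q j \<cdot> p j \<cdot> mor f = q j \<cdot> p j \<cdot> mor g" by simp
    qed
    also have "\<dots> = mor g"
      using direct_sum_components[OF q p xo s o id fg(2)] by (rule sym)
    finally show ?thesis using f g src by (cases f; cases g) simp
  qed
  have Smod: "is_module S"
  proof (rule is_module_of_jointly_monic[of S "{..<n}" "\<lambda>j. mact (x j)" P])
    show "f = g" if "arr C f" "arr C g" "src f = src g" "tgt f = tgt S" "tgt g = tgt S"
      "\<And>j. j \<in> {..<n} \<Longrightarrow> P j \<odot> f = P j \<odot> g" for f g
      by (rule monic) (use that S in auto)
  qed (use S M Plin in auto)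
  have zero: "Idn A \<otimes>\<^sub>m 0 = 0"
    using tmor_diff_right[OF Idn_closed[OF alg_obj] zero_hom[OF s s] zero_hom[OF s s]] alg_obj s by simp
  have Qlin: "is_linear (mact (x l)) S (Q l)" if l: "l < n" for l
  proof -
    have "Q l \<odot> mact (x l) = S \<odot> (\<iota> A \<otimes> Q l)"
    proof (rule monic)
      fix j assume j: "j < n"
      have PQ: "P j \<odot> Q l = Arrow (fst (x l)) (if j = l then Idn (fst (x j)) else 0) (fst (x j))"
        using pq[OF j l] by (simp add: P_def Q_def cmp_def)
      \<comment> \<open>After projecting, the inclusion becomes an identity or a zero map, both of
        which are linear.\<close>
      have "(P j \<odot> Q l) \<odot> mact (x l) = mact (x j) \<odot> (\<iota> A \<otimes> (P j \<odot> Q l))"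
      proof (cases "j = l")
        case True
        then have "P j \<odot> Q l = \<iota> (fst (x l))" using PQ by (simp add: ide_def)
        then show ?thesis using True Ma[OF l] xo[OF l] alg_obj by simp
      next
        case False
        then have PQ0: "P j \<odot> Q l = Arrow (fst (x l)) 0 (fst (x j))" using PQ by simp
        show ?thesis unfolding PQ0
          using comp_zero_left[OF act[OF l], of "fst (x j)"]
            comp_zero_right[OF act[OF j], of "A \<otimes>\<^sub>o fst (x l)"] xo j l alg_obj
          by (simp add: cmp_def tns_def ide_def zero mact_def)
      qed
      also have "mact (x j) \<odot> (\<iota> A \<otimes> (P j \<odot> Q l)) = (mact (x j) \<odot> (\<iota> A \<otimes> P j)) \<odot> (\<iota> A \<otimes> Q l)"
        using P[OF j] Q[OF l] Ma[OF j] alg_obj by simp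
      also have "\<dots> = P j \<odot> S \<odot> (\<iota> A \<otimes> Q l)"
        unfolding is_linear_eq[OF Plin[OF j], symmetric] using P[OF j] Q[OF l] S alg_obj by simp
      finally show "P j \<odot> Q l \<odot> mact (x l) = P j \<odot> S \<odot> (\<iota> A \<otimes> Q l)"
        using P[OF j] Q[OF l] Ma[OF l] by simp
    qed (use Q[OF l] S Ma[OF l] alg_obj in auto)
    then show ?thesis using S Q[OF l] Ma[OF l] by (simp add: is_linear_def)
  qed
  have sr: "(s, r) \<in> left_modules C A m i" using Smod by (simp add: left_modules_iff S_def)
  have "q j \<in> homs ?N (x j) (s, r)" "p j \<in> homs ?N (s, r) (x j)" if "j < n" for j
    using Qlin[OF that] Plin[OF that]
    by (simp_all add: module_hom_iff[OF x[OF that] sr] module_hom_iff[OF sr x[OF that]] P_def Q_def S_def)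
  then have "is_direct_sum ?N n x (s, r)"
    unfolding is_direct_sum_def using pq id by (intro exI[of _ q] exI[of _ p]) simp
  then show ?thesis using sr by blast
qed

lemma semisimple_modulesI:
  assumes C: "abelian_category C"
    and reg: "\<And>c d f. \<lbrakk>c \<in> Obj; d \<in> Obj; is_linear (act c) (act d) f\<rbrakk>
      \<Longrightarrow> \<exists>g. is_linear (act d) (act c) g \<and> f \<odot> g \<odot> f = f"
  shows "semisimple_category (module_category C A m i)"
proof (rule semisimple_categoryI)
  show "linear_category (module_category C A m i)" by (rule linear_category_modules)
  show "regular_category (module_category C A m i)"
    by (rule regular_modulesI[OF regular_of_free_regular[OF reg]])
  show "idempotents_split (module_category C A m i)"
    by (rule idempotents_split_modules[OF abelian_category.idempotents_split[OF C]])
  show "\<exists>s\<in>objects (module_category C A m i). is_direct_sum (module_category C A m i) n x s"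
    if "\<And>j. j < n \<Longrightarrow> x j \<in> objects (module_category C A m i)" for n x
    using direct_sum_modules[OF abelian_category.direct_sum_exists[OF C]] that
    by (simp add: module_category_def)
qed

end

section \<open>Tensor functors and adjunctions on arrows\<close>

text \<open>Here \<open>d\<close> itself must be the dual, so the witness is a predual:
  \<open>d\<close> is isomorphic to a dual \<open>b\<close> of some \<open>a\<close>, and evaluation
  and coevaluation are transported along this isomorphism. The object \<open>a\<close> becomes
  \<open>d'\<close>.\<close>

lemma (in rigid_tensor_category) arrow_dual_exists:
  assumes d: "d \<in> Obj"
  obtains d' ev coev where "d' \<in> Obj"
    "arr C ev" "src ev = d \<otimes>\<^sub>o d'" "tgt ev = \<one>" "arr C coev" "src coev = \<one>" "tgt coev = d' \<otimes>\<^sub>o d"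
    "\<ell> d \<odot> (ev \<otimes> \<iota> d) \<odot> \<alpha>' d d' d \<odot> (\<iota> d \<otimes> coev) = \<rho> d"
proof -
  obtain a b where a: "a \<in> Obj" and dual: "is_dual C a b" and iso: "isomorphic C d b"
    using predual_exists[OF d] by blast
  obtain e c where b: "b \<in> Obj" and e: "e \<in> Hom (b \<otimes>\<^sub>o a) \<one>" and c: "c \<in> Hom \<one> (a \<otimes>\<^sub>o b)"
    and zig: "\<l> b \<cdot> (e \<otimes>\<^sub>m Idn b) \<cdot> inv_mor C ((b \<otimes>\<^sub>o a) \<otimes>\<^sub>o b) (b \<otimes>\<^sub>o (a \<otimes>\<^sub>o b)) (\<a> b a b)
      \<cdot> (Idn b \<otimes>\<^sub>m c) = \<r> b"
    using dual unfolding is_dual_def by blast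
  obtain f g where fg: "is_inverse C d b f g" using iso by (auto simp: isomorphic_def is_iso_def)
  define ev coev \<phi> \<psi> where "ev = Arrow (b \<otimes>\<^sub>o a) e \<one>" and "coev = Arrow \<one> c (a \<otimes>\<^sub>o b)"
    and "\<phi> = Arrow d f b" and "\<psi> = Arrow b g d"
  have ev: "arr C ev" "src ev = b \<otimes>\<^sub>o a" "tgt ev = \<one>"
    and coev: "arr C coev" "src coev = \<one>" "tgt coev = a \<otimes>\<^sub>o b"
    and \<phi>: "arr C \<phi>" "src \<phi> = d" "tgt \<phi> = b" and \<psi>: "arr C \<psi>" "src \<psi> = b" "tgt \<psi> = d"
    and inv: "\<phi> \<odot> \<psi> = \<iota> b" "\<psi> \<odot> \<phi> = \<iota> d"
    using e c fg a b d
    by (simp_all del: arr_src_tgt add: ev_def coev_def \<phi>_def \<psi>_def arr_def is_inverse_def cmp_def ide_def)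
  have zig': "\<ell> b \<odot> (ev \<otimes> \<iota> b) \<odot> \<alpha>' b a b \<odot> (\<iota> b \<otimes> coev) = \<rho> b"
    using zig by (simp add: ev_def coev_def cmp_def tns_def ide_def asi_def as_def lu_def ru_def inv_arrow_def)
  let ?ev = "ev \<odot> (\<phi> \<otimes> \<iota> a)" and ?coev = "(\<iota> a \<otimes> \<psi>) \<odot> coev"
  \<comment> \<open>After composing with \<phi>, naturality moves \<phi> to the right through the
    composite. It meets the \<psi> of the new coevaluation and cancels, leaving the zig-zag of
    \<open>b\<close>.\<close>
  have "\<phi> \<odot> \<ell> d \<odot> (?ev \<otimes> \<iota> d) \<odot> \<alpha>' d a d \<odot> (\<iota> d \<otimes> ?coev)
    = \<ell> b \<odot> (\<iota> \<one> \<otimes> \<phi>) \<odot> (?ev \<otimes> \<iota> d) \<odot> \<alpha>' d a d \<odot> (\<iota> d \<otimes> ?coev)"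
    using whisker[OF lu_nat[OF \<phi>(1)]] ev coev \<phi> \<psi> a b d by (simp del: no_fuse)
  also have "\<dots> = \<ell> b \<odot> (ev \<otimes> \<iota> b) \<odot> ((\<phi> \<otimes> \<iota> a) \<otimes> \<phi>) \<odot> \<alpha>' d a d \<odot> (\<iota> d \<otimes> ?coev)"
    using ev coev \<phi> \<psi> a b d by simp
  also have "\<dots> = \<ell> b \<odot> (ev \<otimes> \<iota> b) \<odot> \<alpha>' b a b \<odot> (\<phi> \<otimes> \<iota> a \<otimes> \<phi>) \<odot> (\<iota> d \<otimes> ?coev)"
    using asi_nat_whisker[of \<phi> "\<iota> a" \<phi> "\<iota> d \<otimes> ?coev", symmetric] ev coev \<phi> \<psi> a b d by (simp del: no_fuse)
  also have "(\<phi> \<otimes> \<iota> a \<otimes> \<phi>) \<odot> (\<iota> d \<otimes> ?coev) = (\<iota> b \<otimes> coev) \<odot> (\<phi> \<otimes> \<iota> \<one>)"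
    using ev coev \<phi> \<psi> a b d inv by simp
  also have "\<ell> b \<odot> (ev \<otimes> \<iota> b) \<odot> \<alpha>' b a b \<odot> (\<iota> b \<otimes> coev) \<odot> (\<phi> \<otimes> \<iota> \<one>)
    = (\<ell> b \<odot> (ev \<otimes> \<iota> b) \<odot> \<alpha>' b a b \<odot> (\<iota> b \<otimes> coev)) \<odot> (\<phi> \<otimes> \<iota> \<one>)"
    using ev coev \<phi> \<psi> a b d by (simp del: no_fuse)
  also have "\<dots> = \<phi> \<odot> \<rho> d" unfolding zig' using ru_nat[OF \<phi>(1)] \<phi> by simp
  finally have "\<ell> d \<odot> (?ev \<otimes> \<iota> d) \<odot> \<alpha>' d a d \<odot> (\<iota> d \<otimes> ?coev) = \<rho> d"
    by (rule cancel_left[where p' = \<psi>]) (use ev coev \<phi> \<psi> a b d inv in simp_all)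
  then show thesis using that[of a ?ev ?coev] ev coev \<phi> \<psi> a b d by simp
qed

definition fmap :: "('o, 'm, 'p, 'n, 'w) funct_scheme \<Rightarrow> ('o, 'm) arrow \<Rightarrow> ('p, 'n) arrow"
  where "fmap F f = Arrow (omap F (src f)) (mmap F (mor f)) (omap F (tgt f))"

lemma src_tgt_fmap [simp]: "src (fmap F f) = omap F (src f)" "tgt (fmap F f) = omap F (tgt f)"
  by (simp_all add: fmap_def)

context linear_functor
begin

lemma omap_obj [simp]: "a \<in> Obj\<^bsub>C\<^esub> \<Longrightarrow> omap F a \<in> Obj\<^bsub>D\<^esub>"
  by (rule omap_closed)

lemma arr_fmap [simp]: "arr C f \<Longrightarrow> arr D (fmap F f)"
  by (simp del: source.arr_src_tgt target.arr_src_tgt add: arr_def fmap_def mmap_closed)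

lemma fmap_cmp [simp]: "\<lbrakk>arr C g; arr C f; src g = tgt f\<rbrakk> \<Longrightarrow> fmap F (g \<odot>\<^bsub>C\<^esub> f) = fmap F g \<odot>\<^bsub>D\<^esub> fmap F f"
  by (simp del: source.arr_src_tgt target.arr_src_tgt
      add: arr_def fmap_def cmp_def mmap_Comp[of "src f" "tgt f" "tgt g"])

lemma fmap_ide [simp]: "a \<in> Obj\<^bsub>C\<^esub> \<Longrightarrow> fmap F (\<iota>\<^bsub>C\<^esub> a) = \<iota>\<^bsub>D\<^esub> (omap F a)"
  by (simp add: fmap_def ide_def mmap_Idn)

end

section \<open>Coherence of tensor functors\<close>

locale tensor_functor_arrows = tensor_functor C D F
  for C :: "('o, 'm::ab_group_add, 'k::field, 'z) tensor_cat_scheme"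
    and D :: "('p, 'n::ab_group_add, 'k, 'y) tensor_cat_scheme" (structure)
    and F :: "('o, 'm, 'p, 'n, 'w) tensor_funct_scheme"
begin

definition fm :: "'o \<Rightarrow> 'o \<Rightarrow> ('p, 'n) arrow"
  where "fm a b = Arrow (omap F a \<otimes>\<^sub>o omap F b) (Fmult F a b) (omap F (a \<otimes>\<^sub>o\<^bsub>C\<^esub> b))"

text \<open>Computations start at the image of a tensor product and break it up, so the inverse
  structure isomorphism is the one that is moved around. The coherence laws below are restated for
  it.\<close>

definition fmi :: "'o \<Rightarrow> 'o \<Rightarrow> ('p, 'n) arrow"
  where "fmi a b = inv_arrow D (fm a b)"

definition fu :: "('p, 'n) arrow"
  where "fu = Arrow \<one> (Funit F) (omap F \<one>\<^bsub>C\<^esub>)"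

definition fui :: "('p, 'n) arrow"
  where "fui = inv_arrow D fu"

lemma src_tgt_fm [simp]:
  "src (fm a b) = omap F a \<otimes>\<^sub>o omap F b" "tgt (fm a b) = omap F (a \<otimes>\<^sub>o\<^bsub>C\<^esub> b)"
  "src (fmi a b) = omap F (a \<otimes>\<^sub>o\<^bsub>C\<^esub> b)" "tgt (fmi a b) = omap F a \<otimes>\<^sub>o omap F b"
  "src fu = \<one>" "tgt fu = omap F \<one>\<^bsub>C\<^esub>" "src fui = omap F \<one>\<^bsub>C\<^esub>" "tgt fui = \<one>"
  by (simp_all add: fm_def fmi_def fu_def fui_def)

lemma fm_inverse:
  assumes "a \<in> Obj\<^bsub>C\<^esub>" "b \<in> Obj\<^bsub>C\<^esub>"
  shows arr_fm [simp]: "arr D (fm a b)" and arr_fmi [simp]: "arr D (fmi a b)"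
    and fm_fmi [simp]: "fm a b \<odot> fmi a b = \<iota> (omap F (a \<otimes>\<^sub>o\<^bsub>C\<^esub> b))"
    and fmi_fm [simp]: "fmi a b \<odot> fm a b = \<iota> (omap F a \<otimes>\<^sub>o omap F b)"
  using target.inv_arrow[of "fm a b"] Fmult_iso[OF assms] assms by (simp_all add: fm_def fmi_def)

lemma fu_inverse:
  shows arr_fu [simp]: "arr D fu" and arr_fui [simp]: "arr D fui"
    and fu_fui [simp]: "fu \<odot> fui = \<iota> (omap F \<one>\<^bsub>C\<^esub>)" and fui_fu [simp]: "fui \<odot> fu = \<iota> \<one>"
  using target.inv_arrow[of fu] Funit_iso by (simp_all add: fu_def fui_def)

lemma cancel_fm [simp]:
  "\<lbrakk>a \<in> Obj\<^bsub>C\<^esub>; b \<in> Obj\<^bsub>C\<^esub>; arr D t; tgt t = omap F (a \<otimes>\<^sub>o\<^bsub>C\<^esub> b)\<rbrakk> \<Longrightarrow> fm a b \<odot> fmi a b \<odot> t = t"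
  "\<lbrakk>a \<in> Obj\<^bsub>C\<^esub>; b \<in> Obj\<^bsub>C\<^esub>; arr D t; tgt t = omap F a \<otimes>\<^sub>o omap F b\<rbrakk> \<Longrightarrow> fmi a b \<odot> fm a b \<odot> t = t"
  "\<lbrakk>arr D t; tgt t = omap F \<one>\<^bsub>C\<^esub>\<rbrakk> \<Longrightarrow> fu \<odot> fui \<odot> t = t"
  "\<lbrakk>arr D t; tgt t = \<one>\<rbrakk> \<Longrightarrow> fui \<odot> fu \<odot> t = t"
  by (simp_all add: target.whisker[OF fm_fmi] target.whisker[OF fmi_fm] target.whisker[OF fu_fui]
      target.whisker[OF fui_fu])

lemma fm_nat:
  assumes "arr C f" "arr C g"
  shows "fm (tgt f) (tgt g) \<odot> (fmap F f \<otimes> fmap F g) = fmap F (f \<otimes>\<^bsub>C\<^esub> g) \<odot> fm (src f) (src g)"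
  using assms Fmult_natural[of "src f" "tgt f" "src g" "tgt g" "mor f" "mor g"]
  by (simp del: source.arr_src_tgt target.arr_src_tgt add: arr_def fmap_def fm_def tns_def cmp_def)

lemma fmi_nat:
  assumes f: "arr C f" and g: "arr C g"
  shows "fmi (tgt f) (tgt g) \<odot> fmap F (f \<otimes>\<^bsub>C\<^esub> g) = (fmap F f \<otimes> fmap F g) \<odot> fmi (src f) (src g)"
proof (rule target.cancel_left[where p = "fm (tgt f) (tgt g)" and p' = "fmi (tgt f) (tgt g)"])
  show "fm (tgt f) (tgt g) \<odot> fmi (tgt f) (tgt g) \<odot> fmap F (f \<otimes>\<^bsub>C\<^esub> g)
    = fm (tgt f) (tgt g) \<odot> (fmap F f \<otimes> fmap F g) \<odot> fmi (src f) (src g)"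
    using f g by (simp add: target.whisker[OF fm_nat])
qed (use f g in simp_all)

lemma fmi_nat_whisker:
  "\<lbrakk>arr C f; arr C g; arr D t; tgt t = omap F (src f \<otimes>\<^sub>o\<^bsub>C\<^esub> src g); tgt f = a; tgt g = b\<rbrakk>
    \<Longrightarrow> fmi a b \<odot> fmap F (f \<otimes>\<^bsub>C\<^esub> g) \<odot> t = (fmap F f \<otimes> fmap F g) \<odot> fmi (src f) (src g) \<odot> t"
  using target.whisker[OF fmi_nat, of f g t] by auto

lemma fmi_as:
  assumes ob: "a \<in> Obj\<^bsub>C\<^esub>" "b \<in> Obj\<^bsub>C\<^esub>" "c \<in> Obj\<^bsub>C\<^esub>"
  shows "(\<iota> (omap F a) \<otimes> fmi b c) \<odot> fmi a (b \<otimes>\<^sub>o\<^bsub>C\<^esub> c) \<odot> fmap F (\<alpha>\<^bsub>C\<^esub> a b c)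
    = \<alpha> (omap F a) (omap F b) (omap F c) \<odot> (fmi a b \<otimes> \<iota> (omap F c)) \<odot> fmi (a \<otimes>\<^sub>o\<^bsub>C\<^esub> b) c"
proof -
  have as: "fmap F (\<alpha>\<^bsub>C\<^esub> a b c) \<odot> fm (a \<otimes>\<^sub>o\<^bsub>C\<^esub> b) c \<odot> (fm a b \<otimes> \<iota> (omap F c))
    = fm a (b \<otimes>\<^sub>o\<^bsub>C\<^esub> c) \<odot> (\<iota> (omap F a) \<otimes> fm b c) \<odot> \<alpha> (omap F a) (omap F b) (omap F c)"
    using Fmult_Assoc[OF ob] by (simp add: fmap_def fm_def tns_def cmp_def ide_def as_def)
  let ?P = "fm (a \<otimes>\<^sub>o\<^bsub>C\<^esub> b) c \<odot> (fm a b \<otimes> \<iota> (omap F c))"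
    and ?P' = "(fmi a b \<otimes> \<iota> (omap F c)) \<odot> fmi (a \<otimes>\<^sub>o\<^bsub>C\<^esub> b) c"
  have P: "?P \<odot> ?P' = \<iota> (omap F ((a \<otimes>\<^sub>o\<^bsub>C\<^esub> b) \<otimes>\<^sub>o\<^bsub>C\<^esub> c))" "?P' \<odot> ?P = \<iota> ((omap F a \<otimes>\<^sub>o omap F b) \<otimes>\<^sub>o omap F c)"
    using ob by simp_all
  show ?thesis
  proof (rule target.cancel_right[where p = ?P and p' = ?P', OF _ P(1)])
    have "((\<iota> (omap F a) \<otimes> fmi b c) \<odot> fmi a (b \<otimes>\<^sub>o\<^bsub>C\<^esub> c) \<odot> fmap F (\<alpha>\<^bsub>C\<^esub> a b c)) \<odot> ?P
      = (\<iota> (omap F a) \<otimes> fmi b c) \<odot> fmi a (b \<otimes>\<^sub>o\<^bsub>C\<^esub> c) \<odot> fmap F (\<alpha>\<^bsub>C\<^esub> a b c) \<odot> ?P"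
      using ob by simp
    also have "\<dots> = \<alpha> (omap F a) (omap F b) (omap F c)"
      unfolding as using ob by simp
    also have "\<dots> = (\<alpha> (omap F a) (omap F b) (omap F c) \<odot> ?P') \<odot> ?P"
      using ob P(2) by simp
    finally show "((\<iota> (omap F a) \<otimes> fmi b c) \<odot> fmi a (b \<otimes>\<^sub>o\<^bsub>C\<^esub> c) \<odot> fmap F (\<alpha>\<^bsub>C\<^esub> a b c)) \<odot> ?P
      = (\<alpha> (omap F a) (omap F b) (omap F c) \<odot> ?P') \<odot> ?P" .
  qed (use ob in simp_all)
qed

lemma fmi_asi:
  assumes ob: "a \<in> Obj\<^bsub>C\<^esub>" "b \<in> Obj\<^bsub>C\<^esub>" "c \<in> Obj\<^bsub>C\<^esub>"
  shows "(fmi a b \<otimes> \<iota> (omap F c)) \<odot> fmi (a \<otimes>\<^sub>o\<^bsub>C\<^esub> b) c \<odot> fmap F (\<alpha>'\<^bsub>C\<^esub> a b c)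
    = \<alpha>' (omap F a) (omap F b) (omap F c) \<odot> (\<iota> (omap F a) \<otimes> fmi b c) \<odot> fmi a (b \<otimes>\<^sub>o\<^bsub>C\<^esub> c)"
proof (rule target.cancel_left[where p = "\<alpha> (omap F a) (omap F b) (omap F c)"
      and p' = "\<alpha>' (omap F a) (omap F b) (omap F c)"])
  have "\<alpha> (omap F a) (omap F b) (omap F c) \<odot> (fmi a b \<otimes> \<iota> (omap F c)) \<odot> fmi (a \<otimes>\<^sub>o\<^bsub>C\<^esub> b) c
      \<odot> fmap F (\<alpha>'\<^bsub>C\<^esub> a b c)
    = (\<iota> (omap F a) \<otimes> fmi b c) \<odot> fmi a (b \<otimes>\<^sub>o\<^bsub>C\<^esub> c) \<odot> fmap F (\<alpha>\<^bsub>C\<^esub> a b c) \<odot> fmap F (\<alpha>'\<^bsub>C\<^esub> a b c)"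
    using target.whisker3[OF fmi_as[OF ob]] ob by simp
  also have "\<dots> = (\<iota> (omap F a) \<otimes> fmi b c) \<odot> fmi a (b \<otimes>\<^sub>o\<^bsub>C\<^esub> c)"
    using ob by (simp flip: fmap_cmp)
  finally show "\<alpha> (omap F a) (omap F b) (omap F c) \<odot> (fmi a b \<otimes> \<iota> (omap F c)) \<odot> fmi (a \<otimes>\<^sub>o\<^bsub>C\<^esub> b) c
      \<odot> fmap F (\<alpha>'\<^bsub>C\<^esub> a b c)
    = \<alpha> (omap F a) (omap F b) (omap F c) \<odot> \<alpha>' (omap F a) (omap F b) (omap F c)
      \<odot> (\<iota> (omap F a) \<otimes> fmi b c) \<odot> fmi a (b \<otimes>\<^sub>o\<^bsub>C\<^esub> c)"
    using ob by simp
qed (use ob in simp_all)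

lemma fmap_lu:
  assumes a: "a \<in> Obj\<^bsub>C\<^esub>"
  shows "fmap F (\<ell>\<^bsub>C\<^esub> a) = \<ell> (omap F a) \<odot> (fui \<otimes> \<iota> (omap F a)) \<odot> fmi \<one>\<^bsub>C\<^esub> a"
proof -
  have "fmap F (\<ell>\<^bsub>C\<^esub> a) \<odot> fm \<one>\<^bsub>C\<^esub> a \<odot> (fu \<otimes> \<iota> (omap F a)) = \<ell> (omap F a)"
    using Fmult_Lunit[OF a] by (simp add: fmap_def fm_def fu_def tns_def cmp_def ide_def lu_def)
  then show ?thesis
    using target.whisker3[of "fmap F (\<ell>\<^bsub>C\<^esub> a)" "fm \<one>\<^bsub>C\<^esub> a" "fu \<otimes> \<iota> (omap F a)" "\<ell> (omap F a)"
        "(fui \<otimes> \<iota> (omap F a)) \<odot> fmi \<one>\<^bsub>C\<^esub> a"] a by simp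
qed

lemma fmap_ru:
  assumes a: "a \<in> Obj\<^bsub>C\<^esub>"
  shows "fmap F (\<rho>\<^bsub>C\<^esub> a) = \<rho> (omap F a) \<odot> (\<iota> (omap F a) \<otimes> fui) \<odot> fmi a \<one>\<^bsub>C\<^esub>"
proof -
  have "fmap F (\<rho>\<^bsub>C\<^esub> a) \<odot> fm a \<one>\<^bsub>C\<^esub> \<odot> (\<iota> (omap F a) \<otimes> fu) = \<rho> (omap F a)"
    using Fmult_Runit[OF a] by (simp add: fmap_def fm_def fu_def tns_def cmp_def ide_def ru_def)
  then show ?thesis
    using target.whisker3[of "fmap F (\<rho>\<^bsub>C\<^esub> a)" "fm a \<one>\<^bsub>C\<^esub>" "\<iota> (omap F a) \<otimes> fu" "\<rho> (omap F a)"
        "(\<iota> (omap F a) \<otimes> fui) \<odot> fmi a \<one>\<^bsub>C\<^esub>"] a by simp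
qed

lemma fmi_rui:
  assumes a: "a \<in> Obj\<^bsub>C\<^esub>"
  shows "fmi a \<one>\<^bsub>C\<^esub> \<odot> fmap F (\<rho>'\<^bsub>C\<^esub> a) = (\<iota> (omap F a) \<otimes> fu) \<odot> \<rho>' (omap F a)"
proof (rule target.cancel_left[where p = "\<rho> (omap F a) \<odot> (\<iota> (omap F a) \<otimes> fui)"
      and p' = "(\<iota> (omap F a) \<otimes> fu) \<odot> \<rho>' (omap F a)"])
  have "(\<rho> (omap F a) \<odot> (\<iota> (omap F a) \<otimes> fui)) \<odot> fmi a \<one>\<^bsub>C\<^esub> \<odot> fmap F (\<rho>'\<^bsub>C\<^esub> a)
    = fmap F (\<rho>\<^bsub>C\<^esub> a) \<odot> fmap F (\<rho>'\<^bsub>C\<^esub> a)"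
    using a by (simp add: fmap_ru)
  also have "\<dots> = \<iota> (omap F a)"
    using a by (simp flip: fmap_cmp)
  finally show "(\<rho> (omap F a) \<odot> (\<iota> (omap F a) \<otimes> fui)) \<odot> fmi a \<one>\<^bsub>C\<^esub> \<odot> fmap F (\<rho>'\<^bsub>C\<^esub> a)
    = (\<rho> (omap F a) \<odot> (\<iota> (omap F a) \<otimes> fui)) \<odot> (\<iota> (omap F a) \<otimes> fu) \<odot> \<rho>' (omap F a)"
    using a by simp
qed (use a in simp_all)

end

section \<open>Tensor functors preserve dual pairs\<close>

context tensor_functor_arrows
begin

definition fev :: "'o \<Rightarrow> 'o \<Rightarrow> ('o, 'm) arrow \<Rightarrow> ('p, 'n) arrow"
  where "fev d d' ev = fui \<odot> fmap F ev \<odot> fm d d'"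

definition fcoev :: "'o \<Rightarrow> 'o \<Rightarrow> ('o, 'm) arrow \<Rightarrow> ('p, 'n) arrow"
  where "fcoev d d' coev = fmi d' d \<odot> fmap F coev \<odot> fu"

text \<open>Apply the functor to \<open>zig\<close> and push all structure isomorphisms to the
  right. What remains on both sides is one isomorphism into the image of
  \<open>d \<otimes> \<one>\<close>, which is cancelled.\<close>

lemma fmap_zigzag:
  assumes ob: "d \<in> Obj\<^bsub>C\<^esub>" "d' \<in> Obj\<^bsub>C\<^esub>"
    and ev: "arr C ev" "src ev = d \<otimes>\<^sub>o\<^bsub>C\<^esub> d'" "tgt ev = \<one>\<^bsub>C\<^esub>"
    and coev: "arr C coev" "src coev = \<one>\<^bsub>C\<^esub>" "tgt coev = d' \<otimes>\<^sub>o\<^bsub>C\<^esub> d"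
    and zig: "\<ell>\<^bsub>C\<^esub> d \<odot>\<^bsub>C\<^esub> (ev \<otimes>\<^bsub>C\<^esub> \<iota>\<^bsub>C\<^esub> d) \<odot>\<^bsub>C\<^esub> \<alpha>'\<^bsub>C\<^esub> d d' d \<odot>\<^bsub>C\<^esub> (\<iota>\<^bsub>C\<^esub> d \<otimes>\<^bsub>C\<^esub> coev) = \<rho>\<^bsub>C\<^esub> d"
  shows "\<ell> (omap F d) \<odot> (fev d d' ev \<otimes> \<iota> (omap F d)) \<odot> \<alpha>' (omap F d) (omap F d') (omap F d)
    \<odot> (\<iota> (omap F d) \<otimes> fcoev d d' coev) = \<rho> (omap F d)" (is "?L = _")
proof (rule target.cancel_right[where p = "(\<iota> (omap F d) \<otimes> fui) \<odot> fmi d \<one>\<^bsub>C\<^esub>"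
      and p' = "fm d \<one>\<^bsub>C\<^esub> \<odot> (\<iota> (omap F d) \<otimes> fu)"])
  note [simp] = ob ev coev
  note [simp del] = target.no_fuse
  \<comment> \<open>The law \<open>fmi_asi\<close> with \<open>fmi d d'\<close> brought to the other
    side, where it supplies the \<open>fm d d'\<close> contained in \<open>fev\<close>.\<close>
  have asi: "fmi (d \<otimes>\<^sub>o\<^bsub>C\<^esub> d') d \<odot> fmap F (\<alpha>'\<^bsub>C\<^esub> d d' d) \<odot> t = (fm d d' \<otimes> \<iota> (omap F d))
    \<odot> \<alpha>' (omap F d) (omap F d') (omap F d) \<odot> (\<iota> (omap F d) \<otimes> fmi d' d) \<odot> fmi d (d' \<otimes>\<^sub>o\<^bsub>C\<^esub> d) \<odot> t"
    if t: "arr D t" "tgt t = omap F (d \<otimes>\<^sub>o\<^bsub>C\<^esub> d' \<otimes>\<^sub>o\<^bsub>C\<^esub> d)" for t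
  proof (rule target.cancel_left[where p = "fmi d d' \<otimes> \<iota> (omap F d)" and p' = "fm d d' \<otimes> \<iota> (omap F d)"])
    have "(fmi d d' \<otimes> \<iota> (omap F d)) \<odot> (fm d d' \<otimes> \<iota> (omap F d)) = \<iota> ((omap F d \<otimes>\<^sub>o omap F d') \<otimes>\<^sub>o omap F d)"
      by (simp add: target.no_fuse)
    from target.whisker[OF this] target.whisker3[OF fmi_asi[OF ob ob(1)] _ _ _ t(1)] t
    show "(fmi d d' \<otimes> \<iota> (omap F d)) \<odot> fmi (d \<otimes>\<^sub>o\<^bsub>C\<^esub> d') d \<odot> fmap F (\<alpha>'\<^bsub>C\<^esub> d d' d) \<odot> t
      = (fmi d d' \<otimes> \<iota> (omap F d)) \<odot> (fm d d' \<otimes> \<iota> (omap F d)) \<odot> \<alpha>' (omap F d) (omap F d') (omap F d)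
        \<odot> (\<iota> (omap F d) \<otimes> fmi d' d) \<odot> fmi d (d' \<otimes>\<^sub>o\<^bsub>C\<^esub> d) \<odot> t"
      by simp
  qed (use t in \<open>simp_all add: target.no_fuse\<close>)
  have "\<rho> (omap F d) \<odot> (\<iota> (omap F d) \<otimes> fui) \<odot> fmi d \<one>\<^bsub>C\<^esub>
    = fmap F (\<ell>\<^bsub>C\<^esub> d) \<odot> fmap F (ev \<otimes>\<^bsub>C\<^esub> \<iota>\<^bsub>C\<^esub> d) \<odot> fmap F (\<alpha>'\<^bsub>C\<^esub> d d' d) \<odot> fmap F (\<iota>\<^bsub>C\<^esub> d \<otimes>\<^bsub>C\<^esub> coev)"
    unfolding fmap_ru[OF ob(1), symmetric] zig[symmetric] by simp
  also have "\<dots> = \<ell> (omap F d) \<odot> (fui \<otimes> \<iota> (omap F d)) \<odot> (fmap F ev \<otimes> \<iota> (omap F d))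
      \<odot> fmi (d \<otimes>\<^sub>o\<^bsub>C\<^esub> d') d \<odot> fmap F (\<alpha>'\<^bsub>C\<^esub> d d' d) \<odot> fmap F (\<iota>\<^bsub>C\<^esub> d \<otimes>\<^bsub>C\<^esub> coev)"
    by (simp add: fmap_lu fmi_nat_whisker)
  also have "\<dots> = \<ell> (omap F d) \<odot> (fui \<otimes> \<iota> (omap F d)) \<odot> (fmap F ev \<otimes> \<iota> (omap F d))
      \<odot> (fm d d' \<otimes> \<iota> (omap F d)) \<odot> \<alpha>' (omap F d) (omap F d') (omap F d)
      \<odot> (\<iota> (omap F d) \<otimes> fmi d' d) \<odot> fmi d (d' \<otimes>\<^sub>o\<^bsub>C\<^esub> d) \<odot> fmap F (\<iota>\<^bsub>C\<^esub> d \<otimes>\<^bsub>C\<^esub> coev)"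
    by (simp add: asi)
  also have "fmi d (d' \<otimes>\<^sub>o\<^bsub>C\<^esub> d) \<odot> fmap F (\<iota>\<^bsub>C\<^esub> d \<otimes>\<^bsub>C\<^esub> coev)
    = (\<iota> (omap F d) \<otimes> fmap F coev) \<odot> (\<iota> (omap F d) \<otimes> fu) \<odot> (\<iota> (omap F d) \<otimes> fui) \<odot> fmi d \<one>\<^bsub>C\<^esub>"
    using fmi_nat[of "\<iota>\<^bsub>C\<^esub> d" coev] by (simp add: target.no_fuse)
  finally show "?L \<odot> (\<iota> (omap F d) \<otimes> fui) \<odot> fmi d \<one>\<^bsub>C\<^esub> = \<rho> (omap F d) \<odot> (\<iota> (omap F d) \<otimes> fui) \<odot> fmi d \<one>\<^bsub>C\<^esub>"
    by (simp add: target.no_fuse fev_def fcoev_def)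
qed (use ob ev coev in \<open>simp_all add: fev_def fcoev_def\<close>)

end

section \<open>The adjunction as a bijection between arrows\<close>

locale tensor_adjunction = tensor_functor_arrows C D F + linear_adjunction C D F G \<eta> \<epsilon>
  for C :: "('o, 'm::ab_group_add, 'k::field, 'z) tensor_cat_scheme"
    and D :: "('p, 'n::ab_group_add, 'k, 'y) tensor_cat_scheme" (structure)
    and F :: "('o, 'm, 'p, 'n, 'w) tensor_funct_scheme"
    and G :: "('p, 'n, 'o, 'm, 'v) funct_scheme"
    and \<eta> :: "'o \<Rightarrow> 'm"
    and \<epsilon> :: "'p \<Rightarrow> 'n"
begin

definition eta :: "'o \<Rightarrow> ('o, 'm) arrow"
  where "eta c = Arrow c (\<eta> c) (omap G (omap F c))"

definition eps :: "'p \<Rightarrow> ('p, 'n) arrow"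
  where "eps x = Arrow (omap F (omap G x)) (\<epsilon> x) x"

lemma src_tgt_eps [simp]:
  "src (eta c) = c" "tgt (eta c) = omap G (omap F c)" "src (eps x) = omap F (omap G x)" "tgt (eps x) = x"
  by (simp_all add: eta_def eps_def)

lemma arr_eta [simp]: "c \<in> Obj\<^bsub>C\<^esub> \<Longrightarrow> arr C (eta c)"
  by (simp add: arr_def eta_def unit_closed)

lemma arr_eps [simp]: "x \<in> Obj \<Longrightarrow> arr D (eps x)"
  by (simp add: arr_def eps_def counit_closed)

lemma eta_nat: "arr C f \<Longrightarrow> eta (tgt f) \<odot>\<^bsub>C\<^esub> f = fmap G (fmap F f) \<odot>\<^bsub>C\<^esub> eta (src f)"
  using unit_natural[of "src f" "tgt f" "mor f"]
  by (simp del: source.arr_src_tgt target.arr_src_tgt add: arr_def eta_def fmap_def cmp_def)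

lemma eps_nat: "arr D f \<Longrightarrow> eps (tgt f) \<odot> fmap F (fmap G f) = f \<odot> eps (src f)"
  using counit_natural[of "src f" "tgt f" "mor f"]
  by (simp del: source.arr_src_tgt target.arr_src_tgt add: arr_def eps_def fmap_def cmp_def)

lemma eps_fmap_eta: "c \<in> Obj\<^bsub>C\<^esub> \<Longrightarrow> eps (omap F c) \<odot> fmap F (eta c) = \<iota> (omap F c)"
  using triangle_left[of c] by (simp add: eps_def eta_def fmap_def cmp_def ide_def)

lemma fmap_eps_eta: "x \<in> Obj \<Longrightarrow> fmap G (eps x) \<odot>\<^bsub>C\<^esub> eta (omap G x) = \<iota>\<^bsub>C\<^esub> (omap G x)"
  using triangle_right[of x] by (simp add: eps_def eta_def fmap_def cmp_def ide_def)

text \<open>By the triangle identity, an arrow \<open>h\<close> into \<open>omap G x\<close> is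
  recovered from its transpose \<open>eps x \<odot> fmap F h\<close> by applying \<open>G\<close>
  and composing with the unit. All laws of the image algebra are verified through this.\<close>

lemma adjoint_inj:
  assumes eq: "eps x \<odot> fmap F f = eps x \<odot> fmap F g" and x: "x \<in> Obj"
    and f: "arr C f" "tgt f = omap G x" and g: "arr C g" "tgt g = omap G x" and src: "src f = src g"
  shows "f = g"
proof -
  have *: "h = fmap G (eps x \<odot> fmap F h) \<odot>\<^bsub>C\<^esub> eta (src h)" if h: "arr C h" "tgt h = omap G x" for h
  proof -
    have "fmap G (eps x \<odot> fmap F h) \<odot>\<^bsub>C\<^esub> eta (src h) = fmap G (eps x) \<odot>\<^bsub>C\<^esub> eta (omap G x) \<odot>\<^bsub>C\<^esub> h"
      using h x eta_nat[OF h(1)] by simp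
    also have "\<dots> = h" using h x by (simp add: source.whisker[OF fmap_eps_eta])
    finally show ?thesis by simp
  qed
  show ?thesis using *[OF f] *[OF g] eq src by simp
qed

text \<open>The witness is the usual transpose, the image of \<open>w\<close> under \<open>G\<close>
  after the unit at \<open>c\<close>.\<close>

lemma adjoint_exists:
  assumes w: "arr D w" "src w = omap F c" "tgt w = x" and c: "c \<in> Obj\<^bsub>C\<^esub>"
  obtains f where "arr C f" "src f = c" "tgt f = omap G x" "eps x \<odot> fmap F f = w"
proof
  let ?f = "fmap G w \<odot>\<^bsub>C\<^esub> eta c"
  have "eps x \<odot> fmap F ?f = (eps x \<odot> fmap F (fmap G w)) \<odot> fmap F (eta c)"
    using w c by auto
  also have "eps x \<odot> fmap F (fmap G w) = w \<odot> eps (omap F c)"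
    using eps_nat[OF w(1)] w by simp
  also have "(w \<odot> eps (omap F c)) \<odot> fmap F (eta c) = w"
    using w c by (simp add: eps_fmap_eta)
  finally show "eps x \<odot> fmap F ?f = w" .
qed (use w c in auto)

definition mu :: "'p \<Rightarrow> 'p \<Rightarrow> ('o, 'm) arrow"
  where "mu x y = Arrow (omap G x \<otimes>\<^sub>o\<^bsub>C\<^esub> omap G y) (adj_mu C D F G \<epsilon> x y) (omap G (x \<otimes>\<^sub>o y))"

lemma src_tgt_mu [simp]:
  "src (mu x y) = omap G x \<otimes>\<^sub>o\<^bsub>C\<^esub> omap G y" "tgt (mu x y) = omap G (x \<otimes>\<^sub>o y)"
  by (simp_all add: mu_def)

text \<open>The defining condition of \<open>adj_mu\<close>, with \<open>Fmult\<close> inverted and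
  moved to the other side, prescribes the transpose of a morphism. The adjunction then gives
  existence and uniqueness, so the definite description denotes.\<close>

lemma
  assumes x: "x \<in> Obj" and y: "y \<in> Obj"
  shows arr_mu [simp]: "arr C (mu x y)"
    and eps_mu: "eps (x \<otimes>\<^sub>o y) \<odot> fmap F (mu x y) = (eps x \<otimes> eps y) \<odot> fmi (omap G x) (omap G y)"
proof -
  let ?s = "omap G x \<otimes>\<^sub>o\<^bsub>C\<^esub> omap G y" and ?t = "omap G (x \<otimes>\<^sub>o y)"
  define Q where "Q = (\<lambda>h. h \<in> Hom\<^bsub>C\<^esub> ?s ?t \<and>
    \<epsilon> (x \<otimes>\<^sub>o y) \<cdot> mmap F h \<cdot> Fmult F (omap G x) (omap G y) = \<epsilon> x \<otimes>\<^sub>m \<epsilon> y)"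
  have ob: "?s \<in> Obj\<^bsub>C\<^esub>" "?t \<in> Obj\<^bsub>C\<^esub>" using x y by simp_all
  have Q: "Q h \<longleftrightarrow> arr C (Arrow ?s h ?t) \<and>
    eps (x \<otimes>\<^sub>o y) \<odot> fmap F (Arrow ?s h ?t) = (eps x \<otimes> eps y) \<odot> fmi (omap G x) (omap G y)" for h
  proof -
    have "Q h \<longleftrightarrow> arr C (Arrow ?s h ?t) \<and>
      eps (x \<otimes>\<^sub>o y) \<odot> fmap F (Arrow ?s h ?t) \<odot> fm (omap G x) (omap G y) = eps x \<otimes> eps y"
      using ob by (simp del: source.arr_src_tgt add: Q_def arr_def eps_def fmap_def fm_def cmp_def tns_def)
    moreover have "eps (x \<otimes>\<^sub>o y) \<odot> fmap F f \<odot> fm (omap G x) (omap G y) = eps x \<otimes> eps y \<longleftrightarrow>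
        eps (x \<otimes>\<^sub>o y) \<odot> fmap F f = (eps x \<otimes> eps y) \<odot> fmi (omap G x) (omap G y)"
      if f: "arr C f" "src f = ?s" "tgt f = ?t" for f
    proof
      assume "eps (x \<otimes>\<^sub>o y) \<odot> fmap F f \<odot> fm (omap G x) (omap G y) = eps x \<otimes> eps y"
      from target.whisker3[OF this, of "fmi (omap G x) (omap G y)"]
      show "eps (x \<otimes>\<^sub>o y) \<odot> fmap F f = (eps x \<otimes> eps y) \<odot> fmi (omap G x) (omap G y)"
        using f x y by simp
    next
      assume "eps (x \<otimes>\<^sub>o y) \<odot> fmap F f = (eps x \<otimes> eps y) \<odot> fmi (omap G x) (omap G y)"
      from target.whisker[OF this, of "fm (omap G x) (omap G y)"]
      show "eps (x \<otimes>\<^sub>o y) \<odot> fmap F f \<odot> fm (omap G x) (omap G y) = eps x \<otimes> eps y"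
        using f x y by simp
    qed
    ultimately show ?thesis by auto
  qed
  have "arr D ((eps x \<otimes> eps y) \<odot> fmi (omap G x) (omap G y))" using x y by simp
  then obtain f where f: "arr C f" "src f = ?s" "tgt f = ?t"
    and ef: "eps (x \<otimes>\<^sub>o y) \<odot> fmap F f = (eps x \<otimes> eps y) \<odot> fmi (omap G x) (omap G y)"
    by (rule adjoint_exists[of _ ?s "x \<otimes>\<^sub>o y"]) (use ob in simp_all)
  have fe: "f = Arrow ?s (mor f) ?t" using f by (cases f) simp
  have "Q (mor f)" using f(1) ef fe Q by metis
  moreover have "h = mor f" if "Q h" for h
  proof -
    have "Arrow ?s h ?t = f"
      by (rule adjoint_inj[of "x \<otimes>\<^sub>o y"]) (use that x y f ef in \<open>simp_all add: Q\<close>)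
    then show ?thesis by (cases f) simp
  qed
  ultimately have "Q (THE h. Q h)" by (rule theI)
  moreover have "(THE h. Q h) = adj_mu C D F G \<epsilon> x y" by (simp add: adj_mu_def Q_def)
  ultimately have "Q (adj_mu C D F G \<epsilon> x y)" by simp
  then show "arr C (mu x y)"
    and "eps (x \<otimes>\<^sub>o y) \<odot> fmap F (mu x y) = (eps x \<otimes> eps y) \<odot> fmi (omap G x) (omap G y)"
    by (simp_all add: Q mu_def)
qed

end

section \<open>The algebra in the image of the right adjoint\<close>

locale adjoint_algebra = tensor_adjunction C D F G \<eta> \<epsilon> + alg: arrow_algebra D A \<mu> \<upsilon>
  for C :: "('o, 'm::ab_group_add, 'k::field, 'z) tensor_cat_scheme"
    and D :: "('p, 'n::ab_group_add, 'k, 'y) tensor_cat_scheme" (structure)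
    and F :: "('o, 'm, 'p, 'n, 'w) tensor_funct_scheme"
    and G :: "('p, 'n, 'o, 'm, 'v) funct_scheme"
    and \<eta> :: "'o \<Rightarrow> 'm"
    and \<epsilon> :: "'p \<Rightarrow> 'n"
    and A :: 'p and \<mu> \<upsilon> :: "('p, 'n) arrow"
begin

abbreviation B :: 'o
  where "B \<equiv> omap G A"

abbreviation FB :: 'p
  where "FB \<equiv> omap F (omap G A)"

definition multB :: "('o, 'm) arrow"
  where "multB = fmap G \<mu> \<odot>\<^bsub>C\<^esub> mu A A"

definition unitB :: "('o, 'm) arrow"
  where "unitB = fmap G \<upsilon> \<odot>\<^bsub>C\<^esub> fmap G fui \<odot>\<^bsub>C\<^esub> eta \<one>\<^bsub>C\<^esub>"

lemma arr_multB [simp]: "arr C multB" "src multB = B \<otimes>\<^sub>o\<^bsub>C\<^esub> B" "tgt multB = B"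
  by (simp_all add: multB_def)

lemma arr_unitB [simp]: "arr C unitB" "src unitB = \<one>\<^bsub>C\<^esub>" "tgt unitB = B"
  by (simp_all add: unitB_def)

text \<open>The counit at \<open>A\<close> is multiplicative. Together with compatibility with
  units, it reduces laws of the image algebra to those of \<open>A\<close> after
  transposing.\<close>

lemma eps_multB: "eps A \<odot> fmap F multB = \<mu> \<odot> (eps A \<otimes> eps A) \<odot> fmi B B"
proof -
  have "eps A \<odot> fmap F multB = (eps A \<odot> fmap F (fmap G \<mu>)) \<odot> fmap F (mu A A)"
    by (simp add: multB_def)
  also have "eps A \<odot> fmap F (fmap G \<mu>) = \<mu> \<odot> eps (A \<otimes>\<^sub>o A)" using eps_nat[of \<mu>] by simp
  also have "(\<mu> \<odot> eps (A \<otimes>\<^sub>o A)) \<odot> fmap F (mu A A) = \<mu> \<odot> (eps A \<otimes> eps A) \<odot> fmi B B"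
    by (simp add: eps_mu)
  finally show ?thesis .
qed

lemma eps_unitB: "eps A \<odot> fmap F unitB = \<upsilon> \<odot> fui"
proof -
  have "unitB = fmap G (\<upsilon> \<odot> fui) \<odot>\<^bsub>C\<^esub> eta \<one>\<^bsub>C\<^esub>" by (simp add: unitB_def)
  then have "eps A \<odot> fmap F unitB = (eps A \<odot> fmap F (fmap G (\<upsilon> \<odot> fui))) \<odot> fmap F (eta \<one>\<^bsub>C\<^esub>)"
    by simp
  also have "eps A \<odot> fmap F (fmap G (\<upsilon> \<odot> fui)) = (\<upsilon> \<odot> fui) \<odot> eps (omap F \<one>\<^bsub>C\<^esub>)"
    using eps_nat[of "\<upsilon> \<odot> fui"] by simp
  also have "((\<upsilon> \<odot> fui) \<odot> eps (omap F \<one>\<^bsub>C\<^esub>)) \<odot> fmap F (eta \<one>\<^bsub>C\<^esub>) = \<upsilon> \<odot> fui"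
    by (simp add: eps_fmap_eta)
  finally show ?thesis .
qed

lemma eps_multB_whisker:
  "\<lbrakk>arr D t; tgt t = omap F (B \<otimes>\<^sub>o\<^bsub>C\<^esub> B)\<rbrakk>
    \<Longrightarrow> eps A \<odot> fmap F multB \<odot> t = \<mu> \<odot> (eps A \<otimes> eps A) \<odot> fmi B B \<odot> t"
  using target.whisker[OF eps_multB, of t] by simp

text \<open>Both sides have the same transpose: multiplicativity of the counit turns them into
  triple products in \<open>A\<close>, and \<open>fmi_as\<close> matches the associators of the two
  categories.\<close>

lemma multB_assoc:
  "multB \<odot>\<^bsub>C\<^esub> (multB \<otimes>\<^bsub>C\<^esub> \<iota>\<^bsub>C\<^esub> B) = multB \<odot>\<^bsub>C\<^esub> (\<iota>\<^bsub>C\<^esub> B \<otimes>\<^bsub>C\<^esub> multB) \<odot>\<^bsub>C\<^esub> \<alpha>\<^bsub>C\<^esub> B B B"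
proof (rule adjoint_inj[of A])
  define t where "t = ((eps A \<otimes> eps A) \<otimes> eps A) \<odot> (fmi B B \<otimes> \<iota> FB) \<odot> fmi (B \<otimes>\<^sub>o\<^bsub>C\<^esub> B) B"
  have t: "arr D t" "tgt t = (A \<otimes>\<^sub>o A) \<otimes>\<^sub>o A" by (simp_all add: t_def)
  have "eps A \<odot> fmap F (multB \<odot>\<^bsub>C\<^esub> (multB \<otimes>\<^bsub>C\<^esub> \<iota>\<^bsub>C\<^esub> B))
    = \<mu> \<odot> (eps A \<otimes> eps A) \<odot> (fmap F multB \<otimes> \<iota> FB) \<odot> fmi (B \<otimes>\<^sub>o\<^bsub>C\<^esub> B) B"
    using fmi_nat[of multB "\<iota>\<^bsub>C\<^esub> B"] by (simp del: target.no_fuse add: eps_multB_whisker)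
  also have "\<dots> = (\<mu> \<odot> (\<mu> \<otimes> \<iota> A)) \<odot> t"
    by (simp add: eps_multB t_def)
  also have "\<dots> = \<mu> \<odot> (\<iota> A \<otimes> \<mu>) \<odot> \<alpha> A A A \<odot> t"
    unfolding alg.mult_assoc using t by simp
  also have "\<alpha> A A A \<odot> t = (eps A \<otimes> eps A \<otimes> eps A) \<odot> \<alpha> FB FB FB \<odot> (fmi B B \<otimes> \<iota> FB) \<odot> fmi (B \<otimes>\<^sub>o\<^bsub>C\<^esub> B) B"
    by (simp del: target.no_fuse add: t_def target.as_nat_whisker)
  also have "\<dots> = (eps A \<otimes> eps A \<otimes> eps A) \<odot> (\<iota> FB \<otimes> fmi B B) \<odot> fmi B (B \<otimes>\<^sub>o\<^bsub>C\<^esub> B) \<odot> fmap F (\<alpha>\<^bsub>C\<^esub> B B B)"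
    by (simp add: fmi_as)
  also have "\<mu> \<odot> (\<iota> A \<otimes> \<mu>) \<odot> \<dots>
    = \<mu> \<odot> (eps A \<otimes> eps A) \<odot> (\<iota> FB \<otimes> fmap F multB) \<odot> fmi B (B \<otimes>\<^sub>o\<^bsub>C\<^esub> B) \<odot> fmap F (\<alpha>\<^bsub>C\<^esub> B B B)"
    by (simp add: eps_multB)
  also have "\<dots> = eps A \<odot> fmap F (multB \<odot>\<^bsub>C\<^esub> (\<iota>\<^bsub>C\<^esub> B \<otimes>\<^bsub>C\<^esub> multB) \<odot>\<^bsub>C\<^esub> \<alpha>\<^bsub>C\<^esub> B B B)"
    by (simp del: target.no_fuse add: eps_multB_whisker fmi_nat_whisker)
  finally show "eps A \<odot> fmap F (multB \<odot>\<^bsub>C\<^esub> (multB \<otimes>\<^bsub>C\<^esub> \<iota>\<^bsub>C\<^esub> B))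
    = eps A \<odot> fmap F (multB \<odot>\<^bsub>C\<^esub> (\<iota>\<^bsub>C\<^esub> B \<otimes>\<^bsub>C\<^esub> multB) \<odot>\<^bsub>C\<^esub> \<alpha>\<^bsub>C\<^esub> B B B)" .
qed simp_all

lemma multB_unit_left: "multB \<odot>\<^bsub>C\<^esub> (unitB \<otimes>\<^bsub>C\<^esub> \<iota>\<^bsub>C\<^esub> B) = \<ell>\<^bsub>C\<^esub> B"
proof (rule adjoint_inj[of A])
  have "eps A \<odot> fmap F (multB \<odot>\<^bsub>C\<^esub> (unitB \<otimes>\<^bsub>C\<^esub> \<iota>\<^bsub>C\<^esub> B))
    = \<mu> \<odot> (eps A \<otimes> eps A) \<odot> (fmap F unitB \<otimes> \<iota> FB) \<odot> fmi \<one>\<^bsub>C\<^esub> B"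
    using fmi_nat[of unitB "\<iota>\<^bsub>C\<^esub> B"] by (simp del: target.no_fuse add: eps_multB_whisker)
  also have "\<dots> = (\<mu> \<odot> (\<upsilon> \<otimes> \<iota> A)) \<odot> (\<iota> \<one> \<otimes> eps A) \<odot> (fui \<otimes> \<iota> FB) \<odot> fmi \<one>\<^bsub>C\<^esub> B"
    by (simp add: eps_unitB)
  also have "\<dots> = eps A \<odot> \<ell> FB \<odot> (fui \<otimes> \<iota> FB) \<odot> fmi \<one>\<^bsub>C\<^esub> B"
    unfolding alg.mult_unit_left using target.whisker[OF target.lu_nat[of "eps A"]]
    by (simp del: target.no_fuse)
  also have "\<dots> = eps A \<odot> fmap F (\<ell>\<^bsub>C\<^esub> B)" by (simp add: fmap_lu)
  finally show "eps A \<odot> fmap F (multB \<odot>\<^bsub>C\<^esub> (unitB \<otimes>\<^bsub>C\<^esub> \<iota>\<^bsub>C\<^esub> B)) = eps A \<odot> fmap F (\<ell>\<^bsub>C\<^esub> B)" .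
qed simp_all

lemma multB_unit_right: "multB \<odot>\<^bsub>C\<^esub> (\<iota>\<^bsub>C\<^esub> B \<otimes>\<^bsub>C\<^esub> unitB) = \<rho>\<^bsub>C\<^esub> B"
proof (rule adjoint_inj[of A])
  have "eps A \<odot> fmap F (multB \<odot>\<^bsub>C\<^esub> (\<iota>\<^bsub>C\<^esub> B \<otimes>\<^bsub>C\<^esub> unitB))
    = \<mu> \<odot> (eps A \<otimes> eps A) \<odot> (\<iota> FB \<otimes> fmap F unitB) \<odot> fmi B \<one>\<^bsub>C\<^esub>"
    using fmi_nat[of "\<iota>\<^bsub>C\<^esub> B" unitB] by (simp del: target.no_fuse add: eps_multB_whisker)
  also have "\<dots> = (\<mu> \<odot> (\<iota> A \<otimes> \<upsilon>)) \<odot> (eps A \<otimes> \<iota> \<one>) \<odot> (\<iota> FB \<otimes> fui) \<odot> fmi B \<one>\<^bsub>C\<^esub>"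
    by (simp add: eps_unitB)
  also have "\<dots> = eps A \<odot> \<rho> FB \<odot> (\<iota> FB \<otimes> fui) \<odot> fmi B \<one>\<^bsub>C\<^esub>"
    unfolding alg.mult_unit_right using target.whisker[OF target.ru_nat[of "eps A"]]
    by (simp del: target.no_fuse)
  also have "\<dots> = eps A \<odot> fmap F (\<rho>\<^bsub>C\<^esub> B)" by (simp add: fmap_ru)
  finally show "eps A \<odot> fmap F (multB \<odot>\<^bsub>C\<^esub> (\<iota>\<^bsub>C\<^esub> B \<otimes>\<^bsub>C\<^esub> unitB)) = eps A \<odot> fmap F (\<rho>\<^bsub>C\<^esub> B)" .
qed simp_all

sublocale adj: arrow_algebra C B multB unitB
  by unfold_locales (simp_all add: multB_assoc multB_unit_left multB_unit_right)

text \<open>The morphism \<open>F (B \<otimes> c) \<rightarrow> A \<otimes> F c\<close> is semilinear along the counit \<open>F B \<rightarrow> A\<close>, and it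
  exhibits \<open>B \<otimes> c\<close> as the value of \<open>G\<close> at \<open>A \<otimes> F c\<close> when \<open>c\<close> is rigid.\<close>

definition free :: "'o \<Rightarrow> ('p, 'n) arrow"
  where "free c = (eps A \<otimes> \<iota> (omap F c)) \<odot> fmi B c"

lemma arr_free [simp]: "c \<in> Obj\<^bsub>C\<^esub> \<Longrightarrow> arr D (free c)"
  "src (free c) = omap F (B \<otimes>\<^sub>o\<^bsub>C\<^esub> c)" "tgt (free c) = A \<otimes>\<^sub>o omap F c"
  by (simp_all add: free_def)

text \<open>Multiplicativity of the counit, tensored with the image of \<open>c\<close>; the
  associators are matched by \<open>fmi_asi\<close>. This square lets linearity pass between the two
  algebras.\<close>

lemma free_semilinear:
  assumes c: "c \<in> Obj\<^bsub>C\<^esub>"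
  shows "free c \<odot> fmap F (adj.act c) = alg.act (omap F c) \<odot> (eps A \<otimes> free c) \<odot> fmi B (B \<otimes>\<^sub>o\<^bsub>C\<^esub> c)"
proof -
  let ?c = "omap F c"
  have "free c \<odot> fmap F (adj.act c)
    = (eps A \<otimes> \<iota> ?c) \<odot> (fmap F multB \<otimes> \<iota> ?c) \<odot> fmi (B \<otimes>\<^sub>o\<^bsub>C\<^esub> B) c \<odot> fmap F (\<alpha>'\<^bsub>C\<^esub> B B c)"
    using c by (simp del: target.no_fuse add: free_def adj.act_def fmi_nat_whisker)
  also have "\<dots> = (\<mu> \<otimes> \<iota> ?c) \<odot> ((eps A \<otimes> eps A) \<otimes> \<iota> ?c) \<odot> (fmi B B \<otimes> \<iota> ?c) \<odot> fmi (B \<otimes>\<^sub>o\<^bsub>C\<^esub> B) c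
      \<odot> fmap F (\<alpha>'\<^bsub>C\<^esub> B B c)"
    using c by (simp add: eps_multB)
  also have "\<dots> = (\<mu> \<otimes> \<iota> ?c) \<odot> ((eps A \<otimes> eps A) \<otimes> \<iota> ?c) \<odot> \<alpha>' FB FB ?c \<odot> (\<iota> FB \<otimes> fmi B c)
      \<odot> fmi B (B \<otimes>\<^sub>o\<^bsub>C\<^esub> c)"
    using c by (simp add: fmi_asi del: target.no_fuse)
  also have "\<dots> = (\<mu> \<otimes> \<iota> ?c) \<odot> \<alpha>' A A ?c \<odot> (eps A \<otimes> eps A \<otimes> \<iota> ?c) \<odot> (\<iota> FB \<otimes> fmi B c)
      \<odot> fmi B (B \<otimes>\<^sub>o\<^bsub>C\<^esub> c)"
    using c by (simp del: target.no_fuse add: target.asi_nat_whisker)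
  also have "\<dots> = alg.act ?c \<odot> (eps A \<otimes> free c) \<odot> fmi B (B \<otimes>\<^sub>o\<^bsub>C\<^esub> c)"
    using c by (simp add: free_def alg.act_def)
  finally show ?thesis .
qed

text \<open>Two kinds of transposition commute: moving \<open>d\<close> across with
  \<open>ev\<close> and then applying the adjunction is the same as applying \<open>free d\<close>
  and then moving the image of \<open>d\<close> across with \<open>fev\<close>.\<close>

lemma free_transpose:
  assumes ob: "d \<in> Obj\<^bsub>C\<^esub>" "d' \<in> Obj\<^bsub>C\<^esub>"
    and ev: "arr C ev" "src ev = d \<otimes>\<^sub>o\<^bsub>C\<^esub> d'" "tgt ev = \<one>\<^bsub>C\<^esub>"
    and u: "arr C u" "src u = e" "tgt u = B \<otimes>\<^sub>o\<^bsub>C\<^esub> d"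
  shows "eps A \<odot> fmap F (\<rho>\<^bsub>C\<^esub> B \<odot>\<^bsub>C\<^esub> (\<iota>\<^bsub>C\<^esub> B \<otimes>\<^bsub>C\<^esub> ev) \<odot>\<^bsub>C\<^esub> \<alpha>\<^bsub>C\<^esub> B d d' \<odot>\<^bsub>C\<^esub> (u \<otimes>\<^bsub>C\<^esub> \<iota>\<^bsub>C\<^esub> d'))
    = \<rho> A \<odot> (\<iota> A \<otimes> fev d d' ev) \<odot> \<alpha> A (omap F d) (omap F d')
      \<odot> ((free d \<odot> fmap F u) \<otimes> \<iota> (omap F d')) \<odot> fmi e d'"
proof -
  let ?d = "omap F d" and ?d' = "omap F d'"
  have e: "e \<in> Obj\<^bsub>C\<^esub>" using u by auto
  have fev: "arr D (fev d d' ev)" "src (fev d d' ev) = ?d \<otimes>\<^sub>o ?d'" "tgt (fev d d' ev) = \<one>"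
    using ob ev by (simp_all add: fev_def)
  have as: "fmi B (d \<otimes>\<^sub>o\<^bsub>C\<^esub> d') \<odot> fmap F (\<alpha>\<^bsub>C\<^esub> B d d')
    = (\<iota> FB \<otimes> fm d d') \<odot> \<alpha> FB ?d ?d' \<odot> (fmi B d \<otimes> \<iota> ?d') \<odot> fmi (B \<otimes>\<^sub>o\<^bsub>C\<^esub> d) d'"
    using ob by (simp flip: fmi_as)
  have "fmap F (\<rho>\<^bsub>C\<^esub> B \<odot>\<^bsub>C\<^esub> (\<iota>\<^bsub>C\<^esub> B \<otimes>\<^bsub>C\<^esub> ev) \<odot>\<^bsub>C\<^esub> \<alpha>\<^bsub>C\<^esub> B d d' \<odot>\<^bsub>C\<^esub> (u \<otimes>\<^bsub>C\<^esub> \<iota>\<^bsub>C\<^esub> d'))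
    = \<rho> FB \<odot> (\<iota> FB \<otimes> fui) \<odot> (\<iota> FB \<otimes> fmap F ev) \<odot> fmi B (d \<otimes>\<^sub>o\<^bsub>C\<^esub> d') \<odot> fmap F (\<alpha>\<^bsub>C\<^esub> B d d')
      \<odot> fmap F (u \<otimes>\<^bsub>C\<^esub> \<iota>\<^bsub>C\<^esub> d')"
    using ob ev u by (simp del: target.no_fuse add: fmap_ru fmi_nat_whisker)
  also have "\<dots> = \<rho> FB \<odot> (\<iota> FB \<otimes> fui) \<odot> (\<iota> FB \<otimes> fmap F ev) \<odot> (\<iota> FB \<otimes> fm d d') \<odot> \<alpha> FB ?d ?d'
      \<odot> (fmi B d \<otimes> \<iota> ?d') \<odot> fmi (B \<otimes>\<^sub>o\<^bsub>C\<^esub> d) d' \<odot> fmap F (u \<otimes>\<^bsub>C\<^esub> \<iota>\<^bsub>C\<^esub> d')"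
    using ob ev u by (simp del: target.no_fuse add: target.whisker[OF as])
  also have "\<dots> = \<rho> FB \<odot> (\<iota> FB \<otimes> fev d d' ev) \<odot> \<alpha> FB ?d ?d'
      \<odot> ((fmi B d \<odot> fmap F u) \<otimes> \<iota> ?d') \<odot> fmi e d'"
    using fmi_nat[of u "\<iota>\<^bsub>C\<^esub> d'"] ob ev u e by (simp add: fev_def)
  finally have 1: "fmap F (\<rho>\<^bsub>C\<^esub> B \<odot>\<^bsub>C\<^esub> (\<iota>\<^bsub>C\<^esub> B \<otimes>\<^bsub>C\<^esub> ev) \<odot>\<^bsub>C\<^esub> \<alpha>\<^bsub>C\<^esub> B d d' \<odot>\<^bsub>C\<^esub> (u \<otimes>\<^bsub>C\<^esub> \<iota>\<^bsub>C\<^esub> d'))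
    = \<rho> FB \<odot> (\<iota> FB \<otimes> fev d d' ev) \<odot> \<alpha> FB ?d ?d' \<odot> ((fmi B d \<odot> fmap F u) \<otimes> \<iota> ?d') \<odot> fmi e d'" .
  have rn: "eps A \<odot> \<rho> FB \<odot> t = \<rho> A \<odot> (eps A \<otimes> \<iota> \<one>) \<odot> t" if "arr D t" "tgt t = FB \<otimes>\<^sub>o \<one>" for t
    using target.whisker[OF target.ru_nat[of "eps A"], of t] that by simp
  have "eps A \<odot> \<rho> FB \<odot> (\<iota> FB \<otimes> fev d d' ev) \<odot> \<alpha> FB ?d ?d' \<odot> ((fmi B d \<odot> fmap F u) \<otimes> \<iota> ?d') \<odot> fmi e d'
    = \<rho> A \<odot> (\<iota> A \<otimes> fev d d' ev) \<odot> (eps A \<otimes> \<iota> ?d \<otimes> \<iota> ?d') \<odot> \<alpha> FB ?d ?d'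
      \<odot> ((fmi B d \<odot> fmap F u) \<otimes> \<iota> ?d') \<odot> fmi e d'"
    using ob u e fev by (simp add: rn)
  also have "\<dots> = \<rho> A \<odot> (\<iota> A \<otimes> fev d d' ev) \<odot> \<alpha> A ?d ?d' \<odot> ((eps A \<otimes> \<iota> ?d) \<otimes> \<iota> ?d')
      \<odot> ((fmi B d \<odot> fmap F u) \<otimes> \<iota> ?d') \<odot> fmi e d'"
    using ob u e fev by (simp del: target.no_fuse add: target.as_nat_whisker)
  also have "\<dots> = \<rho> A \<odot> (\<iota> A \<otimes> fev d d' ev) \<odot> \<alpha> A ?d ?d' \<odot> ((free d \<odot> fmap F u) \<otimes> \<iota> ?d') \<odot> fmi e d'"
    using ob u e fev by (simp add: free_def)
  finally show ?thesis unfolding 1 .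
qed

text \<open>By \<open>free_transpose\<close>, the adjoint transpose of \<open>T u\<close> depends on
  \<open>u\<close> only through \<open>free d \<odot> fmap F u\<close>. The adjunction recovers
  \<open>T u\<close> from it, and transposing back recovers \<open>u\<close>.\<close>

lemma free_inj:
  assumes ob: "d \<in> Obj\<^bsub>C\<^esub>" "d' \<in> Obj\<^bsub>C\<^esub>"
    and ev: "arr C ev" "src ev = d \<otimes>\<^sub>o\<^bsub>C\<^esub> d'" "tgt ev = \<one>\<^bsub>C\<^esub>"
    and coev: "arr C coev" "src coev = \<one>\<^bsub>C\<^esub>" "tgt coev = d' \<otimes>\<^sub>o\<^bsub>C\<^esub> d"
    and zig: "\<ell>\<^bsub>C\<^esub> d \<odot>\<^bsub>C\<^esub> (ev \<otimes>\<^bsub>C\<^esub> \<iota>\<^bsub>C\<^esub> d) \<odot>\<^bsub>C\<^esub> \<alpha>'\<^bsub>C\<^esub> d d' d \<odot>\<^bsub>C\<^esub> (\<iota>\<^bsub>C\<^esub> d \<otimes>\<^bsub>C\<^esub> coev) = \<rho>\<^bsub>C\<^esub> d"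
    and u: "arr C u" "tgt u = B \<otimes>\<^sub>o\<^bsub>C\<^esub> d" and v: "arr C v" "tgt v = B \<otimes>\<^sub>o\<^bsub>C\<^esub> d"
    and src: "src u = src v" and eq: "free d \<odot> fmap F u = free d \<odot> fmap F v"
  shows "u = v"
proof -
  define T where "T = (\<lambda>u. \<rho>\<^bsub>C\<^esub> B \<odot>\<^bsub>C\<^esub> (\<iota>\<^bsub>C\<^esub> B \<otimes>\<^bsub>C\<^esub> ev) \<odot>\<^bsub>C\<^esub> \<alpha>\<^bsub>C\<^esub> B d d' \<odot>\<^bsub>C\<^esub> (u \<otimes>\<^bsub>C\<^esub> \<iota>\<^bsub>C\<^esub> d'))"
  have B: "B \<in> Obj\<^bsub>C\<^esub>" by simp
  have T: "arr C (T w)" "tgt (T w) = B" "src (T w) = src w \<otimes>\<^sub>o\<^bsub>C\<^esub> d'"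
    if "arr C w" "tgt w = B \<otimes>\<^sub>o\<^bsub>C\<^esub> d" for w
    using that ob ev by (simp_all add: T_def)
  have "T u = T v"
  proof (rule adjoint_inj[of A])
    show "eps A \<odot> fmap F (T u) = eps A \<odot> fmap F (T v)"
      unfolding T_def free_transpose[OF ob ev u(1) src u(2)] free_transpose[OF ob ev v(1) refl v(2)] eq ..
  qed (use T u v src in simp_all)
  moreover note source.transpose_transpose[OF B ob ev coev zig u(1) src u(2)]
    source.transpose_transpose[OF B ob ev coev zig v(1) refl v(2)]
  ultimately show ?thesis unfolding T_def by metis
qed

text \<open>The chain of bijections is run backwards, and the resulting preimage is checked by
  transposing back in the target category.\<close>

lemma free_surj:
  assumes ob: "d \<in> Obj\<^bsub>C\<^esub>" "d' \<in> Obj\<^bsub>C\<^esub>" "e \<in> Obj\<^bsub>C\<^esub>"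
    and ev: "arr C ev" "src ev = d \<otimes>\<^sub>o\<^bsub>C\<^esub> d'" "tgt ev = \<one>\<^bsub>C\<^esub>"
    and coev: "arr C coev" "src coev = \<one>\<^bsub>C\<^esub>" "tgt coev = d' \<otimes>\<^sub>o\<^bsub>C\<^esub> d"
    and zig: "\<ell>\<^bsub>C\<^esub> d \<odot>\<^bsub>C\<^esub> (ev \<otimes>\<^bsub>C\<^esub> \<iota>\<^bsub>C\<^esub> d) \<odot>\<^bsub>C\<^esub> \<alpha>'\<^bsub>C\<^esub> d d' d \<odot>\<^bsub>C\<^esub> (\<iota>\<^bsub>C\<^esub> d \<otimes>\<^bsub>C\<^esub> coev) = \<rho>\<^bsub>C\<^esub> d"
    and w: "arr D w" "src w = omap F e" "tgt w = A \<otimes>\<^sub>o omap F d"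
  shows "\<exists>u. arr C u \<and> src u = e \<and> tgt u = B \<otimes>\<^sub>o\<^bsub>C\<^esub> d \<and> free d \<odot> fmap F u = w"
proof -
  let ?d = "omap F d" and ?d' = "omap F d'" and ?e = "omap F e"
  have fob: "?d \<in> Obj" "?d' \<in> Obj" "?e \<in> Obj" using ob by simp_all
  have fev: "arr D (fev d d' ev)" "src (fev d d' ev) = ?d \<otimes>\<^sub>o ?d'" "tgt (fev d d' ev) = \<one>"
    and fcoev: "arr D (fcoev d d' coev)" "src (fcoev d d' coev) = \<one>" "tgt (fcoev d d' coev) = ?d' \<otimes>\<^sub>o ?d"
    using ob ev coev by (simp_all add: fev_def fcoev_def)
  \<comment> \<open>Transposed in the target category, \<open>w\<close> has values in
    \<open>A\<close> alone, so the adjunction applies.\<close>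
  define w' where "w' = \<rho> A \<odot> (\<iota> A \<otimes> fev d d' ev) \<odot> \<alpha> A ?d ?d' \<odot> (w \<otimes> \<iota> ?d')"
  have w': "arr D w'" "src w' = ?e \<otimes>\<^sub>o ?d'" "tgt w' = A"
    using w fev fob by (simp_all add: w'_def)
  obtain v where v: "arr C v" "src v = e \<otimes>\<^sub>o\<^bsub>C\<^esub> d'" "tgt v = B" and epsv: "eps A \<odot> fmap F v = w' \<odot> fmi e d'"
    by (rule adjoint_exists[of "w' \<odot> fmi e d'" "e \<otimes>\<^sub>o\<^bsub>C\<^esub> d'" A]) (use w' ob in simp_all)
  define u where "u = (v \<otimes>\<^bsub>C\<^esub> \<iota>\<^bsub>C\<^esub> d) \<odot>\<^bsub>C\<^esub> \<alpha>'\<^bsub>C\<^esub> e d' d \<odot>\<^bsub>C\<^esub> (\<iota>\<^bsub>C\<^esub> e \<otimes>\<^bsub>C\<^esub> coev) \<odot>\<^bsub>C\<^esub> \<rho>'\<^bsub>C\<^esub> e"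
  have u: "arr C u" "src u = e" "tgt u = B \<otimes>\<^sub>o\<^bsub>C\<^esub> d"
    using v ob coev by (simp_all add: u_def)
  have "free d \<odot> fmap F u = (eps A \<otimes> \<iota> ?d) \<odot> (fmap F v \<otimes> \<iota> ?d) \<odot> fmi (e \<otimes>\<^sub>o\<^bsub>C\<^esub> d') d
      \<odot> fmap F (\<alpha>'\<^bsub>C\<^esub> e d' d) \<odot> fmap F (\<iota>\<^bsub>C\<^esub> e \<otimes>\<^bsub>C\<^esub> coev) \<odot> fmap F (\<rho>'\<^bsub>C\<^esub> e)"
    using v ob coev by (simp del: target.no_fuse add: u_def free_def fmi_nat_whisker)
  also have "\<dots> = (w' \<otimes> \<iota> ?d) \<odot> (fmi e d' \<otimes> \<iota> ?d) \<odot> fmi (e \<otimes>\<^sub>o\<^bsub>C\<^esub> d') d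
      \<odot> fmap F (\<alpha>'\<^bsub>C\<^esub> e d' d) \<odot> fmap F (\<iota>\<^bsub>C\<^esub> e \<otimes>\<^bsub>C\<^esub> coev) \<odot> fmap F (\<rho>'\<^bsub>C\<^esub> e)"
    using v w' ob coev by (simp add: epsv)
  also have "\<dots> = (w' \<otimes> \<iota> ?d) \<odot> \<alpha>' ?e ?d' ?d \<odot> (\<iota> ?e \<otimes> fmi d' d) \<odot> fmi e (d' \<otimes>\<^sub>o\<^bsub>C\<^esub> d)
      \<odot> fmap F (\<iota>\<^bsub>C\<^esub> e \<otimes>\<^bsub>C\<^esub> coev) \<odot> fmap F (\<rho>'\<^bsub>C\<^esub> e)"
    using w' ob coev by (simp del: target.no_fuse add: target.whisker3[OF fmi_asi])
  also have "\<dots> = (w' \<otimes> \<iota> ?d) \<odot> \<alpha>' ?e ?d' ?d \<odot> (\<iota> ?e \<otimes> fmi d' d) \<odot> (\<iota> ?e \<otimes> fmap F coev)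
      \<odot> fmi e \<one>\<^bsub>C\<^esub> \<odot> fmap F (\<rho>'\<^bsub>C\<^esub> e)"
    using w' ob coev by (simp del: target.no_fuse add: fmi_nat_whisker)
  also have "\<dots> = (w' \<otimes> \<iota> ?d) \<odot> \<alpha>' ?e ?d' ?d \<odot> (\<iota> ?e \<otimes> fcoev d d' coev) \<odot> \<rho>' ?e"
    using w' ob coev by (simp add: fmi_rui fcoev_def)
  \<comment> \<open>The image of the dual pair is again a dual pair, so the second transposition
    undoes the first.\<close>
  also have "\<dots> = w"
    unfolding w'_def
    using target.transpose_transpose[OF alg.A_obj fob(1,2) fev fcoev _ w]
      fmap_zigzag[OF ob(1,2) ev coev zig]
      by simp
  finally show ?thesis using u by blast
qed

text \<open>The semilinear maps \<open>free\<close> translate between \<open>B\<close>-linear maps \<open>B \<otimes> c \<rightarrow> B \<otimes> d\<close> and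
  \<open>A\<close>-linear maps \<open>A \<otimes> F c \<rightarrow> A \<otimes> F d\<close>, compatibly with composition.\<close>

lemma free_regular:
  assumes rigid: "rigid_tensor_category C"
    and reg: "\<And>R S f. \<lbrakk>alg.is_module R; alg.is_module S; alg.is_linear R S f\<rbrakk>
      \<Longrightarrow> \<exists>g. alg.is_linear S R g \<and> f \<odot> g \<odot> f = f"
    and c: "c \<in> Obj\<^bsub>C\<^esub>" and d: "d \<in> Obj\<^bsub>C\<^esub>" and f: "adj.is_linear (adj.act c) (adj.act d) f"
  shows "\<exists>g. adj.is_linear (adj.act d) (adj.act c) g \<and> f \<odot>\<^bsub>C\<^esub> g \<odot>\<^bsub>C\<^esub> f = f"
proof -
  have inj: "u = v" if y: "y \<in> Obj\<^bsub>C\<^esub>" and uv: "arr C u" "tgt u = B \<otimes>\<^sub>o\<^bsub>C\<^esub> y" "arr C v" "tgt v = B \<otimes>\<^sub>o\<^bsub>C\<^esub> y"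
    "src u = src v" "free y \<odot> fmap F u = free y \<odot> fmap F v" for y u v
  proof -
    obtain d' ev coev where dual: "d' \<in> Obj\<^bsub>C\<^esub>" "arr C ev" "src ev = y \<otimes>\<^sub>o\<^bsub>C\<^esub> d'" "tgt ev = \<one>\<^bsub>C\<^esub>"
      "arr C coev" "src coev = \<one>\<^bsub>C\<^esub>" "tgt coev = d' \<otimes>\<^sub>o\<^bsub>C\<^esub> y"
      "\<ell>\<^bsub>C\<^esub> y \<odot>\<^bsub>C\<^esub> (ev \<otimes>\<^bsub>C\<^esub> \<iota>\<^bsub>C\<^esub> y) \<odot>\<^bsub>C\<^esub> \<alpha>'\<^bsub>C\<^esub> y d' y \<odot>\<^bsub>C\<^esub> (\<iota>\<^bsub>C\<^esub> y \<otimes>\<^bsub>C\<^esub> coev) = \<rho>\<^bsub>C\<^esub> y"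
      by (rule rigid_tensor_category.arrow_dual_exists[OF rigid y])
    show ?thesis by (rule free_inj[OF y dual uv])
  qed
  have fa: "arr C f" "src f = B \<otimes>\<^sub>o\<^bsub>C\<^esub> c" "tgt f = B \<otimes>\<^sub>o\<^bsub>C\<^esub> d"
    using adj.is_linear_arr[OF f] c d by simp_all
  \<comment> \<open>The restriction of \<open>f\<close> to generators. A linear map between free
    modules is rebuilt from it, and it can be carried to the target category as a plain
    arrow.\<close>
  define u where "u = f \<odot>\<^bsub>C\<^esub> adj.unt c"
  have u: "arr C u" "src u = c" "tgt u = B \<otimes>\<^sub>o\<^bsub>C\<^esub> d" using fa c by (simp_all add: u_def)
  have fu: "f = adj.act d \<odot>\<^bsub>C\<^esub> (\<iota>\<^bsub>C\<^esub> B \<otimes>\<^bsub>C\<^esub> u)"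
  proof -
    have "f = (f \<odot>\<^bsub>C\<^esub> adj.act c) \<odot>\<^bsub>C\<^esub> (\<iota>\<^bsub>C\<^esub> B \<otimes>\<^bsub>C\<^esub> adj.unt c)"
      using fa c by (simp add: adj.act_free_unit)
    also have "\<dots> = adj.act d \<odot>\<^bsub>C\<^esub> (\<iota>\<^bsub>C\<^esub> B \<otimes>\<^bsub>C\<^esub> u)"
      unfolding adj.is_linear_eq[OF f] using fa c d by (simp add: u_def)
    finally show ?thesis .
  qed
  define w where "w = free d \<odot> fmap F u"
  have w: "arr D w" "src w = omap F c" "tgt w = A \<otimes>\<^sub>o omap F d" using u d by (simp_all add: w_def)
  \<comment> \<open>The linear extension of the transported generators; it corresponds to
    \<open>f\<close> in the sense of \<open>rel\<close> below.\<close>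
  define f' where "f' = alg.act (omap F d) \<odot> (\<iota> A \<otimes> w)"
  have f': "alg.is_linear (alg.act (omap F c)) (alg.act (omap F d)) f'"
    unfolding f'_def
    using alg.is_linear_comp[OF alg.tensor_linear[OF w(1)]] alg.action_linear[OF alg.act_module] w d by simp
  have fa': "arr D f'" "src f' = A \<otimes>\<^sub>o omap F c" "tgt f' = A \<otimes>\<^sub>o omap F d"
    using alg.is_linear_arr[OF f'] c d by simp_all
  have rel: "free d \<odot> fmap F f = f' \<odot> free c"
  proof -
    have "free d \<odot> fmap F f = (free d \<odot> fmap F (adj.act d)) \<odot> fmap F (\<iota>\<^bsub>C\<^esub> B \<otimes>\<^bsub>C\<^esub> u)"
      using u d by (subst fu) simp
    also have "\<dots> = alg.act (omap F d) \<odot> (eps A \<otimes> free d) \<odot> (\<iota> FB \<otimes> fmap F u) \<odot> fmi B c"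
      unfolding free_semilinear[OF d] using u d fmi_nat[of "\<iota>\<^bsub>C\<^esub> B" u] by (simp del: target.no_fuse)
    also have "\<dots> = alg.act (omap F d) \<odot> (\<iota> A \<otimes> w) \<odot> (eps A \<otimes> \<iota> (omap F c)) \<odot> fmi B c"
      using u d c by (simp add: w_def)
    also have "\<dots> = f' \<odot> free c" using w d c by (simp add: f'_def free_def del: target.no_fuse)
    finally show ?thesis .
  qed
  obtain g' where g': "alg.is_linear (alg.act (omap F d)) (alg.act (omap F c)) g'"
    and fgf': "f' \<odot> g' \<odot> f' = f'"
    using reg[OF _ _ f'] alg.act_module c d by auto
  have ga': "arr D g'" "src g' = A \<otimes>\<^sub>o omap F d" "tgt g' = A \<otimes>\<^sub>o omap F c"
    using alg.is_linear_arr[OF g'] c d by simp_all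
  \<comment> \<open>Here \<open>free_surj\<close> is used with \<open>e\<close> equal to
    \<open>B \<otimes> d\<close>: the pseudo-inverse is lifted as a map on the whole free module,
    and its linearity is a separate matter.\<close>
  have "\<exists>g. arr C g \<and> src g = B \<otimes>\<^sub>o\<^bsub>C\<^esub> d \<and> tgt g = B \<otimes>\<^sub>o\<^bsub>C\<^esub> c \<and> free c \<odot> fmap F g = g' \<odot> free d"
  proof -
    obtain d' ev coev where dual: "d' \<in> Obj\<^bsub>C\<^esub>" "arr C ev" "src ev = c \<otimes>\<^sub>o\<^bsub>C\<^esub> d'" "tgt ev = \<one>\<^bsub>C\<^esub>"
      "arr C coev" "src coev = \<one>\<^bsub>C\<^esub>" "tgt coev = d' \<otimes>\<^sub>o\<^bsub>C\<^esub> c"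
      "\<ell>\<^bsub>C\<^esub> c \<odot>\<^bsub>C\<^esub> (ev \<otimes>\<^bsub>C\<^esub> \<iota>\<^bsub>C\<^esub> c) \<odot>\<^bsub>C\<^esub> \<alpha>'\<^bsub>C\<^esub> c d' c \<odot>\<^bsub>C\<^esub> (\<iota>\<^bsub>C\<^esub> c \<otimes>\<^bsub>C\<^esub> coev) = \<rho>\<^bsub>C\<^esub> c"
      by (rule rigid_tensor_category.arrow_dual_exists[OF rigid c])
    show ?thesis by (rule free_surj[OF c dual(1) _ dual(2-)]) (use ga' c d in simp_all)
  qed
  then obtain g where g: "arr C g" "src g = B \<otimes>\<^sub>o\<^bsub>C\<^esub> d" "tgt g = B \<otimes>\<^sub>o\<^bsub>C\<^esub> c"
    and rel': "free c \<odot> fmap F g = g' \<odot> free d" by blast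
  have "g \<odot>\<^bsub>C\<^esub> adj.act d = adj.act c \<odot>\<^bsub>C\<^esub> (\<iota>\<^bsub>C\<^esub> B \<otimes>\<^bsub>C\<^esub> g)"
  \<comment> \<open>Both sides agree after \<open>free c\<close>, because \<open>g'\<close> is
    linear and the maps \<open>free\<close> are semilinear.\<close>
  proof (rule inj[OF c])
    have "free c \<odot> fmap F (g \<odot>\<^bsub>C\<^esub> adj.act d) = g' \<odot> free d \<odot> fmap F (adj.act d)"
      using g c d ga' by (simp add: target.whisker[OF rel'])
    also have "\<dots> = (g' \<odot> alg.act (omap F d)) \<odot> (eps A \<otimes> free d) \<odot> fmi B (B \<otimes>\<^sub>o\<^bsub>C\<^esub> d)"
      unfolding free_semilinear[OF d] using ga' d by simp
    also have "\<dots> = alg.act (omap F c) \<odot> (\<iota> A \<otimes> g') \<odot> (eps A \<otimes> free d) \<odot> fmi B (B \<otimes>\<^sub>o\<^bsub>C\<^esub> d)"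
      unfolding alg.is_linear_eq[OF g'] using ga' c d by (simp del: target.no_fuse)
    also have "\<dots> = alg.act (omap F c) \<odot> (eps A \<otimes> free c) \<odot> (\<iota> FB \<otimes> fmap F g) \<odot> fmi B (B \<otimes>\<^sub>o\<^bsub>C\<^esub> d)"
      using ga' g c d by (simp add: rel')
    also have "\<dots> = (alg.act (omap F c) \<odot> (eps A \<otimes> free c) \<odot> fmi B (B \<otimes>\<^sub>o\<^bsub>C\<^esub> c)) \<odot> fmap F (\<iota>\<^bsub>C\<^esub> B \<otimes>\<^bsub>C\<^esub> g)"
      using g c d fmi_nat[of "\<iota>\<^bsub>C\<^esub> B" g] by (simp del: target.no_fuse)
    also have "\<dots> = free c \<odot> fmap F (adj.act c \<odot>\<^bsub>C\<^esub> (\<iota>\<^bsub>C\<^esub> B \<otimes>\<^bsub>C\<^esub> g))"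
      unfolding free_semilinear[OF c, symmetric] using g c by simp
    finally show "free c \<odot> fmap F (g \<odot>\<^bsub>C\<^esub> adj.act d) = free c \<odot> fmap F (adj.act c \<odot>\<^bsub>C\<^esub> (\<iota>\<^bsub>C\<^esub> B \<otimes>\<^bsub>C\<^esub> g))" .
  qed (use g c d in simp_all)
  then have "adj.is_linear (adj.act d) (adj.act c) g"
    using g c d by (simp add: adj.is_linear_def)
  moreover have "f \<odot>\<^bsub>C\<^esub> g \<odot>\<^bsub>C\<^esub> f = f"
  \<comment> \<open>The relations \<open>rel\<close> and \<open>rel'\<close> move
    \<open>free\<close> through the composite from left to right, turning the claim into
    \<open>f' \<odot> g' \<odot> f' = f'\<close>.\<close>
  proof (rule inj[OF d])
    have "free d \<odot> fmap F (f \<odot>\<^bsub>C\<^esub> g \<odot>\<^bsub>C\<^esub> f) = f' \<odot> free c \<odot> fmap F g \<odot> fmap F f"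
      using fa fa' g c d by (simp add: target.whisker[OF rel])
    also have "\<dots> = f' \<odot> g' \<odot> free d \<odot> fmap F f"
      using fa fa' ga' g c d by (simp add: target.whisker[OF rel'])
    also have "\<dots> = (f' \<odot> g' \<odot> f') \<odot> free c"
      using fa' ga' c d by (simp add: rel)
    also have "\<dots> = free d \<odot> fmap F f" unfolding fgf' rel ..
    finally show "free d \<odot> fmap F (f \<odot>\<^bsub>C\<^esub> g \<odot>\<^bsub>C\<^esub> f) = free d \<odot> fmap F f" .
  qed (use fa g in simp_all)
  ultimately show ?thesis by blast
qed

lemma mor_multB: "mor multB = adj_mult C D F G \<epsilon> A (mor \<mu>)"
  by (simp add: multB_def adj_mult_def cmp_def fmap_def mu_def)

lemma mor_unitB: "mor unitB = adj_unit C D F G \<eta> (mor \<upsilon>)"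
  by (simp add: unitB_def adj_unit_def cmp_def fmap_def eta_def fui_def fu_def inv_arrow_def)

end

theorem theorem5p1:
  fixes C :: "('o, 'm::ab_group_add, 'k::field) tensor_cat"
    and M :: "('p, 'n::ab_group_add, 'k) tensor_cat"
    and \<Phi> :: "('o, 'm, 'p, 'n) tensor_funct"
    and Tr :: "('p, 'n, 'o, 'm) funct"
    and \<eta> :: "'o \<Rightarrow> 'm"
    and \<epsilon> :: "'p \<Rightarrow> 'n"
    and A :: 'p and m :: 'n and i :: 'n
  assumes "rigid_tensor_category C" and "semisimple_category C"
    and "rigid_tensor_category M" and "semisimple_category M"
    and "tensor_functor C M \<Phi>"
    and "linear_adjunction C M \<Phi> Tr \<eta> \<epsilon>"
    and "semisimple_algebra M A m i"
  shows "semisimple_algebra C (omap Tr A) (adj_mult C M \<Phi> Tr \<epsilon> A m) (adj_unit C M \<Phi> Tr \<eta> i)"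
proof -
  interpret A: algebra_object M A m i
    using assms(7) by (simp add: semisimple_algebra_def)
  interpret adjoint_algebra C M \<Phi> Tr \<eta> \<epsilon> A "Arrow (A \<otimes>\<^sub>o\<^bsub>M\<^esub> A) m A" "Arrow \<one>\<^bsub>M\<^esub> i A"
    by (intro adjoint_algebra.intro tensor_adjunction.intro tensor_functor_arrows.intro assms(5,6)
        A.arrow_algebra_axioms)
  have reg: "regular_category (module_category M A m i)"
    using assms(7) semisimple_category.regular by (auto simp: semisimple_algebra_def)
  let ?mB = "adj_mult C M \<Phi> Tr \<epsilon> A m" and ?iB = "adj_unit C M \<Phi> Tr \<eta> i"
  \<comment> \<open>The interpretation \<open>B\<close> below is built from the raw morphisms, while
    \<open>free_regular\<close> speaks of \<open>multB\<close> and \<open>unitB\<close>. These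
    equations identify the two sets of derived notions.\<close>
  have mB: "multB = Arrow (omap Tr A \<otimes>\<^sub>o\<^bsub>C\<^esub> omap Tr A) ?mB (omap Tr A)"
    and iB: "unitB = Arrow \<one>\<^bsub>C\<^esub> ?iB (omap Tr A)"
    using arr_multB(2,3) arr_unitB(2,3) mor_multB mor_unitB by (metis arrow.collapse arrow.sel(2))+
  interpret B: algebra_object C "omap Tr A" ?mB ?iB
    using adj.algebra_object by (simp add: mor_multB mor_unitB)
  have "semisimple_category (module_category C (omap Tr A) ?mB ?iB)"
  proof (rule B.semisimple_modulesI)
    show "abelian_category C" using assms(2) by (simp add: semisimple_category_def)
    show "\<exists>g. B.is_linear (B.act d) (B.act c) g \<and> f \<odot>\<^bsub>C\<^esub> g \<odot>\<^bsub>C\<^esub> f = f"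
      if "c \<in> Obj\<^bsub>C\<^esub>" "d \<in> Obj\<^bsub>C\<^esub>" "B.is_linear (B.act c) (B.act d) f" for c d f
      using free_regular[OF assms(1) A.regular_modulesD[OF reg], unfolded mB iB, OF _ _ _ that] by blast
  qed
  then show ?thesis using B.algebra_object_axioms by (simp add: semisimple_algebra_def)
qed

end
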